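(* Let $d\geq 3$ be an integer and let $s=(d-3)+2\lambda$, with $0<\lambda<1$. Suppose that the support of the $s$-extremal measure $\mu_Q$ on $\mathbb{D}$ is the disk $\mathbb{D}_R$, and that the external field $Q$ is invariant with respect to rotations about the polar axis, that is $Q(x)=Q(r)$, where $x=(0,r\overline{x})\in\mathbb{D}_R$, $\overline{x}\in\mathbb{S}^{d-2}$, $0\leq r\leq R$. Also assume that $Q\in C^2(\mathbb{D}_R)$. Let $$F(t)=\frac{\sin(\lambda\pi)\,\Gamma((d-3)/2+\lambda)}{\pi^{(d+1)/2}\,\Gamma(\lambda)}\,\frac{1}{t}\,\frac{d}{dt}\int_t^R\frac{g(r)\,r\,dr}{(r^2-t^2)^{1-\lambda}},\quad 0\leq t\leq R,$$ with $$g(r)=\frac{1}{r^{d+2\lambda-4}}\,\frac{d}{dr}\int_0^r\frac{Q(u)\,u^{d-2}\,du}{(r^2-u^2)^{1-\lambda}},\quad 0\leq r\leq R.$$ Then for the extremal measure $\mu_Q$ we have $$d\mu_Q(x)=f(r)\,r^{d-2}\,dr\,d\sigma_{d-1}(\overline{x}),\quad x=(0,r\overline{x})\in\mathbb{D}_R,\ \overline{x}\in\mathbb{S}^{d-2},\ 0\leq r\leq R,$$ where the density $f$ is explicitly given by $$f(r)=C_Q\,(R^2-r^2)^{\lambda-1}+F(r),\quad 0\leq r\leq R,$$ with the constant $C_Q$ uniquely defined by $$C_Q=\frac{2\,\Gamma((d-1)/2+\lambda)}{\Gamma(\lambda)\,\Gamma((d-1)/2)}\,\frac{1}{R^{d+2\lambda-3}}\left\{\frac{\Gamma((d-1)/2)}{2\,\pi^{(d-1)/2}}-\int_0^R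 F(t)\,t^{d-2}\,dt\right\}.$$
   Context: $|\cdot|$ is the Euclidean norm on $\mathbb{R}^d$, $\mathbb{S}^{d-2}$ is the unit sphere of $\mathbb{R}^{d-1}$, and $\sigma_{d-1}$ is the (unnormalized) surface area measure on $\mathbb{S}^{d-2}$. The disk of radius $R$ is $\mathbb{D}_R=\{(x_1,\ldots,x_d)\in\mathbb{R}^d:x_1=0,\ x_2^2+\cdots+x_d^2\leq R^2\}$, $\mathbb{D}=\mathbb{D}_1$; its points are written $x=(0,r\overline{x})$ with $\overline{x}\in\mathbb{S}^{d-2}$, $0\leq r\leq R$. The polar axis is the $x_1$-axis. $\mathcal{M}(\mathbb{D})$ is the class of unit positive Borel measures supported on $\mathbb{D}$, and $I_s(\mu)=\iint|x-y|^{-s}\,d\mu(x)\,d\mu(y)$. An external field on $\mathbb{D}$ is a non-negative lower semicontinuous function $Q:\mathbb{D}\to[0,\infty]$ with $Q(x)<\infty$ on a set of positive surface area measure. The weighted energy is $I_Q(\mu)=I_s(\mu)+2\int Q\,d\mu$, and $V_Q=\inf\{I_Q(\mu):\mu\in\mathcal{M}(\mathbb{D})\}$. The $s$-extremal measure $\mu_Q\in\mathcal{M}(\mathbb{D})$ is the (unique) measure with $I_Q(\mu_Q)=V_Q$. *)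

theory Defs
  imports "HOL-Analysis.Analysis"
begin

text \<open>
  Euclidean space of dimension \<open>d\<close> is modelled as \<open>real \<times> 'a\<close> with \<open>'a\<close> an arbitrary Euclidean
  space of dimension \<open>d - 1\<close>. The first component is the coordinate along the polar axis, and
  the norm of the product type is the Euclidean norm.
\<close>

definition disk :: "real \<Rightarrow> (real \<times> 'a::euclidean_space) set" where
  "disk R = {0} \<times> cball 0 R"

text \<open>
  The unnormalized surface area measure on the unit sphere of \<open>'a\<close>, obtained from Lebesgue measure
  as the cone measure: the area of \<open>A\<close> is \<open>DIM('a)\<close> times the volume of the cone
  \<open>{t *\<^sub>R w | 0 < t \<le> 1, w \<in> A}\<close>; see \<open>emeasure_sphere_measure\<close> below.
\<close>

definition sphere_measure :: "'a::euclidean_space measure" where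
  "sphere_measure =
     scale_measure (of_nat DIM('a))
       (distr (restrict_space lborel (cball 0 1 - {0})) (restrict_space borel (sphere 0 1)) sgn)"

lemma emeasure_sphere_measure:
  fixes A :: "'a::euclidean_space set"
  assumes "A \<in> sets borel" "A \<subseteq> sphere 0 1"
  shows "emeasure sphere_measure A =
    of_nat DIM('a) * emeasure lborel {t *\<^sub>R w | t w. 0 < t \<and> t \<le> 1 \<and> w \<in> A}"
proof -
  let ?B = "cball (0::'a) 1 - {0}"
  have B: "?B \<inter> space lborel \<in> sets lborel" by simp
  have sp: "space (restrict_space lborel ?B) = ?B"
    by (simp add: space_restrict_space)
  have sgn1: "(sgn :: 'a \<Rightarrow> 'a) \<in> borel_measurable borel"
    unfolding sgn_div_norm by measurable
  have meas: "sgn \<in> measurable (restrict_space lborel ?B) (restrict_space borel (sphere (0::'a) 1))"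
    by (intro measurable_restrict_space2 measurable_restrict_space1)
      (use sgn1 in \<open>auto simp: space_restrict_space norm_sgn\<close>)
  have As: "A \<in> sets (restrict_space borel (sphere 0 1))"
    using assms by (auto simp: sets_restrict_space_iff)
  have eq: "sgn -` A \<inter> ?B = {t *\<^sub>R w | t w. 0 < t \<and> t \<le> 1 \<and> w \<in> A}"
  proof (intro equalityI subsetI)
    fix x assume x: "x \<in> sgn -` A \<inter> ?B"
    then have "x = norm x *\<^sub>R sgn x" by (simp add: sgn_div_norm)
    with x show "x \<in> {t *\<^sub>R w | t w. 0 < t \<and> t \<le> 1 \<and> w \<in> A}"
      by (intro CollectI exI[of _ "norm x"] exI[of _ "sgn x"]) auto
  next
    fix x assume "x \<in> {t *\<^sub>R w | t w. 0 < t \<and> t \<le> 1 \<and> w \<in> A}"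
    then obtain t w where *: "x = t *\<^sub>R w" "0 < t" "t \<le> 1" "w \<in> A" by auto
    then have "norm w = 1" using assms by auto
    then show "x \<in> sgn -` A \<inter> ?B" using *
      by (auto simp: sgn_scaleR sgn_div_norm)
  qed
  show ?thesis
    unfolding sphere_measure_def
    by (simp add: emeasure_distr[OF meas As] sp emeasure_restrict_space[OF B] flip: eq)
qed

definition msupport :: "'b::topological_space measure \<Rightarrow> 'b set" where
  "msupport \<mu> = {x. \<forall>U. open U \<and> x \<in> U \<longrightarrow> emeasure \<mu> U > 0}"

definition unit_measures_on :: "'b::topological_space set \<Rightarrow> 'b measure set" where
  "unit_measures_on K = {\<mu>. sets \<mu> = sets borel \<and> emeasure \<mu> UNIV = 1 \<and> msupport \<mu> \<subseteq> K}"

text \<open>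
  The reciprocal is taken in \<open>ennreal\<close>, so that for \<open>s > 0\<close> the kernel is infinite on the diagonal.
\<close>

definition riesz_energy :: "real \<Rightarrow> 'b::euclidean_space measure \<Rightarrow> ennreal" where
  "riesz_energy s \<mu> = (\<integral>\<^sup>+x. \<integral>\<^sup>+y. inverse (ennreal (norm (x - y) powr s)) \<partial>\<mu> \<partial>\<mu>)"

definition lower_semicontinuous_on ::
    "'b::topological_space set \<Rightarrow> ('b \<Rightarrow> 'c::linorder) \<Rightarrow> bool" where
  "lower_semicontinuous_on S f \<longleftrightarrow> (\<forall>c. openin (top_of_set S) {x \<in> S. c < f x})"

text \<open>
  External fields on the unit disk; only the values of \<open>Q\<close> on \<open>disk 1\<close> matter. The surface area
  measure on the flat disk is Lebesgue measure on \<open>'a\<close>.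
\<close>

definition external_field :: "(real \<times> 'a::euclidean_space \<Rightarrow> ennreal) \<Rightarrow> bool" where
  "external_field Q \<longleftrightarrow>
     lower_semicontinuous_on (disk 1) Q \<and>
     emeasure lborel {y::'a. (0, y) \<in> disk 1 \<and> Q (0, y) < \<infinity>} > 0"

definition weighted_energy ::
    "real \<Rightarrow> (real \<times> 'a::euclidean_space \<Rightarrow> ennreal) \<Rightarrow> (real \<times> 'a) measure \<Rightarrow> ennreal" where
  "weighted_energy s Q \<mu> = riesz_energy s \<mu> + 2 * (\<integral>\<^sup>+x \<in> disk 1. Q x \<partial>\<mu>)"

definition min_energy :: "real \<Rightarrow> (real \<times> 'a::euclidean_space \<Rightarrow> ennreal) \<Rightarrow> ennreal" where
  "min_energy s Q = (INF \<mu> \<in> unit_measures_on (disk 1). weighted_energy s Q \<mu>)"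

definition extremal_measure ::
    "real \<Rightarrow> (real \<times> 'a::euclidean_space \<Rightarrow> ennreal) \<Rightarrow> (real \<times> 'a) measure \<Rightarrow> bool" where
  "extremal_measure s Q \<mu> \<longleftrightarrow>
     \<mu> \<in> unit_measures_on (disk 1) \<and> weighted_energy s Q \<mu> = min_energy s Q"

text \<open>
  Twice continuously differentiable on \<open>S\<close>, with derivatives taken within \<open>S\<close>. On a closed ball this
  means \<open>C\<^sup>2\<close> in the interior with first and second derivatives extending continuously to the boundary.
\<close>

definition C2_on :: "'a::euclidean_space set \<Rightarrow> ('a \<Rightarrow> real) \<Rightarrow> bool" where
  "C2_on S f \<longleftrightarrow>
     (\<exists>(f' :: 'a \<Rightarrow> 'a \<Rightarrow>\<^sub>L real) (f'' :: 'a \<Rightarrow> 'a \<Rightarrow>\<^sub>L ('a \<Rightarrow>\<^sub>L real)).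
        (\<forall>x\<in>S. (f has_derivative blinfun_apply (f' x)) (at x within S)) \<and>
        (\<forall>x\<in>S. (f' has_derivative blinfun_apply (f'' x)) (at x within S)) \<and>
        continuous_on S f'')"

text \<open>
  The functions \<open>g\<close>, \<open>F\<close>, \<open>f\<close> below depend on the radial profile \<open>q\<close> of the field. They are meaningful
  on the open interval \<open>(0, R)\<close>; at the endpoints, where the formulas are singular or the two-sided
  derivative may not exist, the values are irrelevant, as \<open>g\<close>, \<open>F\<close> and \<open>f\<close> are only integrated.
\<close>

definition dens_g :: "nat \<Rightarrow> real \<Rightarrow> (real \<Rightarrow> real) \<Rightarrow> real \<Rightarrow> real" where
  "dens_g d lam q r =
     1 / r powr (real d + 2 * lam - 4) *
     deriv (\<lambda>\<rho>. integral {0..\<rho>} (\<lambda>u. q u * u ^ (d - 2) / (\<rho>\<^sup>2 - u\<^sup>2) powr (1 - lam))) r"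

definition dens_F :: "nat \<Rightarrow> real \<Rightarrow> real \<Rightarrow> (real \<Rightarrow> real) \<Rightarrow> real \<Rightarrow> real" where
  "dens_F d lam R q t =
     sin (lam * pi) * Gamma ((real d - 3) / 2 + lam) / (pi powr ((real d + 1) / 2) * Gamma lam) *
     (1 / t) *
     deriv (\<lambda>\<tau>. integral {\<tau>..R} (\<lambda>r. dens_g d lam q r * r / (r\<^sup>2 - \<tau>\<^sup>2) powr (1 - lam))) t"

definition dens_C :: "nat \<Rightarrow> real \<Rightarrow> real \<Rightarrow> (real \<Rightarrow> real) \<Rightarrow> real" where
  "dens_C d lam R q =
     2 * Gamma ((real d - 1) / 2 + lam) / (Gamma lam * Gamma ((real d - 1) / 2)) *
     (1 / R powr (real d + 2 * lam - 3)) *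
     (Gamma ((real d - 1) / 2) / (2 * pi powr ((real d - 1) / 2)) -
      integral {0..R} (\<lambda>t. dens_F d lam R q t * t ^ (d - 2)))"

definition dens_f :: "nat \<Rightarrow> real \<Rightarrow> real \<Rightarrow> (real \<Rightarrow> real) \<Rightarrow> real \<Rightarrow> real" where
  "dens_f d lam R q r = dens_C d lam R q * (R\<^sup>2 - r\<^sup>2) powr (lam - 1) + dens_F d lam R q r"

text \<open>
  \<open>d\<mu>(0, r *\<^sub>R w) = f r * r ^ (d - 2) dr d\<sigma>(w)\<close> for \<open>0 \<le> r \<le> R\<close> and unit vectors \<open>w\<close>, as an equality of
  (a priori signed) measures: the density is not truncated at zero, so nonnegativity is not presupposed.
\<close>

definition has_polar_density ::
    "nat \<Rightarrow> real \<Rightarrow> (real \<times> 'a::euclidean_space) measure \<Rightarrow> (real \<Rightarrow> real) \<Rightarrow> bool" where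
  "has_polar_density d R \<mu> f \<longleftrightarrow>
     (let P = restrict_space lborel {0..R} \<Otimes>\<^sub>M (sphere_measure :: 'a measure) in
        integrable P (\<lambda>(r, w). f r * r ^ (d - 2)) \<and>
        (\<forall>A \<in> sets borel.
           measure \<mu> A = (\<integral>(r, w). indicat_real A (0, r *\<^sub>R w) * (f r * r ^ (d - 2)) \<partial>P)))"

end

theory Submission
  imports Defs
begin

text \<open>
  Put \<open>n = d - 1\<close>, so that \<open>s = n - 2 + 2 \<lambda>\<close>, and let \<open>e\<^sub>\<rho>(y) = (\<rho>\<^sup>2 - |y|\<^sup>2)\<^sup>\<lambda>\<^sup>-\<^sup>1\<close> on the ball of radius \<open>\<rho>\<close>.
  In polar coordinates around a point \<open>x\<close> of this ball, the contributions of two opposite directions to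
  the potential of \<open>e\<^sub>\<rho>\<close> at \<open>x\<close> add up to a Beta integral, so this potential is a constant \<open>W\<close> on the
  ball. Hence the mutual energy of \<open>e\<^sub>\<rho>\<close> and \<open>e\<^sub>\<sigma>\<close> is a multiple of \<open>min \<rho> \<sigma>\<close> to the power \<open>s\<close>.

  Integration by parts shows that \<open>F\<close> is a signed mixture of the \<open>e\<^sub>\<rho>\<close>, with weight proportional to
  \<open>g'(\<rho>) d\<rho>\<close> on \<open>(0, R)\<close> and a point mass at \<open>R\<close>. Testing the potential of this mixture against all \<open>e\<^sub>\<rho>\<close>
  and inverting the Abel transform, one finds that it equals \<open>- Q\<close> on the disk, so the measure with
  density \<open>f\<close> has potential \<open>C\<^sub>Q W - Q\<close>. By the variational conditions the potential of the extremal
  measure plus \<open>Q\<close> is constant Lebesgue-almost everywhere on its support, and at most this constant on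
  the whole support. Comparing the two, the difference of the measures has zero energy, so they
  coincide by strict positive definiteness of the Riesz kernel.
\<close>


section \<open>Polar coordinates\<close>

text \<open>The energy kernel \<open>min a b powr s\<close> makes the weight of the mixture
  computable. With \<open>\<rho> powr s * A0 \<rho>\<close> the Abel transform of the profile,
  \<open>g\<close> is its derivative divided by the power s - 1 of the radius; integrating
  \<open>g'\<close> against the kernel gives back the Abel transform up to a boundary term at
  \<open>R\<close>, which the point mass absorbs. The numerical factor of \<open>F\<close> is the
  one for which this match is exact, and its sine comes from the reflection formula for Gamma. The
  weight is signed, while potentials and energies live in \<open>ennreal\<close>. So the weight is
  split into its positive and negative part, giving finite measures \<open>Mpos\<close> and
  \<open>Mneg\<close>; every identity is arranged without subtraction, and the goal becomes
  \<open>add_measure M Mneg = Mpos\<close>. Nonnegativity of the density is never assumed. The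
  multiplier \<open>C\<close> changes the potential on the disk only by a constant and is fixed
  solely by total mass 1. The constants \<open>C * W\<close> and \<open>c\<close> cancel in the
  energy of the difference because both measures have mass 1; they need not be compared
  beforehand.\<close>

lemma space_sphere_measure [simp]: "space (sphere_measure :: 'a::euclidean_space measure) = sphere 0 1"
  by (simp add: sphere_measure_def space_scale_measure space_restrict_space)

lemma sets_sphere_measure [measurable_cong]:
  "sets (sphere_measure :: 'a::euclidean_space measure) = sets (restrict_space borel (sphere 0 1))"
  by (simp add: sphere_measure_def)

lemma sets_sphere_measureD:
  "B \<in> sets (sphere_measure :: 'a::euclidean_space measure) \<Longrightarrow> B \<in> sets borel \<and> B \<subseteq> sphere 0 1"
  by (subst (asm) sets_sphere_measure, subst (asm) sets_restrict_space_iff) auto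

lemma sgn_borel_measurable [measurable]: "(sgn :: 'a::euclidean_space \<Rightarrow> 'a) \<in> borel_measurable borel"
  unfolding sgn_div_norm by measurable

lemma emeasure_sphere_measure_sgn:
  fixes B :: "'a::euclidean_space set"
  assumes "B \<in> sets sphere_measure"
  shows "emeasure sphere_measure B =
    of_nat DIM('a) * emeasure lborel {x. x \<noteq> 0 \<and> norm x \<le> 1 \<and> sgn x \<in> B}"
proof -
  have B: "B \<in> sets borel" "B \<subseteq> sphere 0 1" using sets_sphere_measureD[OF assms] by auto
  have "{t *\<^sub>R w | t w. 0 < t \<and> t \<le> 1 \<and> w \<in> B} = {x. x \<noteq> 0 \<and> norm x \<le> 1 \<and> sgn x \<in> B}"
  proof (intro equalityI subsetI)
    fix x assume "x \<in> {x. x \<noteq> 0 \<and> norm x \<le> 1 \<and> sgn x \<in> B}"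
    then show "x \<in> {t *\<^sub>R w | t w. 0 < t \<and> t \<le> 1 \<and> w \<in> B}"
      by (intro CollectI exI[of _ "norm x"] exI[of _ "sgn x"]) (auto simp: sgn_div_norm)
  next
    fix x assume "x \<in> {t *\<^sub>R w | t w. 0 < t \<and> t \<le> 1 \<and> w \<in> B}"
    then obtain t w where "x = t *\<^sub>R w" "0 < t" "t \<le> 1" "w \<in> B" by auto
    moreover from this have "norm w = 1" using B by auto
    ultimately show "x \<in> {x. x \<noteq> 0 \<and> norm x \<le> 1 \<and> sgn x \<in> B}"
      by (auto simp: sgn_scaleR sgn_div_norm)
  qed
  then show ?thesis using emeasure_sphere_measure[OF B] by simp
qed

lemma emeasure_sphere_measure_finite:
  "emeasure (sphere_measure :: 'a::euclidean_space measure) A < \<infinity>"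
proof (cases "A \<in> sets (sphere_measure :: 'a measure)")
  case True
  have "emeasure lborel {x::'a. x \<noteq> 0 \<and> norm x \<le> 1 \<and> sgn x \<in> A} \<le> emeasure lborel (cball (0::'a) 1)"
    by (intro emeasure_mono) auto
  also have "\<dots> < \<infinity>" by (simp add: emeasure_cball less_top)
  finally show ?thesis
    by (simp add: emeasure_sphere_measure_sgn[OF True] ennreal_mult_less_top of_nat_less_top)
qed (simp add: emeasure_notin_sets)

lemma finite_measure_sphere_measure: "finite_measure (sphere_measure :: 'a::euclidean_space measure)"
  by (rule finite_measureI) (use emeasure_sphere_measure_finite in \<open>auto simp: less_top\<close>)

lemma emeasure_cone_scale:
  fixes B :: "'a::euclidean_space set"
  assumes [measurable]: "B \<in> sets borel" and "0 < b"
  shows "emeasure lborel {x. x \<noteq> 0 \<and> norm x \<le> b \<and> sgn x \<in> B} =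
    ennreal (b ^ DIM('a)) * emeasure lborel {x. x \<noteq> 0 \<and> norm x \<le> 1 \<and> sgn x \<in> B}"
proof -
  have "emeasure lborel {x. x \<noteq> 0 \<and> norm x \<le> b \<and> sgn x \<in> B} =
     emeasure (density (distr lborel borel (\<lambda>x. 0 + b *\<^sub>R x)) (\<lambda>_. ennreal (\<bar>b\<bar> ^ DIM('a))))
       {x::'a. x \<noteq> 0 \<and> norm x \<le> b \<and> sgn x \<in> B}"
    using lborel_affine[of b "0::'a"] \<open>0 < b\<close> by simp
  also have "\<dots> = ennreal (b ^ DIM('a)) *
     emeasure lborel ((\<lambda>x. b *\<^sub>R x) -` {x::'a. x \<noteq> 0 \<and> norm x \<le> b \<and> sgn x \<in> B})"
    using \<open>0 < b\<close> by (simp add: emeasure_density nn_integral_cmult_indicator emeasure_distr)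
  also have "(\<lambda>x. b *\<^sub>R x) -` {x::'a. x \<noteq> 0 \<and> norm x \<le> b \<and> sgn x \<in> B} =
      {x. x \<noteq> 0 \<and> norm x \<le> 1 \<and> sgn x \<in> B}"
    using \<open>0 < b\<close> by (auto simp: sgn_scaleR)
  finally show ?thesis .
qed

text \<open>The radial factor of Lebesgue measure on a space of dimension \<open>n\<close>; the
  origin, which has no direction, is left out.\<close>

definition radial_measure :: "nat \<Rightarrow> real measure" where
  "radial_measure n = density lborel (\<lambda>r. indicator {0<..} r * ennreal (r ^ (n - 1)))"

lemma sets_radial_measure [simp, measurable_cong]: "sets (radial_measure n) = sets borel"
  and space_radial_measure [simp]: "space (radial_measure n) = UNIV"
  by (simp_all add: radial_measure_def)

lemma emeasure_radial_measure_atMost: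
  assumes "n > 0"
  shows "emeasure (radial_measure n) {..b} = (if b \<le> 0 then 0 else ennreal (b ^ n / n))"
proof (cases "b \<le> 0")
  case True
  then have "emeasure (radial_measure n) {..b} = (\<integral>\<^sup>+r. 0 \<partial>(lborel::real measure))"
    unfolding radial_measure_def
    by (subst emeasure_density) (auto simp: nn_integral_0_iff_AE indicator_def)
  then show ?thesis using True by simp
next
  case False
  have "emeasure (radial_measure n) {..b} = (\<integral>\<^sup>+r. ennreal (r ^ (n - 1)) * indicator {0..b} r \<partial>lborel)"
    unfolding radial_measure_def
    by (subst emeasure_density, simp, simp, rule nn_integral_cong_AE, rule AE_mp[OF AE_lborel_singleton[of 0]])
      (auto simp: indicator_def)
  also have "\<dots> = ennreal (b ^ n / n - 0 ^ n / n)"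
    using False assms
    by (intro nn_integral_FTC_Icc) (auto intro!: derivative_eq_intros)
  finally show ?thesis using False assms by (simp add: zero_power)
qed

lemma sigma_finite_radial_measure: "n > 0 \<Longrightarrow> sigma_finite_measure (radial_measure n)"
proof
  assume "n > 0"
  have "(\<Union>i::nat. {..real i}) = UNIV" by (auto intro: real_arch_simple)
  then show "\<exists>A. countable A \<and> A \<subseteq> sets (radial_measure n) \<and> \<Union> A = space (radial_measure n) \<and>
      (\<forall>a\<in>A. emeasure (radial_measure n) a \<noteq> \<infinity>)"
    using \<open>n > 0\<close> by (intro exI[of _ "range (\<lambda>i::nat. {..real i})"])
       (auto simp: emeasure_radial_measure_atMost)
qed

lemma of_nat_mult_ennreal_divide:
  assumes "n > 0" "x \<ge> 0"
  shows "of_nat n * ennreal (x / real n) = ennreal x"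
proof -
  have "of_nat n * ennreal (x / real n) = ennreal (real n * (x / real n))"
    using assms by (subst ennreal_mult) (auto simp: ennreal_of_nat_eq_real_of_nat)
  then show ?thesis using assms by simp
qed

text \<open>For fixed \<open>B\<close> both sides are Borel measures in \<open>A\<close>, so it
  suffices to compare them on the half-lines \<open>{..b}\<close>. There the set is a cone scaled by
  \<open>b\<close>, and the factor \<open>DIM('a)\<close> in the cone measure cancels the one from
  integrating the radial weight.\<close>

lemma emeasure_polar_rectangle:
  fixes B :: "'a::euclidean_space set"
  assumes A: "A \<in> sets borel" and B: "B \<in> sets sphere_measure"
  shows "emeasure (radial_measure DIM('a)) A * emeasure sphere_measure B =
     emeasure lborel {x. x \<noteq> 0 \<and> norm x \<in> A \<and> sgn x \<in> B}"
proof -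
  have [measurable]: "B \<in> sets borel" using sets_sphere_measureD[OF B] by auto
  define N1 where "N1 = scale_measure (emeasure sphere_measure B) (radial_measure DIM('a))"
  define N2 where "N2 = distr (restrict_space lborel {x::'a. x \<noteq> 0 \<and> sgn x \<in> B}) borel norm"
  have N2: "emeasure N2 A = emeasure lborel {x. x \<noteq> 0 \<and> norm x \<in> A \<and> sgn x \<in> B}" if [measurable]: "A \<in> sets borel" for A
  proof -
    have "emeasure N2 A = emeasure (restrict_space lborel {x::'a. x \<noteq> 0 \<and> sgn x \<in> B})
        (norm -` A \<inter> {x::'a. x \<noteq> 0 \<and> sgn x \<in> B})"
      unfolding N2_def by (subst emeasure_distr) (auto simp: space_restrict_space intro!: measurable_restrict_space1)
    also have "\<dots> = emeasure lborel (norm -` A \<inter> {x::'a. x \<noteq> 0 \<and> sgn x \<in> B})"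
      by (rule emeasure_restrict_space) auto
    also have "norm -` A \<inter> {x::'a. x \<noteq> 0 \<and> sgn x \<in> B} = {x. x \<noteq> 0 \<and> norm x \<in> A \<and> sgn x \<in> B}" by auto
    finally show ?thesis .
  qed
  have eq: "emeasure N1 {..b} = emeasure N2 {..b}" for b
  proof (cases "b \<le> 0")
    case True
    then have "{x::'a. x \<noteq> 0 \<and> norm x \<in> {..b} \<and> sgn x \<in> B} = {}"
      by (auto dest!: order_trans[OF _ True])
    then show ?thesis using True by (simp only: N2 atMost_borel) (simp add: N1_def emeasure_radial_measure_atMost)
  next
    case False
    define c where "c = emeasure lborel {x::'a. x \<noteq> 0 \<and> norm x \<le> 1 \<and> sgn x \<in> B}"
    have "emeasure N1 {..b} = emeasure sphere_measure B * ennreal (b ^ DIM('a) / DIM('a))"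
      using False by (simp add: N1_def emeasure_radial_measure_atMost)
    also have "\<dots> = (of_nat DIM('a) * ennreal (b ^ DIM('a) / DIM('a))) * c"
      unfolding emeasure_sphere_measure_sgn[OF B] c_def by (simp only: mult_ac)
    also have "of_nat DIM('a) * ennreal (b ^ DIM('a) / DIM('a)) = ennreal (b ^ DIM('a))"
      using False by (intro of_nat_mult_ennreal_divide) auto
    also have "ennreal (b ^ DIM('a)) * c = emeasure N2 {..b}"
      unfolding c_def using False by (subst emeasure_cone_scale[symmetric]) (auto simp: N2)
    finally show ?thesis .
  qed
  have "N1 = N2"
  proof (rule measure_eqI_generator_eq[where \<Omega>=UNIV and E="range atMost" and A="\<lambda>i. {..real i}"])
    show "Int_stable (range (atMost :: real \<Rightarrow> _))"
      by (auto simp: Int_stable_def)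
    show "(\<Union>i::nat. {..real i}) = UNIV" by (auto intro: real_arch_simple)
    show "emeasure N1 {..real i} \<noteq> \<infinity>" for i
      using emeasure_sphere_measure_finite[of B]
      by (auto simp: N1_def emeasure_radial_measure_atMost ennreal_mult_eq_top_iff less_top)
    show "sets N1 = sigma_sets UNIV (range atMost)"
      by (simp add: N1_def borel_eq_atMost)
    show "sets N2 = sigma_sets UNIV (range atMost)"
      by (simp add: N2_def borel_eq_atMost)
  qed (use eq in auto)
  then have "emeasure N1 A = emeasure lborel {x. x \<noteq> 0 \<and> norm x \<in> A \<and> sgn x \<in> B}"
    using N2[OF A] by simp
  then show ?thesis by (simp add: N1_def mult.commute)
qed

lemma measurable_polar:
  "(\<lambda>x. (norm x, sgn x)) \<in> measurable (restrict_space lborel (- {0::'a::euclidean_space}))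
     (radial_measure n \<Otimes>\<^sub>M (sphere_measure :: 'a measure))"
proof (rule measurable_Pair)
  show "norm \<in> restrict_space lborel (- {0::'a}) \<rightarrow>\<^sub>M radial_measure n"
    by (intro measurable_restrict_space1) simp
  have "sgn \<in> restrict_space lborel (- {0::'a}) \<rightarrow>\<^sub>M restrict_space borel (sphere 0 1)"
    by (intro measurable_restrict_space2 measurable_restrict_space1) (auto simp: space_restrict_space norm_sgn)
  then show "sgn \<in> restrict_space lborel (- {0::'a}) \<rightarrow>\<^sub>M sphere_measure"
    by (subst measurable_cong_sets[OF refl sets_sphere_measure])
qed

text \<open>Both sides agree on rectangles, and these determine a product of sigma-finite measures.
  The polar integration formulas below are this identity combined with Tonelli.\<close>

lemma distr_polar:
  "distr (restrict_space lborel (- {0::'a::euclidean_space})) (radial_measure DIM('a) \<Otimes>\<^sub>M sphere_measure)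
     (\<lambda>x. (norm x, sgn x)) = radial_measure DIM('a) \<Otimes>\<^sub>M (sphere_measure :: 'a measure)"
proof (rule pair_measure_eqI[symmetric])
  show "sigma_finite_measure (radial_measure DIM('a))" by (rule sigma_finite_radial_measure) simp
  interpret finite_measure "sphere_measure :: 'a measure" by (rule finite_measure_sphere_measure)
  show "sigma_finite_measure (sphere_measure :: 'a measure)" by unfold_locales
  fix A and B :: "'a set" assume A: "A \<in> sets (radial_measure DIM('a))" and B: "B \<in> sets sphere_measure"
  have "emeasure (distr (restrict_space lborel (- {0::'a})) (radial_measure DIM('a) \<Otimes>\<^sub>M sphere_measure)
      (\<lambda>x. (norm x, sgn x))) (A \<times> B) = emeasure lborel ((\<lambda>x. (norm x, sgn x)) -` (A \<times> B) \<inter> - {0})"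
    using A B by (subst emeasure_distr[OF measurable_polar]) (auto simp: space_restrict_space intro!: emeasure_restrict_space)
  also have "(\<lambda>x. (norm x, sgn x)) -` (A \<times> B) \<inter> - {0} = {x. x \<noteq> 0 \<and> norm x \<in> A \<and> sgn x \<in> B}" by auto
  finally show "emeasure (radial_measure DIM('a)) A * emeasure sphere_measure B =
     emeasure (distr (restrict_space lborel (- {0::'a})) (radial_measure DIM('a) \<Otimes>\<^sub>M sphere_measure)
      (\<lambda>x. (norm x, sgn x))) (A \<times> B)"
    using emeasure_polar_rectangle[OF _ B, of A] A by simp
qed simp

lemma nn_integral_polar_pair:
  fixes f :: "'a::euclidean_space \<Rightarrow> ennreal"
  assumes [measurable]: "f \<in> borel_measurable borel"
  shows "(\<integral>\<^sup>+x. f x \<partial>lborel) = (\<integral>\<^sup>+(r, w). f (r *\<^sub>R w) \<partial>(radial_measure DIM('a) \<Otimes>\<^sub>M sphere_measure))"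
proof -
  have s: "(\<lambda>x. x) \<in> (sphere_measure :: 'a measure) \<rightarrow>\<^sub>M borel"
    by (subst measurable_cong_sets[OF sets_sphere_measure refl]) (intro measurable_restrict_space1, simp)
  have m2: "(\<lambda>(r, w). f (r *\<^sub>R w)) \<in> borel_measurable (radial_measure DIM('a) \<Otimes>\<^sub>M sphere_measure)"
    using measurable_compose[OF measurable_snd s] by measurable
  have "(\<integral>\<^sup>+(r, w). f (r *\<^sub>R w) \<partial>(radial_measure DIM('a) \<Otimes>\<^sub>M sphere_measure)) =
     (\<integral>\<^sup>+x. f (norm x *\<^sub>R sgn x) \<partial>(restrict_space lborel (- {0})))"
    by (subst distr_polar[symmetric], subst nn_integral_distr[OF measurable_polar]) (use m2 in \<open>simp_all\<close>)
  also have "\<dots> = (\<integral>\<^sup>+x. f x * indicator (- {0}) x \<partial>lborel)"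
    by (subst nn_integral_restrict_space) (auto simp: sgn_div_norm indicator_def intro!: nn_integral_cong)
  also have "\<dots> = (\<integral>\<^sup>+x. f x \<partial>lborel)"
    by (rule nn_integral_cong_AE, rule AE_mp[OF AE_lborel_singleton[of 0]]) auto
  finally show ?thesis ..
qed

section \<open>Translations, dilations and reflections of Lebesgue measure\<close>

lemma nn_integral_lborel_translate:
  fixes f :: "'a::euclidean_space \<Rightarrow> ennreal"
  assumes [measurable]: "f \<in> borel_measurable borel"
  shows "(\<integral>\<^sup>+x. f (c + x) \<partial>lborel) = (\<integral>\<^sup>+x. f x \<partial>lborel)"
  by (subst (2) lborel_distr_plus[of c, symmetric]) (simp add: nn_integral_distr)

lemma nn_integral_lborel_uminus:
  fixes f :: "'a::euclidean_space \<Rightarrow> ennreal"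
  assumes [measurable]: "f \<in> borel_measurable borel"
  shows "(\<integral>\<^sup>+x. f (- x) \<partial>lborel) = (\<integral>\<^sup>+x. f x \<partial>lborel)"
  by (subst (2) lborel_affine[of "-1" 0]) (simp_all add: nn_integral_density nn_integral_distr)

lemma nn_integral_lborel_scaleR:
  fixes f :: "'a::euclidean_space \<Rightarrow> ennreal"
  assumes [measurable]: "f \<in> borel_measurable borel" and "c > 0"
  shows "(\<integral>\<^sup>+x. f x \<partial>lborel) = ennreal (c ^ DIM('a)) * (\<integral>\<^sup>+x. f (c *\<^sub>R x) \<partial>lborel)"
  by (subst lborel_affine[of c 0])
    (use \<open>c > 0\<close> in \<open>simp_all add: nn_integral_density nn_integral_distr nn_integral_cmult\<close>)

text \<open>
  Uniqueness of Haar measure: integrate \<open>f (T x + y)\<close> over \<open>x\<close> and over \<open>y\<close> in the unit ball, in both orders.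
\<close>

lemma nn_integral_lborel_isometry:
  fixes T :: "'a::euclidean_space \<Rightarrow> 'a" and f :: "'a \<Rightarrow> ennreal"
  assumes [measurable]: "f \<in> borel_measurable borel"
    and lin: "linear T" and inv: "\<And>x. T (T x) = x" and nrm: "\<And>x. norm (T x) = norm x"
  shows "(\<integral>\<^sup>+x. f (T x) \<partial>lborel) = (\<integral>\<^sup>+x. f x \<partial>lborel)"
proof -
  define b :: "'a \<Rightarrow> ennreal" where "b = indicator (ball 0 1)"
  have [measurable]: "b \<in> borel_measurable borel" unfolding b_def by (intro borel_measurable_indicator) simp
  have [measurable]: "T \<in> borel_measurable borel"
    using lin by (intro borel_measurable_continuous_onI linear_continuous_on linear_conv_bounded_linear[THEN iffD1])
  have Tadd: "T (x + y) = T x + T y" and Tdiff: "T (x - y) = T x - T y" for x y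
    using lin by (auto simp: linear_add linear_diff)
  have bT: "b (y - T x) = b (x - T y)" for x y
  proof -
    have "norm (y - T x) = norm (T (T y - x))" by (simp add: Tdiff inv)
    also have "\<dots> = norm (x - T y)" by (simp add: nrm norm_minus_commute)
    finally show ?thesis by (simp add: b_def indicator_def)
  qed
  define v where "v = (\<integral>\<^sup>+x. b x \<partial>lborel)"
  have v: "v = ennreal (unit_ball_vol (DIM('a)))" by (simp add: v_def b_def emeasure_ball)
  have "v * (\<integral>\<^sup>+x. f (T x) \<partial>lborel) = (\<integral>\<^sup>+y. b y * (\<integral>\<^sup>+x. f (T x) \<partial>lborel) \<partial>lborel)"
    by (simp add: v_def nn_integral_multc)
  also have "\<dots> = (\<integral>\<^sup>+y. b y * (\<integral>\<^sup>+x. f (T (T y + x)) \<partial>lborel) \<partial>lborel)"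
    by (simp add: nn_integral_lborel_translate[of "\<lambda>x. f (T x)"])
  also have "\<dots> = (\<integral>\<^sup>+y. (\<integral>\<^sup>+x. b y * f (y + T x) \<partial>lborel) \<partial>lborel)"
    by (simp add: nn_integral_cmult Tadd inv)
  also have "\<dots> = (\<integral>\<^sup>+x. (\<integral>\<^sup>+y. b y * f (y + T x) \<partial>lborel) \<partial>lborel)"
    by (rule lborel_pair.Fubini') measurable
  also have "\<dots> = (\<integral>\<^sup>+x. (\<integral>\<^sup>+y. b (y - T x) * f y \<partial>lborel) \<partial>lborel)"
  proof (rule nn_integral_cong)
    fix x show "(\<integral>\<^sup>+y. b y * f (y + T x) \<partial>lborel) = (\<integral>\<^sup>+y. b (y - T x) * f y \<partial>lborel)"
      using nn_integral_lborel_translate[of "\<lambda>y. b (y - T x) * f y" "T x"] by (simp add: add.commute)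
  qed
  also have "\<dots> = (\<integral>\<^sup>+y. (\<integral>\<^sup>+x. b (y - T x) * f y \<partial>lborel) \<partial>lborel)"
    by (rule lborel_pair.Fubini') measurable
  also have "\<dots> = (\<integral>\<^sup>+y. (\<integral>\<^sup>+x. b (x - T y) * f y \<partial>lborel) \<partial>lborel)"
    by (intro nn_integral_cong arg_cong2[where f="(*)"] bT refl)
  also have "\<dots> = (\<integral>\<^sup>+y. v * f y \<partial>lborel)"
    using nn_integral_lborel_translate[of b "- T y" for y]
    by (simp add: nn_integral_multc v_def)
  also have "\<dots> = v * (\<integral>\<^sup>+x. f x \<partial>lborel)" by (simp add: nn_integral_cmult)
  finally have "v * (\<integral>\<^sup>+x. f (T x) \<partial>lborel) = v * (\<integral>\<^sup>+x. f x \<partial>lborel)" .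
  moreover have "unit_ball_vol (real DIM('a)) \<noteq> 0"
    by (metis less_irrefl of_nat_0_le_iff unit_ball_vol_pos)
  ultimately show ?thesis
    using v by (simp add: ennreal_mult_cancel_left)
qed

text \<open>The reflection in the hyperplane orthogonal to \<open>x - y\<close>. Reflections suffice
  for all rotation invariance used below, and being involutions they meet the hypothesis of
  \<open>nn_integral_lborel_isometry\<close>.\<close>

lemma exists_reflection:
  fixes x y :: "'a::euclidean_space"
  assumes "norm x = norm y"
  obtains T where "linear T" "\<And>z. T (T z) = z" "\<And>z. norm (T z) = norm z" "T x = y"
proof (cases "x = y")
  case True
  then show ?thesis using that[of id] by (simp add: linear_id)
next
  case False
  define u where "u = x - y"
  have u: "u \<bullet> u \<noteq> 0" using False by (simp add: u_def)
  define T where "T = (\<lambda>z. z - (2 * (z \<bullet> u) / (u \<bullet> u)) *\<^sub>R u)"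
  have "linear T"
    by (rule linearI) (simp_all add: T_def inner_add_left algebra_simps add_divide_distrib flip: scaleR_add_left)
  moreover have "T (T z) = z" for z
    using u by (simp add: T_def inner_diff_left algebra_simps)
  moreover have "norm (T z) = norm z" for z
  proof -
    have "T z \<bullet> T z = z \<bullet> z"
      using u by (simp add: T_def inner_diff_left inner_diff_right inner_commute[of u z] algebra_simps)
    then show ?thesis by (simp add: norm_eq_sqrt_inner)
  qed
  moreover have "T x = y"
  proof -
    have "x \<bullet> x = y \<bullet> y" using assms by (simp add: norm_eq_sqrt_inner)
    then have "u \<bullet> u = 2 * (x \<bullet> u)" by (simp add: u_def inner_diff_left inner_diff_right inner_commute)
    then show ?thesis using u by (simp add: T_def u_def)
  qed
  ultimately show ?thesis using that by blast
qed

lemma measurable_id_sphere_measure: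
  "(\<lambda>x. x) \<in> (sphere_measure :: 'a::euclidean_space measure) \<rightarrow>\<^sub>M borel"
  by (subst measurable_cong_sets[OF sets_sphere_measure refl]) (intro measurable_restrict_space1, simp)

lemma borel_measurable_sphere_measureI:
  "f \<in> borel_measurable borel \<Longrightarrow> f \<in> borel_measurable (sphere_measure :: 'a::euclidean_space measure)"
  using measurable_compose[OF measurable_id_sphere_measure] by auto

lemma nn_integral_polar:
  fixes f :: "'a::euclidean_space \<Rightarrow> ennreal"
  assumes [measurable]: "f \<in> borel_measurable borel"
  shows "(\<integral>\<^sup>+x. f x \<partial>lborel) =
    (\<integral>\<^sup>+w. (\<integral>\<^sup>+r. indicator {0<..} r * ennreal (r ^ (DIM('a) - 1)) * f (r *\<^sub>R w) \<partial>lborel) \<partial>sphere_measure)"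
proof -
  interpret S: finite_measure "sphere_measure :: 'a measure" by (rule finite_measure_sphere_measure)
  interpret R: sigma_finite_measure "radial_measure DIM('a)" by (rule sigma_finite_radial_measure) simp
  interpret P: pair_sigma_finite "radial_measure DIM('a)" "sphere_measure :: 'a measure" ..
  have m: "(\<lambda>(r, w). f (r *\<^sub>R w)) \<in> borel_measurable (radial_measure DIM('a) \<Otimes>\<^sub>M sphere_measure)"
    using measurable_compose[OF measurable_snd measurable_id_sphere_measure] by measurable
  have "(\<integral>\<^sup>+x. f x \<partial>lborel) = (\<integral>\<^sup>+w. (\<integral>\<^sup>+r. f (r *\<^sub>R w) \<partial>radial_measure DIM('a)) \<partial>sphere_measure)"
    unfolding nn_integral_polar_pair[OF assms] by (subst P.nn_integral_snd[symmetric, OF m]) simp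
  also have "\<dots> = (\<integral>\<^sup>+w. (\<integral>\<^sup>+r. indicator {0<..} r * ennreal (r ^ (DIM('a) - 1)) * f (r *\<^sub>R w) \<partial>lborel) \<partial>sphere_measure)"
    unfolding radial_measure_def by (subst nn_integral_density) auto
  finally show ?thesis .
qed

lemma nn_integral_radial:
  fixes f :: "real \<Rightarrow> ennreal"
  assumes [measurable]: "f \<in> borel_measurable borel"
  shows "(\<integral>\<^sup>+x. f (norm x) \<partial>(lborel :: 'a::euclidean_space measure)) =
    emeasure (sphere_measure :: 'a measure) (sphere 0 1) *
    (\<integral>\<^sup>+r. indicator {0<..} r * ennreal (r ^ (DIM('a) - 1)) * f r \<partial>lborel)"
proof -
  have "(\<integral>\<^sup>+x. f (norm x) \<partial>(lborel :: 'a measure)) =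
    (\<integral>\<^sup>+w. (\<integral>\<^sup>+r. indicator {0<..} r * ennreal (r ^ (DIM('a) - 1)) * f r \<partial>lborel) \<partial>(sphere_measure::'a measure))"
    by (subst nn_integral_polar, simp, intro nn_integral_cong) (auto simp: indicator_def)
  then show ?thesis by (simp add: mult.commute)
qed

lemma emeasure_sphere_measure_space:
  "emeasure (sphere_measure :: 'a::euclidean_space measure) (sphere 0 1) = ennreal (real DIM('a) * unit_ball_vol (DIM('a)))"
proof -
  have s: "sphere 0 1 \<in> sets (sphere_measure :: 'a measure)"
    using sets.top[of "sphere_measure :: 'a measure"] by simp
  have "{x::'a. x \<noteq> 0 \<and> norm x \<le> 1 \<and> sgn x \<in> sphere 0 1} = cball 0 1 - {0}"
    by (auto simp: norm_sgn)
  moreover have "emeasure lborel (cball (0::'a) 1 - {0}) = emeasure lborel (cball (0::'a) 1)"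
    by (intro emeasure_Diff_null_set) auto
  ultimately show ?thesis
    by (simp add: emeasure_sphere_measure_sgn[OF s] emeasure_cball ennreal_of_nat_eq_real_of_nat ennreal_mult)
qed

text \<open>Allows each direction to be averaged with its opposite; the cone measure inherits the
  symmetry from Lebesgue measure.\<close>

lemma nn_integral_sphere_measure_uminus:
  fixes f :: "'a::euclidean_space \<Rightarrow> ennreal"
  assumes [measurable]: "f \<in> borel_measurable borel"
  shows "(\<integral>\<^sup>+w. f (- w) \<partial>sphere_measure) = (\<integral>\<^sup>+w. f w \<partial>sphere_measure)"
proof -
  have m: "uminus \<in> (sphere_measure :: 'a measure) \<rightarrow>\<^sub>M sphere_measure"
    by (subst measurable_cong_sets[OF sets_sphere_measure sets_sphere_measure],
        intro measurable_restrict_space2 measurable_restrict_space1) (auto simp: space_restrict_space)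
  have "distr sphere_measure sphere_measure uminus = (sphere_measure :: 'a measure)"
  proof (rule measure_eqI)
    fix B :: "'a set" assume "B \<in> sets (distr sphere_measure sphere_measure uminus)"
    then have B: "B \<in> sets sphere_measure" by simp
    then have [measurable]: "B \<in> sets borel" using sets_sphere_measureD by blast
    have B': "uminus -` B \<inter> sphere 0 1 \<in> sets sphere_measure" using measurable_sets[OF m B] by simp
    have eq: "{x. x \<noteq> 0 \<and> norm x \<le> 1 \<and> sgn x \<in> uminus -` B \<inter> sphere 0 1} =
        {x. x \<noteq> 0 \<and> norm x \<le> 1 \<and> - sgn x \<in> B}"
      by (auto simp: norm_sgn)
    have "emeasure lborel {x. x \<noteq> 0 \<and> norm x \<le> 1 \<and> sgn x \<in> uminus -` B \<inter> sphere 0 1} =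
       (\<integral>\<^sup>+x. indicator {x. x \<noteq> 0 \<and> norm x \<le> 1 \<and> - sgn x \<in> B} x \<partial>lborel)"
      unfolding eq by (subst nn_integral_indicator) auto
    also have "\<dots> = (\<integral>\<^sup>+x. indicator {x. x \<noteq> 0 \<and> norm x \<le> 1 \<and> sgn x \<in> B} (-x) \<partial>lborel)"
      by (intro nn_integral_cong) (auto simp: indicator_def sgn_minus)
    also have "\<dots> = emeasure lborel {x. x \<noteq> 0 \<and> norm x \<le> 1 \<and> sgn x \<in> B}"
      by (subst nn_integral_lborel_uminus) auto
    finally show "emeasure (distr sphere_measure sphere_measure uminus) B = emeasure sphere_measure B"
      by (simp add: emeasure_distr[OF m B] emeasure_sphere_measure_sgn[OF B'] emeasure_sphere_measure_sgn[OF B])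
  qed simp
  then have "(\<integral>\<^sup>+w. f w \<partial>sphere_measure) = (\<integral>\<^sup>+w. f w \<partial>(distr sphere_measure sphere_measure uminus))" by simp
  also have "\<dots> = (\<integral>\<^sup>+w. f (- w) \<partial>sphere_measure)"
    by (rule nn_integral_distr[OF m]) (simp add: borel_measurable_sphere_measureI)
  finally show ?thesis ..
qed

text \<open>The cone over a great subsphere lies in a hyperplane. Needed at boundary points of a
  ball, where tangential directions meet the ball in a degenerate chord.\<close>

lemma AE_sphere_measure_inner_neq_0:
  fixes x :: "'a::euclidean_space"
  assumes "x \<noteq> 0"
  shows "AE w in sphere_measure. x \<bullet> w \<noteq> 0"
proof (rule AE_I')
  let ?B = "{w \<in> sphere (0::'a) 1. x \<bullet> w = 0}"
  have B: "?B \<in> sets sphere_measure"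
    by (subst sets_sphere_measure, subst sets_restrict_space_iff) auto
  have "negligible {w. x \<bullet> w = 0}" using assms by (intro negligible_hyperplane) auto
  then have "{w. x \<bullet> w = 0} \<in> null_sets lborel"
    by (simp add: negligible_iff_null_sets null_sets_completion_iff)
  then have "emeasure lborel {w. x \<bullet> w = 0} = 0" by auto
  then have "emeasure lborel {z. z \<noteq> 0 \<and> norm z \<le> 1 \<and> sgn z \<in> ?B} = 0"
    by (rule emeasure_eq_0[rotated]) (auto simp: sgn_div_norm)
  then have "emeasure sphere_measure ?B = 0"
    unfolding emeasure_sphere_measure_sgn[OF B] by (simp only: mult_zero_right)
  then show "?B \<in> null_sets sphere_measure"
    using B by (rule null_setsI)
qed auto

section \<open>Potential of the equilibrium density of a ball\<close>

lemma nn_integral_Beta: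
  fixes a b :: real
  assumes "a > 0" "b > 0"
  shows "(\<integral>\<^sup>+v. ennreal (v powr (a - 1) * (1 - v) powr (b - 1)) * indicator {0..1} v \<partial>lborel) = ennreal (Beta a b)"
proof -
  have "((\<lambda>v. v powr (a - 1) * (1 - v) powr (b - 1)) has_integral Beta a b) {0..1}"
    by (rule has_integral_Beta_real) fact+
  then have "((\<lambda>v. v powr (a - 1) * (1 - v) powr (b - 1) * indicator {0..1} v) has_integral Beta a b) UNIV"
    by (subst (asm) has_integral_restrict_UNIV[symmetric]) (auto elim!: has_integral_eq[rotated] simp: indicator_def)
  then have "(\<integral>\<^sup>+v. ennreal (v powr (a - 1) * (1 - v) powr (b - 1) * indicator {0..1} v) \<partial>lborel) = ennreal (Beta a b)"
    by (intro nn_integral_has_integral_lborel) auto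
  then show ?thesis by (simp add: ennreal_mult'' ennreal_indicator del: indicator_simps)
qed

text \<open>Contribution of one direction to the potential of a ball density, at a point from which
  the boundary lies at distance \<open>a\<close> in this direction and \<open>b\<close> in the
  opposite one. The product \<open>(a - t) * (t + b)\<close> is the power of the point at distance
  \<open>t\<close>, and the power of \<open>t\<close> is the polar Jacobian times the Riesz
  kernel.\<close>

definition chord :: "real \<Rightarrow> real \<Rightarrow> real \<Rightarrow> ennreal" where
  "chord lam a b = (\<integral>\<^sup>+t. ennreal (t powr (1 - 2 * lam) * ((a - t) * (t + b)) powr (lam - 1)) * indicator {0<..<a} t \<partial>lborel)"

lemma AE_lborel_doubleton: "AE t in lborel. t \<noteq> (a::real) \<and> t \<noteq> b"
  using AE_lborel_singleton[of a] AE_lborel_singleton[of b] by eventually_elim auto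

text \<open>The boundary case: the whole chord lies on one side of the point, and
  \<open>v = t / a\<close> gives a Beta integral directly.\<close>

lemma chord_eq_Beta_0:
  assumes "0 < lam" "lam < 1" "a > 0"
  shows "chord lam a 0 = ennreal (Beta (1 - lam) lam)"
proof -
  have "ennreal (Beta (1 - lam) lam) =
      (\<integral>\<^sup>+v. ennreal (v powr (1 - lam - 1) * (1 - v) powr (lam - 1)) * indicator {0 / a..a / a} v \<partial>lborel)"
    using assms by (subst nn_integral_Beta[symmetric]) simp_all
  also have "\<dots> = (\<integral>\<^sup>+t. ennreal ((t / a) powr (1 - lam - 1) * (1 - t / a) powr (lam - 1)) * ennreal (1 / a) * indicator {0..a} t \<partial>lborel)"
    by (rule nn_integral_substitution_aux) (use assms in \<open>auto intro!: derivative_eq_intros continuous_intros\<close>)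
  also have "\<dots> = chord lam a 0"
    unfolding chord_def
  proof (rule nn_integral_cong_AE, rule AE_mp[OF AE_lborel_doubleton[of 0 a]], intro AE_I2 impI)
    fix t :: real assume t: "t \<noteq> 0 \<and> t \<noteq> a"
    show "ennreal ((t / a) powr (1 - lam - 1) * (1 - t / a) powr (lam - 1)) * ennreal (1 / a) * indicator {0..a} t =
      ennreal (t powr (1 - 2 * lam) * ((a - t) * (t + 0)) powr (lam - 1)) * indicator {0<..<a} t"
    proof (cases "0 < t \<and> t < a")
      case True
      have "1 - t / a = (a - t) / a" using assms by (simp add: field_simps)
      then have "(t / a) powr (1 - lam - 1) * (1 - t / a) powr (lam - 1) * (1 / a) =
          t powr (- lam) * (a - t) powr (lam - 1) * (a powr lam * a powr (1 - lam) / a)"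
        using True assms by (simp add: powr_divide powr_minus field_simps powr_diff)
      also have "a powr lam * a powr (1 - lam) / a = 1"
        using assms by (simp add: powr_add[symmetric])
      also have "t powr (- lam) = t powr (1 - 2 * lam) * t powr (lam - 1)"
        using True by (simp add: powr_add[symmetric])
      finally have "(t / a) powr (1 - lam - 1) * (1 - t / a) powr (lam - 1) * (1 / a) =
           t powr (1 - 2 * lam) * ((a - t) * (t + 0)) powr (lam - 1)"
        using True by (simp add: powr_mult)
      then show ?thesis using True assms by (subst ennreal_mult''[symmetric]) auto
    next
      case False
      then show ?thesis using t by (auto simp: indicator_def)
    qed
  qed
  finally show ?thesis ..
qed

text \<open>
  The substitutions \<open>u = a b t / D\<close> and \<open>v = t\<^sup>2 / D\<close> with \<open>D = a b + (a - b) t\<close>: the first one carries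
  \<open>(0, a)\<close> to \<open>(0, b)\<close>, and the second one turns the sum of the two integrands into that of a Beta integral.
\<close>

lemma chord_add_swap_pos:
  assumes lam: "0 < lam" "lam < 1" and ab: "a > 0" "b > 0"
  shows "chord lam a b + chord lam b a = ennreal (Beta (1 - lam) lam)"
proof -
  define D where "D = (\<lambda>t. a * b + (a - b) * t)"
  have D: "D t > 0" if "0 \<le> t" "t \<le> a" for t
  proof -
    have "D t = (a - t) * b + a * t" by (simp add: D_def algebra_simps)
    moreover have "(a - t) * b \<ge> 0" "a * t \<ge> 0" using that ab by auto
    moreover have "(a - t) * b > 0 \<or> a * t > 0" using that ab by (cases "t = 0") auto
    ultimately show ?thesis by linarith
  qed
  have Dder: "(D has_real_derivative (a - b)) (at t)" for t
    unfolding D_def by (auto intro!: derivative_eq_intros)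
  have Dcont: "continuous_on {0..a} D" unfolding D_def by (intro continuous_intros)
  define h where "h = (\<lambda>a b t. t powr (1 - 2 * lam) * ((a - t) * (t + b)) powr (lam - 1) :: real)"
  define \<phi> where "\<phi> = (\<lambda>t. a * b * t / D t)"
  define \<phi>' where "\<phi>' = (\<lambda>t. (a * b)\<^sup>2 / (D t)\<^sup>2)"
  define v where "v = (\<lambda>t. t\<^sup>2 / D t)"
  define v' where "v' = (\<lambda>t. t * (D t + a * b) / (D t)\<^sup>2)"
  have \<phi>0: "\<phi> 0 = 0" and \<phi>a: "\<phi> a = b" and v0: "v 0 = 0" and va: "v a = 1"
    using ab by (auto simp: \<phi>_def v_def D_def field_simps power2_eq_square)
  have hm: "(\<lambda>t. ennreal (h a b t)) \<in> borel_measurable borel" for a b unfolding h_def by measurable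
  have "chord lam b a = (\<integral>\<^sup>+u. (ennreal (h b a u) * indicator {0<..<b} u) * indicator {\<phi> 0..\<phi> a} u \<partial>lborel)"
    unfolding chord_def \<phi>0 \<phi>a h_def by (intro nn_integral_cong) (auto simp: indicator_def)
  also have "\<dots> = (\<integral>\<^sup>+t. (ennreal (h b a (\<phi> t)) * indicator {0<..<b} (\<phi> t)) * ennreal (\<phi>' t) * indicator {0..a} t \<partial>lborel)"
  proof (rule nn_integral_substitution_aux)
    fix t assume t: "t \<in> {0..a}"
    have "D t \<noteq> 0" using D[of t] t by auto
    moreover have "a * b * D t - a * b * t * (a - b) = (a * b)\<^sup>2" by (simp add: D_def algebra_simps power2_eq_square)
    ultimately show "(\<phi> has_real_derivative \<phi>' t) (at t)" unfolding \<phi>_def \<phi>'_def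
      by (auto intro!: derivative_eq_intros Dder simp: power2_eq_square)
  next
    show "continuous_on {0..a} \<phi>'" unfolding \<phi>'_def using D by (intro continuous_intros Dcont) fastforce
  qed (use ab hm in \<open>auto simp: \<phi>'_def\<close>)
  also have "\<dots> = (\<integral>\<^sup>+t. ennreal (h b a (\<phi> t)) * ennreal (\<phi>' t) * indicator {0<..<a} t \<partial>lborel)"
  proof (rule nn_integral_cong_AE, rule AE_mp[OF AE_lborel_doubleton[of 0 a]], intro AE_I2 impI)
    fix t assume "t \<noteq> 0 \<and> t \<noteq> a"
    moreover have "\<phi> t \<in> {0<..<b}" if "0 < t" "t < a"
    proof -
      have "b - \<phi> t = b\<^sup>2 * (a - t) / D t" using D[of t] that
        by (simp add: \<phi>_def D_def field_simps power2_eq_square)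
      then show ?thesis using D[of t] that ab
        by (auto simp: \<phi>_def intro!: divide_pos_pos) (smt (verit) divide_pos_pos mult_pos_pos zero_less_power)
    qed
    ultimately show "ennreal (h b a (\<phi> t)) * indicator {0<..<b} (\<phi> t) * ennreal (\<phi>' t) * indicator {0..a} t =
        ennreal (h b a (\<phi> t)) * ennreal (\<phi>' t) * indicator {0<..<a} t"
      by (auto simp: indicator_def)
  qed
  finally have "chord lam a b + chord lam b a = (\<integral>\<^sup>+t. ennreal (h a b t) * indicator {0<..<a} t +
      ennreal (h b a (\<phi> t)) * ennreal (\<phi>' t) * indicator {0<..<a} t \<partial>lborel)"
    unfolding chord_def h_def[symmetric]
    by (subst nn_integral_add) (simp_all add: h_def \<phi>_def D_def \<phi>'_def)
  also have "\<dots> = (\<integral>\<^sup>+t. ennreal ((v t) powr (1 - lam - 1) * (1 - v t) powr (lam - 1)) * ennreal (v' t) * indicator {0..a} t \<partial>lborel)"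
  proof (rule nn_integral_cong_AE, rule AE_mp[OF AE_lborel_doubleton[of 0 a]], intro AE_I2 impI)
    fix t assume t: "t \<noteq> 0 \<and> t \<noteq> a"
    show "ennreal (h a b t) * indicator {0<..<a} t + ennreal (h b a (\<phi> t)) * ennreal (\<phi>' t) * indicator {0<..<a} t
       = ennreal ((v t) powr (1 - lam - 1) * (1 - v t) powr (lam - 1)) * ennreal (v' t) * indicator {0..a} t"
    proof (cases "0 < t \<and> t < a")
      case True
      define P where "P = (a - t) * (t + b)"
      define d where "d = D t"
      define c where "c = a * b"
      have pos: "P > 0" "d > 0" "c > 0" "t > 0" using D[of t] True ab by (auto simp: P_def d_def c_def)
      have 1: "h a b t = t powr (1 - 2 * lam) * P powr (lam - 1)" by (simp add: h_def P_def)
      have e1: "b - \<phi> t = b\<^sup>2 * (a - t) / d" "\<phi> t + a = a\<^sup>2 * (t + b) / d"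
        using pos unfolding \<phi>_def d_def by (simp_all add: field_simps power2_eq_square) (simp_all add: D_def algebra_simps)
      have e2: "(b - \<phi> t) * (\<phi> t + a) = (c / d)\<^sup>2 * P"
        unfolding e1 by (simp add: P_def c_def field_simps power2_eq_square)
      have e5: "\<phi>' t = (c / d)\<^sup>2" by (simp add: \<phi>'_def c_def d_def power_divide)
      have e3: "\<phi> t = (c / d) * t" by (simp add: \<phi>_def c_def d_def)
      have "h b a (\<phi> t) * \<phi>' t = ((c / d) * t) powr (1 - 2 * lam) * ((c / d)\<^sup>2 * P) powr (lam - 1) * (c / d)\<^sup>2"
        unfolding h_def e2 e5 unfolding e3 ..
      also have "\<dots> = t powr (1 - 2 * lam) * P powr (lam - 1) *
          ((c / d) powr (1 - 2 * lam) * (c / d) powr (2 * (lam - 1)) * (c / d) powr 2)"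
      proof -
        have aux: "(k * t) powr (1 - 2 * lam) * (k\<^sup>2 * P) powr (lam - 1) * k\<^sup>2 = t powr (1 - 2 * lam) * P powr (lam - 1) *
          (k powr (1 - 2 * lam) * k powr (2 * (lam - 1)) * k powr 2)" if "k > 0" for k
          using pos that by (simp add: powr_mult powr_powr flip: powr_numeral)
        show ?thesis by (rule aux) (use pos in simp)
      qed
      also have "(c / d) powr (1 - 2 * lam) * (c / d) powr (2 * (lam - 1)) * (c / d) powr 2 = c / d"
        using pos by (simp add: powr_add[symmetric] power2_eq_square)
      finally have 2: "h b a (\<phi> t) * \<phi>' t = t powr (1 - 2 * lam) * P powr (lam - 1) * (c / d)" .
      have e4: "1 - v t = P / d" using pos unfolding v_def d_def
        by (simp add: field_simps) (simp add: D_def P_def algebra_simps power2_eq_square)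
      have "(v t) powr (1 - lam - 1) * (1 - v t) powr (lam - 1) * v' t =
         (t powr 2) powr (- lam) / d powr (- lam) * (P powr (lam - 1) / d powr (lam - 1)) * (t * (d + c) / d\<^sup>2)"
        unfolding e4 using pos by (simp add: v_def v'_def c_def d_def powr_divide)
      also have "\<dots> = (t powr (- 2 * lam) * t) * P powr (lam - 1) * ((d + c) / (d powr (- lam) * d powr (lam - 1) * d powr 2))"
      proof -
        have "(t powr 2) powr (- lam) = t powr (- 2 * lam)" by (simp only: powr_powr) simp
        then show ?thesis using pos by simp
      qed
      also have "t powr (- 2 * lam) * t = t powr (1 - 2 * lam)"
        using pos by (simp add: powr_diff powr_minus field_simps)
      also have "d powr (- lam) * d powr (lam - 1) * d powr 2 = d"
        using pos by (simp add: powr_add[symmetric] power2_eq_square)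
      finally have 3: "(v t) powr (1 - lam - 1) * (1 - v t) powr (lam - 1) * v' t = t powr (1 - 2 * lam) * P powr (lam - 1) * ((d + c) / d)" .
      have "h a b t + h b a (\<phi> t) * \<phi>' t = (v t) powr (1 - lam - 1) * (1 - v t) powr (lam - 1) * v' t"
        unfolding 1 2 3 using pos by (simp add: field_simps)
      moreover have "h a b t \<ge> 0" "h b a (\<phi> t) \<ge> 0" "\<phi>' t \<ge> 0" "v' t \<ge> 0" using True pos ab
        by (auto simp: h_def \<phi>'_def v'_def d_def c_def)
      ultimately show ?thesis using True by (simp flip: ennreal_plus ennreal_mult'')
    next
      case False
      then show ?thesis using t by (auto simp: indicator_def)
    qed
  qed
  also have "\<dots> = (\<integral>\<^sup>+u. ennreal (u powr (1 - lam - 1) * (1 - u) powr (lam - 1)) * indicator {v 0..v a} u \<partial>lborel)"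
  proof (rule nn_integral_substitution_aux[symmetric])
    fix t assume t: "t \<in> {0..a}"
    then have *: "D t > 0" using D[of t] by auto
    have "2 * t * D t - t\<^sup>2 * (a - b) = t * (D t + a * b)" by (simp add: D_def algebra_simps power2_eq_square)
    then show "(v has_real_derivative v' t) (at t)" unfolding v_def v'_def using *
      by (auto intro!: derivative_eq_intros Dder simp: power2_eq_square)
    show "0 \<le> v' t" using * t ab by (auto simp: v'_def)
  next
    show "continuous_on {0..a} v'" unfolding v'_def using D by (intro continuous_intros Dcont) fastforce
  qed (use ab in auto)
  also have "\<dots> = ennreal (Beta (1 - lam) lam)"
    unfolding v0 va using lam by (intro nn_integral_Beta) auto
  finally show ?thesis .
qed

lemma chord_add_swap:
  assumes "0 < lam" "lam < 1" "a \<ge> 0" "b \<ge> 0" "a + b > 0"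
  shows "chord lam a b + chord lam b a = ennreal (Beta (1 - lam) lam)"
proof -
  have 0: "chord lam 0 c = 0" for c by (simp add: chord_def)
  consider "a > 0" "b > 0" | "a > 0" "b = 0" | "a = 0" "b > 0" using assms by linarith
  then show ?thesis
  proof cases
    case 1
    then show ?thesis by (rule chord_add_swap_pos[OF assms(1,2)])
  next
    case 2
    then show ?thesis using chord_eq_Beta_0[OF assms(1,2) 2(1)] by (simp only: 0 add_0_right)
  next
    case 3
    then show ?thesis using chord_eq_Beta_0[OF assms(1,2) 3(2)] by (simp only: 0 add_0_left)
  qed
qed

definition riesz_kernel :: "real \<Rightarrow> 'a::euclidean_space \<Rightarrow> 'a \<Rightarrow> ennreal" where
  "riesz_kernel s x y = inverse (ennreal (norm (x - y) powr s))"

lemma riesz_kernel_measurable [measurable]: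
  fixes f g :: "'b \<Rightarrow> 'a::euclidean_space"
  assumes [measurable]: "f \<in> borel_measurable M" "g \<in> borel_measurable M"
  shows "(\<lambda>p. riesz_kernel s (f p) (g p)) \<in> borel_measurable M"
  unfolding riesz_kernel_def by measurable

lemma riesz_kernel_commute: "riesz_kernel s x y = riesz_kernel s y x"
  by (simp add: riesz_kernel_def norm_minus_commute)

lemma riesz_kernel_eq_ennreal: "x \<noteq> y \<Longrightarrow> riesz_kernel s x y = ennreal (norm (x - y) powr - s)"
  by (simp add: riesz_kernel_def inverse_ennreal powr_minus)

lemma ennreal_inverse_antimono: "a \<le> b \<Longrightarrow> inverse b \<le> inverse (a :: ennreal)"
proof (cases "a = 0 \<or> b = top")
  case False
  assume "a \<le> b"
  then obtain x y where "a = ennreal x" "b = ennreal y" "0 < x" "x \<le> y"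
    using False by (cases a; cases b) (auto simp: top_unique)
  then show ?thesis by (simp add: inverse_ennreal le_imp_inverse_le)
qed auto

lemma riesz_kernel_mono:
  assumes "s \<ge> 0" "norm (x - y) \<le> norm (x' - y')"
  shows "riesz_kernel s x' y' \<le> riesz_kernel s x y"
  unfolding riesz_kernel_def using assms by (intro ennreal_inverse_antimono ennreal_leI powr_mono2) auto

definition sphere_area :: "nat \<Rightarrow> real" where
  "sphere_area n = real n * unit_ball_vol (real n)"

lemma emeasure_sphere_area: "emeasure (sphere_measure :: 'a::euclidean_space measure) (sphere 0 1) = ennreal (sphere_area DIM('a))"
  by (simp add: emeasure_sphere_measure_space sphere_area_def)

lemma sphere_area_pos: "n > 0 \<Longrightarrow> sphere_area n > 0"
  by (simp add: sphere_area_def)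

definition ball_density :: "real \<Rightarrow> real \<Rightarrow> 'a::euclidean_space \<Rightarrow> real" where
  "ball_density lam \<rho> y = (if norm y < \<rho> then (\<rho>\<^sup>2 - (norm y)\<^sup>2) powr (lam - 1) else 0)"

lemma ball_density_nonneg [simp]: "ball_density lam \<rho> y \<ge> 0"
  by (simp add: ball_density_def)

lemma ball_density_measurable [measurable]:
  fixes g :: "'b \<Rightarrow> 'a::euclidean_space"
  assumes [measurable]: "f \<in> borel_measurable M" "g \<in> borel_measurable M"
  shows "(\<lambda>p. ball_density lam (f p) (g p)) \<in> borel_measurable M"
  unfolding ball_density_def by measurable

definition ball_potential :: "real \<Rightarrow> real \<Rightarrow> real \<Rightarrow> 'a::euclidean_space \<Rightarrow> ennreal" where
  "ball_potential s lam \<rho> x = (\<integral>\<^sup>+y. riesz_kernel s x y * ennreal (ball_density lam \<rho> y) \<partial>lborel)"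

text \<open>Value of the potential inside the ball. The factor 1/2 arises because each pair of
  opposite directions yields one Beta integral.\<close>

definition ball_const :: "nat \<Rightarrow> real \<Rightarrow> real" where
  "ball_const n lam = sphere_area n * Beta (1 - lam) lam / 2"

text \<open>Total mass of the ball density of radius 1; for radius \<open>\<rho>\<close> it is
  multiplied by \<open>\<rho> powr s\<close>.\<close>

definition mass_const :: "nat \<Rightarrow> real \<Rightarrow> real" where
  "mass_const n lam = sphere_area n * Beta (n / 2) lam / 2"

lemma Beta_real_pos: "a > 0 \<Longrightarrow> b > 0 \<Longrightarrow> Beta a b > (0::real)"
  by (simp add: Beta_def)

lemma ball_potential_inside:
  fixes x :: "'a::euclidean_space"
  assumes lam: "0 < lam" "lam < 1" and s: "s = real DIM('a) - 2 + 2 * lam"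
    and \<rho>: "\<rho> > 0" and x: "norm x \<le> \<rho>"
  shows "ball_potential s lam \<rho> x = ennreal (ball_const DIM('a) lam)"
proof -
  interpret S: finite_measure "sphere_measure :: 'a measure" by (rule finite_measure_sphere_measure)
  define f where "f = (\<lambda>z. riesz_kernel s x (x + z) * ennreal (ball_density lam \<rho> (x + z)))"
  have [measurable]: "f \<in> borel_measurable borel" unfolding f_def by measurable
  define J where "J = (\<lambda>w. \<integral>\<^sup>+r. indicator {0<..} r * ennreal (r ^ (DIM('a) - 1)) * f (r *\<^sub>R w) \<partial>lborel)"
  have [measurable]: "J \<in> borel_measurable borel" unfolding J_def by measurable
  have "ball_potential s lam \<rho> x = (\<integral>\<^sup>+z. f z \<partial>lborel)"
    unfolding ball_potential_def f_def
    by (rule nn_integral_lborel_translate[symmetric]) measurable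
  also have "\<dots> = (\<integral>\<^sup>+w. J w \<partial>sphere_measure)"
    unfolding J_def by (rule nn_integral_polar) measurable
  finally have U: "ball_potential s lam \<rho> x = (\<integral>\<^sup>+w. J w \<partial>sphere_measure)" .
  define \<Delta> where "\<Delta> = (\<lambda>w. \<rho>\<^sup>2 - (norm x)\<^sup>2 + (x \<bullet> w)\<^sup>2)"
  have xr: "(norm x)\<^sup>2 \<le> \<rho>\<^sup>2" using x \<rho> by (intro power_mono) auto
  have J: "J w = chord lam (sqrt (\<Delta> w) - x \<bullet> w) (sqrt (\<Delta> w) + x \<bullet> w)" if w: "norm w = 1" for w
  proof -
    define a b where "a = sqrt (\<Delta> w) - x \<bullet> w" and "b = sqrt (\<Delta> w) + x \<bullet> w"
    have "sqrt ((x \<bullet> w)\<^sup>2) \<le> sqrt (\<Delta> w)" using xr by (intro real_sqrt_le_mono) (simp add: \<Delta>_def)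
    then have ab: "a \<ge> 0" "b \<ge> 0" by (auto simp: a_def b_def)
    have D0: "\<Delta> w \<ge> 0" using xr by (simp add: \<Delta>_def)
    show ?thesis unfolding J_def chord_def a_def[symmetric] b_def[symmetric]
    proof (rule nn_integral_cong)
      fix r :: real
      \<comment> \<open>Power of a point: along the line through \<open>x\<close> in direction
        \<open>w\<close> the left side is a quadratic polynomial in \<open>r\<close> with roots
        \<open>a\<close> and \<open>- b\<close>.\<close>
      have eq: "\<rho>\<^sup>2 - (norm (x + r *\<^sub>R w))\<^sup>2 = (a - r) * (r + b)"
      proof -
        have "(norm (x + r *\<^sub>R w))\<^sup>2 = (norm x)\<^sup>2 + 2 * r * (x \<bullet> w) + r\<^sup>2 * (norm w)\<^sup>2"
          unfolding power2_norm_eq_inner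
          by (simp add: inner_add_left inner_add_right inner_commute[of w x] power2_eq_square algebra_simps)
        moreover have "(a - r) * (r + b) = (sqrt (\<Delta> w))\<^sup>2 - (x \<bullet> w + r)\<^sup>2"
          by (simp add: a_def b_def algebra_simps power2_eq_square)
        ultimately show ?thesis using D0 w by (simp add: \<Delta>_def power2_eq_square algebra_simps)
      qed
      show "indicator {0<..} r * ennreal (r ^ (DIM('a) - 1)) * f (r *\<^sub>R w) =
         ennreal (r powr (1 - 2 * lam) * ((a - r) * (r + b)) powr (lam - 1)) * indicator {0<..<a} r"
      proof (cases "r > 0")
        case r: True
        have less: "norm (x + r *\<^sub>R w) < \<rho> \<longleftrightarrow> r < a"
        proof -
          have "norm (x + r *\<^sub>R w) < \<rho> \<longleftrightarrow> (norm (x + r *\<^sub>R w))\<^sup>2 < \<rho>\<^sup>2"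
            using \<rho> by (auto simp: power2_less_imp_less intro: power_strict_mono)
          also have "\<dots> \<longleftrightarrow> 0 < (a - r) * (r + b)" using eq by linarith
          also have "\<dots> \<longleftrightarrow> r < a" using r ab by (simp add: zero_less_mult_iff)
          finally show ?thesis .
        qed
        have "x \<noteq> x + r *\<^sub>R w" using w r by auto
        then have "f (r *\<^sub>R w) = ennreal (r powr (-s)) * ennreal (if r < a then ((a - r) * (r + b)) powr (lam - 1) else 0)"
          using w r by (simp add: f_def riesz_kernel_eq_ennreal ball_density_def less eq)
        moreover have "r ^ (DIM('a) - 1) * r powr (- s) = r powr (1 - 2 * lam)"
        proof -
          have "r ^ (DIM('a) - 1) = r powr (real DIM('a) - 1)"
            using r by (simp add: powr_realpow[symmetric] of_nat_diff)
          then show ?thesis by (simp add: s powr_add[symmetric])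
        qed
        ultimately show ?thesis using r
          by (cases "r < a") (simp_all add: ennreal_mult'[symmetric] mult.assoc[symmetric] powr_mult)
      qed simp
    qed
  qed
  \<comment> \<open>\<open>chord_add_swap\<close> needs a chord of positive length; this fails only
    for \<open>x\<close> on the sphere and \<open>w\<close> tangential.\<close>
  have AE: "AE w in sphere_measure. J w + J (- w) = ennreal (Beta (1 - lam) lam)"
  proof -
    have "AE w in sphere_measure. \<Delta> w > 0"
    proof (cases "norm x < \<rho>")
      case True
      then have "(norm x)\<^sup>2 < \<rho>\<^sup>2" using \<rho> by (intro power_strict_mono) auto
      then show ?thesis by (auto simp: \<Delta>_def intro!: AE_I2 add_pos_nonneg)
    next
      case False
      then have "x \<noteq> 0" using \<rho> by auto
      from AE_sphere_measure_inner_neq_0[OF this] show ?thesis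
        using xr by (auto simp: \<Delta>_def elim!: eventually_mono intro!: add_nonneg_pos)
    qed
    then show ?thesis
    proof (rule AE_mp, intro AE_I2 impI)
      fix w :: 'a assume "w \<in> space sphere_measure" and D: "\<Delta> w > 0"
      then have w: "norm w = 1" by simp
      have "sqrt ((x \<bullet> w)\<^sup>2) \<le> sqrt (\<Delta> w)" using xr by (intro real_sqrt_le_mono) (simp add: \<Delta>_def)
      then have ab: "sqrt (\<Delta> w) - x \<bullet> w \<ge> 0" "sqrt (\<Delta> w) + x \<bullet> w \<ge> 0" by auto
      have "\<Delta> (- w) = \<Delta> w" by (simp add: \<Delta>_def)
      then show "J w + J (- w) = ennreal (Beta (1 - lam) lam)"
        using w D ab chord_add_swap[OF lam ab] J[of w] J[of "- w"] by simp
    qed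
  qed
  \<comment> \<open>Averaging over \<open>w\<close> and \<open>- w\<close> doubles the potential and
    makes the integrand constant.\<close>
  have "(\<integral>\<^sup>+w. J w \<partial>sphere_measure) + (\<integral>\<^sup>+w. J w \<partial>sphere_measure) =
      (\<integral>\<^sup>+w. J w \<partial>sphere_measure) + (\<integral>\<^sup>+w. J (- w) \<partial>sphere_measure)"
    by (simp add: nn_integral_sphere_measure_uminus)
  also have "\<dots> = (\<integral>\<^sup>+w. J w + J (- w) \<partial>sphere_measure)"
    by (rule nn_integral_add[symmetric]) (auto intro!: borel_measurable_sphere_measureI)
  also have "\<dots> = (\<integral>\<^sup>+w. ennreal (Beta (1 - lam) lam) \<partial>(sphere_measure :: 'a measure))"
    by (rule nn_integral_cong_AE[OF AE])
  also have "\<dots> = ennreal (2 * ball_const DIM('a) lam)"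
    using Beta_real_pos[of "1 - lam" lam] lam sphere_area_pos[of "DIM('a)"]
    by (simp add: emeasure_sphere_area ball_const_def ennreal_mult[symmetric] less_imp_le mult.commute)
  finally have "2 * ball_potential s lam \<rho> x = ennreal (2 * ball_const DIM('a) lam)"
    by (simp only: U mult_2)
  also have "\<dots> = 2 * ennreal (ball_const DIM('a) lam)"
    by (subst ennreal_mult') simp_all
  finally have "2 * ball_potential s lam \<rho> x = 2 * ennreal (ball_const DIM('a) lam)" .
  then show ?thesis by (simp add: ennreal_mult_cancel_left)
qed

text \<open>All potentials are radial, which reduces later arguments to a single ray.\<close>

lemma ball_potential_norm_cong:
  fixes x x' :: "'a::euclidean_space"
  assumes "norm x = norm x'"
  shows "ball_potential s lam \<rho> x = ball_potential s lam \<rho> x'"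
proof -
  obtain T :: "'a \<Rightarrow> 'a" where T: "linear T" "\<And>z. T (T z) = z" "\<And>z. norm (T z) = norm z" "T x = x'"
    using exists_reflection[OF assms] by blast
  have "norm (T x - T y) = norm (x - y)" for y
    using T(3)[of "x - y"] linear_diff[OF T(1)] by simp
  then have "riesz_kernel s x y * ennreal (ball_density lam \<rho> y) = riesz_kernel s x' (T y) * ennreal (ball_density lam \<rho> (T y))" for y
    unfolding riesz_kernel_def ball_density_def T(4)[symmetric] by (simp add: T(3))
  then show ?thesis unfolding ball_potential_def
    using nn_integral_lborel_isometry[OF _ T(1-3), of "\<lambda>y. riesz_kernel s x' y * ennreal (ball_density lam \<rho> y)"] by simp
qed

text \<open>From a point outside the open ball, moving radially outwards increases the distance to
  every point of the ball, so the kernel decreases.\<close>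

lemma ball_potential_antimono:
  fixes x x' :: "'a::euclidean_space"
  assumes "s \<ge> 0" "0 < \<rho>" "\<rho> \<le> norm x" "norm x \<le> norm x'"
  shows "ball_potential s lam \<rho> x' \<le> ball_potential s lam \<rho> x"
proof -
  define c where "c = norm x' / norm x"
  have nx: "norm x > 0" using assms by linarith
  then have c: "c \<ge> 1" using assms by (simp add: c_def le_divide_eq)
  have "ball_potential s lam \<rho> x' = ball_potential s lam \<rho> (c *\<^sub>R x)"
    using nx by (intro ball_potential_norm_cong) (simp add: c_def)
  also have "\<dots> \<le> ball_potential s lam \<rho> x"
    unfolding ball_potential_def
  proof (rule nn_integral_mono)
    fix y :: 'a
    show "riesz_kernel s (c *\<^sub>R x) y * ennreal (ball_density lam \<rho> y) \<le> riesz_kernel s x y * ennreal (ball_density lam \<rho> y)"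
    proof (cases "norm y < \<rho>")
      case True
      have "x \<bullet> y \<le> norm x * norm y" by (rule norm_cauchy_schwarz)
      also have "\<dots> \<le> norm x * norm x" using True assms by (intro mult_left_mono) auto
      finally have 1: "x \<bullet> y \<le> x \<bullet> x" by (simp add: power2_norm_eq_inner[symmetric] power2_eq_square)
      have "1 * (x \<bullet> x) \<le> c * (x \<bullet> x)" using c by (intro mult_right_mono) auto
      \<comment> \<open>Product form of \<open>|c x - y|\<^sup>2 - |x - y|\<^sup>2\<close>; both
        factors are nonnegative because \<open>x \<bullet> y \<le> x \<bullet> x\<close>.\<close>
      then have "0 \<le> (c - 1) * ((c + 1) * (x \<bullet> x) - 2 * (x \<bullet> y))"
        using 1 c by (intro mult_nonneg_nonneg) (auto simp: algebra_simps)
      also have "\<dots> = (norm (c *\<^sub>R x - y))\<^sup>2 - (norm (x - y))\<^sup>2"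
      proof -
        have sq: "(norm (a *\<^sub>R x - y))\<^sup>2 = a\<^sup>2 * (x \<bullet> x) - 2 * a * (x \<bullet> y) + y \<bullet> y" for a
          unfolding power2_norm_eq_inner
          by (simp add: inner_diff_left inner_diff_right inner_commute[of y x] power2_eq_square right_diff_distrib)
        show ?thesis unfolding sq[of c] sq[of 1, unfolded scaleR_one]
          by (simp add: left_diff_distrib right_diff_distrib distrib_right distrib_left power2_eq_square)
      qed
      finally have "(norm (x - y))\<^sup>2 \<le> (norm (c *\<^sub>R x - y))\<^sup>2" by (simp only: diff_ge_0_iff_ge)
      then have "norm (x - y) \<le> norm (c *\<^sub>R x - y)" by (rule power2_le_imp_le) simp
      then show ?thesis by (intro mult_right_mono[OF riesz_kernel_mono[OF assms(1)]]) simp_all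
    qed (simp add: ball_density_def)
  qed
  finally show ?thesis .
qed

text \<open>A maximum principle: outside, the potential is at most its value at the radial
  projection onto the sphere, where it equals the inside constant.\<close>

lemma ball_potential_le:
  fixes x :: "'a::euclidean_space"
  assumes "0 < lam" "lam < 1" and "s = real DIM('a) - 2 + 2 * lam" "s \<ge> 0" "\<rho> > 0"
  shows "ball_potential s lam \<rho> x \<le> ennreal (ball_const DIM('a) lam)"
proof (cases "norm x \<le> \<rho>")
  case True
  then show ?thesis using ball_potential_inside[OF assms(1-3,5)] by auto
next
  case False
  define y where "y = (\<rho> / norm x) *\<^sub>R x"
  have y: "norm y = \<rho>" using False assms by (auto simp: y_def)
  have "ball_potential s lam \<rho> x \<le> ball_potential s lam \<rho> y"
    using False y assms by (intro ball_potential_antimono) auto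
  also have "\<dots> = ennreal (ball_const DIM('a) lam)"
    using y by (intro ball_potential_inside assms) auto
  finally show ?thesis .
qed

text \<open>Substituting \<open>v = r\<^sup>2 / \<rho>\<^sup>2\<close> gives a Beta integral; this
  is where the exponent \<open>s\<close> in the mass of a ball density comes from.\<close>

lemma nn_integral_radial_power:
  assumes lam: "0 < lam" and n: "n > 0" and \<rho>: "\<rho> > 0"
  shows "(\<integral>\<^sup>+r. ennreal (r ^ (n - 1) * (\<rho>\<^sup>2 - r\<^sup>2) powr (lam - 1)) * indicator {0<..<\<rho>} r \<partial>lborel) =
    ennreal (Beta (n / 2) lam / 2 * \<rho> powr (real n - 2 + 2 * lam))"
proof -
  define c where "c = \<rho> powr (real n - 2 + 2 * lam)"
  have c: "c > 0" using \<rho> by (simp add: c_def)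
  have "ennreal (Beta (n / 2) lam) = (\<integral>\<^sup>+v. ennreal (v powr (n / 2 - 1) * (1 - v) powr (lam - 1)) *
      indicator {0\<^sup>2 / \<rho>\<^sup>2..\<rho>\<^sup>2 / \<rho>\<^sup>2} v \<partial>lborel)"
    using assms by (subst nn_integral_Beta[symmetric]) auto
  also have "\<dots> = (\<integral>\<^sup>+r. ennreal ((r\<^sup>2 / \<rho>\<^sup>2) powr (n / 2 - 1) * (1 - r\<^sup>2 / \<rho>\<^sup>2) powr (lam - 1)) * ennreal (2 * r / \<rho>\<^sup>2) * indicator {0..\<rho>} r \<partial>lborel)"
    by (rule nn_integral_substitution_aux) (use assms in \<open>auto intro!: derivative_eq_intros continuous_intros simp: power2_eq_square\<close>)
  also have "\<dots> = (\<integral>\<^sup>+r. ennreal (2 / c) * (ennreal (r ^ (n - 1) * (\<rho>\<^sup>2 - r\<^sup>2) powr (lam - 1)) * indicator {0<..<\<rho>} r) \<partial>lborel)"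
  proof (rule nn_integral_cong_AE, rule AE_mp[OF AE_lborel_doubleton[of 0 \<rho>]], intro AE_I2 impI)
    fix r :: real assume r: "r \<noteq> 0 \<and> r \<noteq> \<rho>"
    show "ennreal ((r\<^sup>2 / \<rho>\<^sup>2) powr (n / 2 - 1) * (1 - r\<^sup>2 / \<rho>\<^sup>2) powr (lam - 1)) * ennreal (2 * r / \<rho>\<^sup>2) * indicator {0..\<rho>} r =
      ennreal (2 / c) * (ennreal (r ^ (n - 1) * (\<rho>\<^sup>2 - r\<^sup>2) powr (lam - 1)) * indicator {0<..<\<rho>} r)"
    proof (cases "0 < r \<and> r < \<rho>")
      case True
      then have p: "\<rho>\<^sup>2 - r\<^sup>2 > 0" by (simp add: power_strict_mono)
      define P where "P = \<rho>\<^sup>2 - r\<^sup>2"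
      have e: "1 - r\<^sup>2 / \<rho>\<^sup>2 = P / \<rho>\<^sup>2" using \<rho> by (simp add: P_def diff_divide_distrib)
      have "(r\<^sup>2 / \<rho>\<^sup>2) powr (n / 2 - 1) = r powr (real n - 2) / \<rho> powr (real n - 2)"
        using True \<rho> by (simp add: powr_divide powr_powr flip: powr_numeral)
      moreover have "(P / \<rho>\<^sup>2) powr (lam - 1) = P powr (lam - 1) / \<rho> powr (2 * lam - 2)"
        using True \<rho> p by (simp add: powr_divide powr_powr P_def flip: powr_numeral)
      moreover have "r powr (real n - 2) * r = r ^ (n - 1)"
      proof -
        have "r powr (real n - 2) * r powr 1 = r powr real (n - 1)"
          using n by (simp only: powr_add[symmetric]) (simp add: of_nat_diff)
        then show ?thesis using True by (simp add: powr_realpow)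
      qed
      moreover have "\<rho> powr (real n - 2) * \<rho> powr (2 * lam - 2) * \<rho>\<^sup>2 = c"
        using \<rho> by (simp add: c_def powr_add[symmetric] flip: powr_numeral) (simp add: algebra_simps)
      ultimately have "(r\<^sup>2 / \<rho>\<^sup>2) powr (n / 2 - 1) * (1 - r\<^sup>2 / \<rho>\<^sup>2) powr (lam - 1) * (2 * r / \<rho>\<^sup>2) =
          2 / c * (r ^ (n - 1) * P powr (lam - 1))"
        unfolding e by (auto simp: field_simps)
      then show ?thesis using True c \<rho> by (simp add: P_def flip: ennreal_mult'')
    qed (use r in \<open>auto simp: indicator_def\<close>)
  qed
  also have "\<dots> = ennreal (2 / c) * (\<integral>\<^sup>+r. (ennreal (r ^ (n - 1) * (\<rho>\<^sup>2 - r\<^sup>2) powr (lam - 1)) * indicator {0<..<\<rho>} r) \<partial>lborel)"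
    by (rule nn_integral_cmult) measurable
  finally have "ennreal (c / 2) * ennreal (Beta (n / 2) lam) = ennreal (c / 2) * (ennreal (2 / c) * (\<integral>\<^sup>+r. (ennreal (r ^ (n - 1) * (\<rho>\<^sup>2 - r\<^sup>2) powr (lam - 1)) * indicator {0<..<\<rho>} r) \<partial>lborel))"
    by (rule arg_cong)
  moreover have "ennreal (c / 2) * (ennreal (2 / c) * z) = z" for z
    using c by (simp add: mult.assoc[symmetric] ennreal_mult'[symmetric])
  moreover have "ennreal (c / 2) * ennreal (Beta (n / 2) lam) = ennreal (Beta (n / 2) lam / 2 * c)"
    using c by (simp add: ennreal_mult'[symmetric] mult.commute)
  ultimately show ?thesis by (simp add: c_def)
qed

lemma nn_integral_ball_density:
  assumes lam: "0 < lam" and s: "s = real DIM('a::euclidean_space) - 2 + 2 * lam" and \<rho>: "\<rho> > 0"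
  shows "(\<integral>\<^sup>+y. ennreal (ball_density lam \<rho> (y::'a)) \<partial>lborel) = ennreal (mass_const DIM('a) lam * \<rho> powr s)"
proof -
  define f where "f = (\<lambda>r. ennreal (if r < \<rho> then (\<rho>\<^sup>2 - r\<^sup>2) powr (lam - 1) else 0))"
  have "(\<integral>\<^sup>+y. ennreal (ball_density lam \<rho> (y::'a)) \<partial>lborel) = (\<integral>\<^sup>+y. f (norm (y::'a)) \<partial>lborel)"
    by (simp add: f_def ball_density_def)
  also have "\<dots> = ennreal (sphere_area DIM('a)) * (\<integral>\<^sup>+r. indicator {0<..} r * ennreal (r ^ (DIM('a) - 1)) * f r \<partial>lborel)"
    unfolding emeasure_sphere_area[symmetric] by (rule nn_integral_radial) (simp add: f_def)
  also have "(\<integral>\<^sup>+r. indicator {0<..} r * ennreal (r ^ (DIM('a) - 1)) * f r \<partial>lborel) =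
     (\<integral>\<^sup>+r. ennreal (r ^ (DIM('a) - 1) * (\<rho>\<^sup>2 - r\<^sup>2) powr (lam - 1)) * indicator {0<..<\<rho>} r \<partial>lborel)"
    by (intro nn_integral_cong) (auto simp: f_def indicator_def ennreal_mult'')
  also have "\<dots> = ennreal (Beta (DIM('a) / 2) lam / 2 * \<rho> powr s)"
    unfolding s by (intro nn_integral_radial_power lam \<rho>) simp
  finally show ?thesis
    using sphere_area_pos[of "DIM('a)"] by (simp add: mass_const_def ennreal_mult'[symmetric] mult_ac)
qed

section \<open>Positive definiteness of the Riesz kernel\<close>

text \<open>The pair \<open>p\<close> consists of radius and centre. As a function of all variables
  jointly the membership indicator is measurable, so Tonelli applies in every order.\<close>

definition ball_mem :: "'a::euclidean_space \<Rightarrow> real \<times> 'a \<Rightarrow> ennreal" where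
  "ball_mem x p = (if norm (x - snd p) < fst p then 1 else 0)"

lemma ball_mem_measurable [measurable]:
  fixes f :: "'b \<Rightarrow> 'a::euclidean_space"
  assumes [measurable]: "f \<in> borel_measurable M" "g \<in> M \<rightarrow>\<^sub>M borel \<Otimes>\<^sub>M borel"
  shows "(\<lambda>p. ball_mem (f p) (g p)) \<in> borel_measurable M"
  unfolding ball_mem_def by measurable

lemma ball_mem_measurable1 [measurable]: "(\<lambda>y. ball_mem y p) \<in> borel_measurable borel"
  unfolding ball_mem_def by measurable

lemma nn_integral_ball_mem:
  fixes K :: "'a::euclidean_space measure"
  assumes K: "sets K = sets borel"
  shows "(\<integral>\<^sup>+x. ball_mem x p \<partial>K) = emeasure K {x. norm (x - snd p) < fst p}"
proof -
  have "{x. norm (x - snd p) < fst p} \<in> sets K" by (subst K) measurable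
  moreover have "ball_mem x p = indicator {x. norm (x - snd p) < fst p} x" for x :: 'a
    by (simp add: ball_mem_def)
  ultimately show ?thesis by simp
qed

lemma nn_integral_ball_mem_lborel:
  fixes x :: "'a::euclidean_space"
  assumes "\<rho> > 0"
  shows "(\<integral>\<^sup>+z. ball_mem x (\<rho>, z) \<partial>lborel) = ennreal (unit_ball_vol DIM('a) * \<rho> ^ DIM('a))"
proof -
  have "ball_mem x (\<rho>, z) = indicator (ball x \<rho>) z" for z :: 'a
    by (simp add: ball_mem_def dist_norm)
  then show ?thesis using assms by (simp add: emeasure_ball)
qed

lemma borel_Collect_infdist_less: "{x. infdist x C < r} \<in> sets borel"
  by (intro borel_open open_Collect_less continuous_intros continuous_on_infdist)

definition ball_weight :: "real \<Rightarrow> nat \<Rightarrow> real \<Rightarrow> ennreal" where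
  "ball_weight s n \<rho> = ennreal (\<rho> powr (- s - n - 1)) * indicator {0<..} \<rho>"

lemma ball_weight_measurable [measurable]: "ball_weight s n \<in> borel_measurable borel"
  unfolding ball_weight_def by measurable

text \<open>
  The representation of Fefferman and de la Llave: up to a constant factor, the Riesz kernel is the
  integral over \<open>\<rho>\<close> of \<open>\<rho>\<close> to the power \<open>- s - n - 1\<close> times the volume of the intersection of the
  balls of radius \<open>\<rho>\<close> around the two points.
\<close>

definition overlap :: "real \<Rightarrow> 'a::euclidean_space \<Rightarrow> 'a \<Rightarrow> ennreal" where
  "overlap s x y = (\<integral>\<^sup>+\<rho>. \<integral>\<^sup>+z. ball_weight s DIM('a) \<rho> * (ball_mem x (\<rho>, z) * ball_mem y (\<rho>, z)) \<partial>lborel \<partial>lborel)"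

lemma overlap_translate: "overlap s x y = overlap s (x - y) (0::'a::euclidean_space)"
proof -
  have "(\<integral>\<^sup>+z. ball_weight s DIM('a) \<rho> * (ball_mem x (\<rho>, z) * ball_mem y (\<rho>, z)) \<partial>lborel) =
        (\<integral>\<^sup>+z. ball_weight s DIM('a) \<rho> * (ball_mem (x - y) (\<rho>, z) * ball_mem 0 (\<rho>, z)) \<partial>lborel)" for \<rho>
    by (subst nn_integral_lborel_translate[of _ y, symmetric]) (simp_all add: ball_mem_def algebra_simps)
  then show ?thesis by (simp add: overlap_def)
qed

lemma overlap_norm_cong:
  fixes x y :: "'a::euclidean_space"
  assumes "norm x = norm y"
  shows "overlap s x 0 = overlap s y 0"
proof -
  obtain T :: "'a \<Rightarrow> 'a" where T: "linear T" "\<And>z. T (T z) = z" "\<And>z. norm (T z) = norm z" "T x = y"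
    using exists_reflection[OF assms] by blast
  have "norm (T x - T z) = norm (x - z)" for z
    using T(3)[of "x - z"] linear_diff[OF T(1)] by simp
  then have "ball_mem y (\<rho>, T z) = ball_mem x (\<rho>, z)" "ball_mem 0 (\<rho>, T z) = ball_mem 0 (\<rho>, z)" for \<rho> z
    unfolding T(4)[symmetric] by (simp_all add: ball_mem_def T(3))
  then have "(\<integral>\<^sup>+z. ball_weight s DIM('a) \<rho> * (ball_mem x (\<rho>, z) * ball_mem 0 (\<rho>, z)) \<partial>lborel) =
        (\<integral>\<^sup>+z. ball_weight s DIM('a) \<rho> * (ball_mem y (\<rho>, z) * ball_mem 0 (\<rho>, z)) \<partial>lborel)" for \<rho>
    using nn_integral_lborel_isometry[OF _ T(1-3), of "\<lambda>z. ball_weight s DIM('a) \<rho> * (ball_mem y (\<rho>, z) * ball_mem 0 (\<rho>, z))"]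
    by simp
  then show ?thesis by (simp add: overlap_def)
qed

text \<open>Substituting \<open>d * \<rho>\<close> and \<open>d *\<^sub>R z\<close> produces the
  factors \<open>d\<close>, \<open>d ^ DIM('a)\<close> and a power of \<open>d\<close> from the
  weight; the exponent in \<open>ball_weight\<close> is chosen so that they combine to
  \<open>d powr - s\<close>.\<close>

lemma overlap_scale:
  fixes x :: "'a::euclidean_space"
  assumes d: "d > 0"
  shows "overlap s (d *\<^sub>R x) 0 = ennreal (d powr - s) * overlap s x 0"
proof -
  have scale: "norm (d *\<^sub>R a - d *\<^sub>R z) < d * \<rho> \<longleftrightarrow> norm (a - z) < \<rho>" for a z :: 'a and \<rho>
    using d by (simp flip: scaleR_diff_right)
  have bm: "ball_mem (d *\<^sub>R x) (d * \<rho>, d *\<^sub>R z) = ball_mem x (\<rho>, z)" "ball_mem 0 (d * \<rho>, d *\<^sub>R z) = ball_mem 0 (\<rho>, z)"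
    for \<rho> and z
    using scale[of x z \<rho>] scale[of 0 z \<rho>] by (simp_all add: ball_mem_def)
  have bw: "ball_weight s DIM('a) (d * \<rho>) = ennreal (d powr (- s - DIM('a) - 1)) * ball_weight s DIM('a) \<rho>" for \<rho>
    using d by (cases "\<rho> > 0") (simp_all add: ball_weight_def powr_mult ennreal_mult' zero_less_mult_iff)
  have "overlap s (d *\<^sub>R x) 0 = ennreal d * (\<integral>\<^sup>+\<rho>. \<integral>\<^sup>+z. ball_weight s DIM('a) (d * \<rho>) *
      (ball_mem (d *\<^sub>R x) (d * \<rho>, z) * ball_mem 0 (d * \<rho>, z)) \<partial>lborel \<partial>lborel)"
    unfolding overlap_def using d by (subst nn_integral_real_affine[of _ d 0]) simp_all
  also have "\<dots> = ennreal d * (\<integral>\<^sup>+\<rho>. ennreal (d ^ DIM('a)) * (\<integral>\<^sup>+z. ball_weight s DIM('a) (d * \<rho>) *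
      (ball_mem (d *\<^sub>R x) (d * \<rho>, d *\<^sub>R z) * ball_mem 0 (d * \<rho>, d *\<^sub>R z)) \<partial>lborel) \<partial>lborel)"
    using d by (subst nn_integral_lborel_scaleR[of _ d]) simp_all
  also have "\<dots> = (ennreal d * ennreal (d ^ DIM('a)) * ennreal (d powr (- s - DIM('a) - 1))) * overlap s x 0"
    unfolding bm bw by (simp add: overlap_def nn_integral_cmult mult.assoc)
  also have "ennreal d * ennreal (d ^ DIM('a)) * ennreal (d powr (- s - DIM('a) - 1)) = ennreal (d powr - s)"
  proof -
    have "d * d ^ DIM('a) * d powr (- s - DIM('a) - 1) = d powr 1 * d powr (DIM('a)) * d powr (- s - DIM('a) - 1)"
      using d by (simp add: powr_realpow)
    also have "\<dots> = d powr - s" by (simp only: powr_add[symmetric]) simp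
    finally show ?thesis using d by (simp add: ennreal_mult'[symmetric])
  qed
  finally show ?thesis .
qed

text \<open>Finite because balls of radius below 1/2 around the two points are disjoint and
  \<open>\<rho> powr (- s - 1)\<close> is integrable at infinity. Positive because, for a radius in
  \<open>{2..3}\<close>, every centre in the unit ball around 0 is close enough to both
  points.\<close>

lemma overlap_unit:
  fixes e :: "'a::euclidean_space"
  assumes e: "norm e = 1" and s: "s > 0"
  shows "overlap s e 0 < top" "overlap s e 0 > 0"
proof -
  let ?n = "DIM('a)"
  have "overlap s e 0 \<le> (\<integral>\<^sup>+\<rho>. ennreal (unit_ball_vol ?n) * (ennreal (\<rho> powr (- s - 1)) * indicator {1/2..} \<rho>) \<partial>lborel)"
    unfolding overlap_def
  proof (rule nn_integral_mono)
    fix \<rho> :: real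
    show "(\<integral>\<^sup>+z. ball_weight s ?n \<rho> * (ball_mem e (\<rho>, z) * ball_mem 0 (\<rho>, z)) \<partial>lborel) \<le>
       ennreal (unit_ball_vol ?n) * (ennreal (\<rho> powr (- s - 1)) * indicator {1/2..} \<rho>)"
    proof (cases "\<rho> \<ge> 1/2")
      case True
      have "(\<integral>\<^sup>+z. ball_weight s ?n \<rho> * (ball_mem e (\<rho>, z) * ball_mem 0 (\<rho>, z)) \<partial>lborel) \<le>
         (\<integral>\<^sup>+z. ball_weight s ?n \<rho> * ball_mem e (\<rho>, z) \<partial>lborel)"
        by (intro nn_integral_mono mult_left_mono) (auto simp: ball_mem_def)
      also have "\<dots> = ennreal (\<rho> powr (- s - ?n - 1)) * ennreal (unit_ball_vol ?n * \<rho> ^ ?n)"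
        using True by (simp add: nn_integral_cmult nn_integral_ball_mem_lborel) (simp add: ball_weight_def)
      also have "\<dots> = ennreal (unit_ball_vol ?n * (\<rho> powr (- s - ?n - 1) * \<rho> powr ?n))"
        using True by (simp add: ennreal_mult'[symmetric] powr_realpow mult_ac)
      also have "\<rho> powr (- s - ?n - 1) * \<rho> powr ?n = \<rho> powr (- s - 1)"
        by (simp only: powr_add[symmetric]) simp
      finally show ?thesis using True by (simp add: ennreal_mult')
    next
      case False
      have "ball_mem e (\<rho>, z) * ball_mem 0 (\<rho>, z) = 0" for z
      proof -
        have "norm e \<le> norm (e - z) + norm z" using norm_triangle_ineq[of "e - z" z] by simp
        then show ?thesis using False e by (auto simp: ball_mem_def)
      qed
      then have "(\<integral>\<^sup>+z. ball_weight s ?n \<rho> * (ball_mem e (\<rho>, z) * ball_mem 0 (\<rho>, z)) \<partial>lborel) = (\<integral>\<^sup>+z. 0 \<partial>(lborel :: 'a measure))"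
        by (intro nn_integral_cong) (simp only: mult_zero_right)
      then show ?thesis by simp
    qed
  qed
  also have "\<dots> = ennreal (unit_ball_vol ?n) * (\<integral>\<^sup>+\<rho>. ennreal (\<rho> powr (- s - 1)) * indicator {1/2..} \<rho> \<partial>lborel)"
    by (rule nn_integral_cmult) measurable
  also have "(\<integral>\<^sup>+\<rho>. ennreal (\<rho> powr (- s - 1)) * indicator {1/2..} \<rho> \<partial>lborel) = ennreal (0 - (- ((1/2) powr (- s)) / s))"
  proof (rule nn_integral_FTC_atLeast)
    show "((\<lambda>\<rho>. - (\<rho> powr (- s)) / s) \<longlongrightarrow> 0) at_top"
    proof -
      have "((\<lambda>\<rho>::real. \<rho> powr (- s)) \<longlongrightarrow> 0) at_top"
        using s by (intro tendsto_neg_powr filterlim_ident) auto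
      then have "((\<lambda>\<rho>::real. - (\<rho> powr (- s)) / s) \<longlongrightarrow> - 0 / s) at_top"
        using s by (intro tendsto_intros) auto
      then show ?thesis by simp
    qed
    fix \<rho> :: real assume "1/2 \<le> \<rho>"
    then show "((\<lambda>\<rho>. - (\<rho> powr (- s)) / s) has_real_derivative \<rho> powr (- s - 1)) (at \<rho>)"
      using s by (auto intro!: derivative_eq_intros)
  qed auto
  finally show "overlap s e 0 < top"
    by (rule order.strict_trans1) (auto simp: ennreal_mult_less_top)
  have "0 < ennreal (3 powr (- s - ?n - 1) * unit_ball_vol ?n)"
    by simp
  also have "\<dots> = (\<integral>\<^sup>+\<rho>. ennreal (3 powr (- s - ?n - 1) * unit_ball_vol ?n) * indicator {2..3} \<rho> \<partial>(lborel::real measure))"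
    by (subst nn_integral_cmult_indicator) auto
  also have "\<dots> \<le> overlap s e 0"
    unfolding overlap_def
  proof (rule nn_integral_mono)
    fix \<rho> :: real
    show "ennreal (3 powr (- s - ?n - 1) * unit_ball_vol ?n) * indicator {2..3} \<rho> \<le>
      (\<integral>\<^sup>+z. ball_weight s ?n \<rho> * (ball_mem e (\<rho>, z) * ball_mem 0 (\<rho>, z)) \<partial>lborel)"
    proof (cases "\<rho> \<in> {2..3}")
      case True
      have "ennreal (3 powr (- s - ?n - 1) * unit_ball_vol ?n) = ennreal (3 powr (- s - ?n - 1)) * ennreal (unit_ball_vol ?n)"
        by (simp add: ennreal_mult')
      also have "ennreal (3 powr (- s - ?n - 1)) \<le> ball_weight s ?n \<rho>"
        using True s by (auto simp: ball_weight_def intro!: ennreal_leI powr_mono2')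
      also have "ball_weight s ?n \<rho> * ennreal (unit_ball_vol ?n) = (\<integral>\<^sup>+z. ball_weight s ?n \<rho> * ball_mem 0 (1, z) \<partial>(lborel :: 'a measure))"
        using nn_integral_ball_mem_lborel[of 1 "0::'a"] by (simp add: nn_integral_cmult)
      also have "\<dots> \<le> (\<integral>\<^sup>+z. ball_weight s ?n \<rho> * (ball_mem e (\<rho>, z) * ball_mem 0 (\<rho>, z)) \<partial>lborel)"
      proof (intro nn_integral_mono mult_left_mono)
        fix z :: 'a
        have "norm (e - z) \<le> norm e + norm z" by (rule norm_triangle_ineq4)
        then show "ball_mem 0 (1, z) \<le> ball_mem e (\<rho>, z) * ball_mem 0 (\<rho>, z)"
          using True e by (auto simp: ball_mem_def)
      qed simp
      finally show ?thesis using True by (simp add: mult_right_mono)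
    qed simp
  qed
  finally show "overlap s e 0 > 0" .
qed

lemma overlap_le_diag: "overlap s x y \<le> overlap s x x"
proof -
  have "overlap s x y \<le> overlap s y y"
    unfolding overlap_def by (intro nn_integral_mono mult_left_mono) (auto simp: ball_mem_def)
  also have "\<dots> = overlap s x x"
    using overlap_translate[of s y y] overlap_translate[of s x x] by simp
  finally show ?thesis .
qed

text \<open>Translation, reflection and scaling determine the overlap off the diagonal up to one
  constant, its value at distance 1. On the diagonal both sides are infinite.\<close>

lemma overlap_eq_riesz_kernel:
  assumes s: "s > 0"
  obtains c where "c > 0" "c < top"
    "\<And>x y :: 'a::euclidean_space. overlap s x y = c * riesz_kernel s x y"
proof -
  obtain e :: 'a where e: "norm e = 1" using vector_choose_size[of 1] by auto
  define c where "c = overlap s e 0"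
  have c: "c > 0" "c < top" unfolding c_def by (rule overlap_unit[OF e s])+
  have neq: "overlap s x y = c * riesz_kernel s x y" if "x \<noteq> y" for x y :: 'a
  proof -
    have d: "norm (x - y) > 0" using that by simp
    have "overlap s x y = overlap s (norm (x - y) *\<^sub>R e) 0"
      by (subst overlap_translate, rule overlap_norm_cong) (simp add: e)
    also have "\<dots> = ennreal (norm (x - y) powr - s) * c"
      unfolding c_def by (rule overlap_scale[OF d])
    finally show ?thesis using that by (simp add: riesz_kernel_eq_ennreal mult.commute)
  qed
  have "overlap s x x = top" for x :: 'a
  proof (rule ccontr)
    assume "overlap s x x \<noteq> top"
    then obtain b where b: "overlap s x x = ennreal b" "b \<ge> 0" by (cases "overlap s x x") auto
    obtain k where k: "c = ennreal k" "k > 0" using c by (cases c) auto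
    \<comment> \<open>The distance at which the overlap equals \<open>b + 1\<close>, more than the
      finite value \<open>b\<close> assumed on the diagonal.\<close>
    define t where "t = ((b + 1) / k) powr (- 1 / s)"
    have t: "t > 0" using b k by (simp add: t_def)
    define y where "y = x + t *\<^sub>R e"
    have y: "x \<noteq> y" "norm (x - y) = t" using t e by (auto simp: y_def)
    have "t powr - s = (b + 1) / k" using b k s by (simp add: t_def powr_powr)
    then have "overlap s x y = ennreal (b + 1)"
      using neq[OF y(1)] y k b by (simp add: riesz_kernel_eq_ennreal ennreal_mult'[symmetric])
    then have "ennreal (b + 1) \<le> ennreal b" using overlap_le_diag[of s x y] b by simp
    then show False using b by simp
  qed
  moreover have "riesz_kernel s x x = top" for x :: 'a by (simp add: riesz_kernel_def)
  ultimately have "overlap s x x = c * riesz_kernel s x x" for x :: 'a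
    using c by (simp add: ennreal_mult_top)
  with neq have "overlap s x y = c * riesz_kernel s x y" for x y :: 'a by (cases "x = y") auto
  then show ?thesis using that[OF c] by blast
qed

section \<open>Energies as integrals of products of ball masses\<close>

definition mutual_energy :: "real \<Rightarrow> 'a::euclidean_space measure \<Rightarrow> 'a measure \<Rightarrow> ennreal" where
  "mutual_energy s M N = (\<integral>\<^sup>+x. \<integral>\<^sup>+y. riesz_kernel s x y \<partial>N \<partial>M)"

text \<open>After the exchange of integrals the energy is a weighted inner product of the functions
  that send a ball to its mass, so positive definiteness of the kernel becomes positivity of
  squares.\<close>

lemma mutual_energy_overlap:
  fixes M N :: "'a::euclidean_space measure"
  assumes M: "finite_measure M" "sets M = sets borel" and N: "finite_measure N" "sets N = sets borel"
  shows "(\<integral>\<^sup>+x. \<integral>\<^sup>+y. overlap s x y \<partial>N \<partial>M) =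
    (\<integral>\<^sup>+p. ball_weight s DIM('a) (fst p) * (emeasure M {x. norm (x - snd p) < fst p} * emeasure N {x. norm (x - snd p) < fst p}) \<partial>(lborel \<Otimes>\<^sub>M lborel))"
proof -
  interpret M: finite_measure M by fact
  interpret N: finite_measure N by fact
  interpret L: sigma_finite_measure "lborel \<Otimes>\<^sub>M lborel :: (real \<times> 'a) measure"
    by (simp add: lborel_prod sigma_finite_lborel)
  interpret PM: pair_sigma_finite M "lborel \<Otimes>\<^sub>M lborel :: (real \<times> 'a) measure" ..
  interpret PN: pair_sigma_finite N "lborel \<Otimes>\<^sub>M lborel :: (real \<times> 'a) measure" ..
  note [measurable_cong] = M(2) N(2)
  have ov: "overlap s x y = (\<integral>\<^sup>+p. ball_weight s DIM('a) (fst p) * (ball_mem x p * ball_mem y p) \<partial>(lborel \<Otimes>\<^sub>M lborel))" for x y :: 'a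
    unfolding overlap_def by (subst lborel.nn_integral_fst[symmetric]) simp_all
  have "(\<integral>\<^sup>+x. \<integral>\<^sup>+y. overlap s x y \<partial>N \<partial>M) =
     (\<integral>\<^sup>+x. (\<integral>\<^sup>+p. (\<integral>\<^sup>+y. ball_weight s DIM('a) (fst p) * (ball_mem x p * ball_mem y p) \<partial>N) \<partial>(lborel \<Otimes>\<^sub>M lborel)) \<partial>M)"
    unfolding ov by (subst PN.Fubini') simp_all
  also have "\<dots> = (\<integral>\<^sup>+p. (\<integral>\<^sup>+x. (\<integral>\<^sup>+y. ball_weight s DIM('a) (fst p) * (ball_mem x p * ball_mem y p) \<partial>N) \<partial>M) \<partial>(lborel \<Otimes>\<^sub>M lborel))"
    by (rule PM.Fubini'[symmetric]) measurable
  also have "\<dots> = (\<integral>\<^sup>+p. ball_weight s DIM('a) (fst p) * ((\<integral>\<^sup>+x. ball_mem x p \<partial>M) * (\<integral>\<^sup>+y. ball_mem y p \<partial>N)) \<partial>(lborel \<Otimes>\<^sub>M lborel))"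
    by (simp add: nn_integral_cmult nn_integral_multc)
  finally show ?thesis by (simp add: nn_integral_ball_mem M(2) N(2))
qed

lemma ennreal_sum_squares:
  fixes m n :: real
  assumes "m \<ge> 0" "n \<ge> 0"
  shows "2 * (ennreal m * ennreal n) \<le> ennreal m * ennreal m + ennreal n * ennreal n"
    and "ennreal m * ennreal m + ennreal n * ennreal n \<le> 2 * (ennreal m * ennreal n) \<Longrightarrow> m = n"
proof -
  have eq: "2 * (ennreal m * ennreal n) = ennreal (2 * (m * n))"
    "ennreal m * ennreal m + ennreal n * ennreal n = ennreal (m * m + n * n)"
    using assms by (simp_all add: ennreal_mult' ennreal_plus)
  have sq: "m * m + n * n - 2 * (m * n) = (m - n)\<^sup>2" by (simp add: power2_eq_square algebra_simps)
  then have "2 * (m * n) \<le> m * m + n * n" using zero_le_power2[of "m - n"] by linarith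
  then show "2 * (ennreal m * ennreal n) \<le> ennreal m * ennreal m + ennreal n * ennreal n"
    unfolding eq by (rule ennreal_leI)
  assume "ennreal m * ennreal m + ennreal n * ennreal n \<le> 2 * (ennreal m * ennreal n)"
  then have "m * m + n * n \<le> 2 * (m * n)" unfolding eq using assms by (subst (asm) ennreal_le_iff) auto
  then have "(m - n)\<^sup>2 \<le> 0" using sq by linarith
  then show "m = n" by simp
qed

text \<open>Double counting of pairs \<open>(x, z)\<close> at distance below \<open>\<rho>\<close>:
  for fixed \<open>x\<close> the admissible \<open>z\<close> have volume \<open>v\<close>; for fixed
  \<open>z\<close> the admissible \<open>x\<close> have the mass of a ball, the same for both
  measures. The centres \<open>z\<close> close to \<open>C\<close> mediate between the two sides,
  which costs the enlargement by \<open>2 * \<rho>\<close>.\<close>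

lemma emeasure_closed_le_nbhd:
  fixes M N :: "'a::euclidean_space measure"
  assumes M: "finite_measure M" "sets M = sets borel" and N: "finite_measure N" "sets N = sets borel"
    and \<rho>: "\<rho> > 0" and C: "closed C" "C \<noteq> {}"
    and eq: "AE z in lborel. emeasure M {x. norm (x - z) < \<rho>} = emeasure N {x. norm (x - z) < \<rho>}"
  shows "emeasure M C \<le> emeasure N {x. infdist x C < 2 * \<rho>}"
proof -
  interpret M: finite_measure M by fact
  interpret N: finite_measure N by fact
  interpret PM: pair_sigma_finite M "lborel :: 'a measure" ..
  interpret PN: pair_sigma_finite N "lborel :: 'a measure" ..
  note [measurable_cong] = M(2) N(2)
  have [measurable]: "C \<in> sets borel" using C by auto
  define U where "U = {z. infdist z C < \<rho>}"
  have [measurable]: "U \<in> sets borel" unfolding U_def by (rule borel_Collect_infdist_less)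
  have [measurable]: "{x. infdist x C < 2 * \<rho>} \<in> sets borel" by (rule borel_Collect_infdist_less)
  define v where "v = ennreal (unit_ball_vol DIM('a) * \<rho> ^ DIM('a))"
  have v: "v \<noteq> 0" "v \<noteq> top"
    using \<rho> unit_ball_vol_pos[of "real DIM('a)"] by (auto simp: v_def simp del: unit_ball_vol_pos)
  have vol: "(\<integral>\<^sup>+z. ball_mem x (\<rho>, z) \<partial>lborel) = v" for x :: 'a
    unfolding v_def by (rule nn_integral_ball_mem_lborel[OF \<rho>])
  have tri: "infdist x C \<le> infdist z C + norm (x - z)" for x z
    using infdist_triangle[of x C z] by (simp add: dist_norm)
  have "v * emeasure M C = (\<integral>\<^sup>+x. v * indicator C x \<partial>M)"
    by (subst nn_integral_cmult_indicator) (simp_all add: M(2))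
  also have "\<dots> = (\<integral>\<^sup>+x. (\<integral>\<^sup>+z. ball_mem x (\<rho>, z) * indicator C x \<partial>lborel) \<partial>M)"
    by (simp add: nn_integral_multc vol)
  also have "\<dots> \<le> (\<integral>\<^sup>+x. (\<integral>\<^sup>+z. ball_mem x (\<rho>, z) * indicator U z \<partial>lborel) \<partial>M)"
  proof (intro nn_integral_mono)
    fix x z :: 'a
    show "ball_mem x (\<rho>, z) * indicator C x \<le> ball_mem x (\<rho>, z) * indicator U z"
      using tri[of z x] by (auto simp: ball_mem_def indicator_def U_def norm_minus_commute)
  qed
  also have "\<dots> = (\<integral>\<^sup>+z. (\<integral>\<^sup>+x. ball_mem x (\<rho>, z) * indicator U z \<partial>M) \<partial>lborel)"
    by (rule PM.Fubini'[symmetric]) measurable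
  also have "\<dots> = (\<integral>\<^sup>+z. (\<integral>\<^sup>+x. ball_mem x (\<rho>, z) * indicator U z \<partial>N) \<partial>lborel)"
    using eq by (intro nn_integral_cong_AE) (auto simp: nn_integral_multc nn_integral_ball_mem M(2) N(2))
  also have "\<dots> = (\<integral>\<^sup>+x. (\<integral>\<^sup>+z. ball_mem x (\<rho>, z) * indicator U z \<partial>lborel) \<partial>N)"
    by (rule PN.Fubini') measurable
  also have "\<dots> \<le> (\<integral>\<^sup>+x. (\<integral>\<^sup>+z. ball_mem x (\<rho>, z) * indicator {x. infdist x C < 2 * \<rho>} x \<partial>lborel) \<partial>N)"
  proof (intro nn_integral_mono)
    fix x z :: 'a
    show "ball_mem x (\<rho>, z) * indicator U z \<le> ball_mem x (\<rho>, z) * indicator {x. infdist x C < 2 * \<rho>} x"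
      using tri[of x z] by (auto simp: ball_mem_def indicator_def U_def)
  qed
  also have "\<dots> = (\<integral>\<^sup>+x. v * indicator {x. infdist x C < 2 * \<rho>} x \<partial>N)"
    by (simp add: nn_integral_multc vol)
  also have "\<dots> = v * emeasure N {x. infdist x C < 2 * \<rho>}"
    by (subst nn_integral_cmult_indicator) (simp_all add: N(2))
  finally show ?thesis using v by (simp add: ennreal_mult_le_mult_iff)
qed

text \<open>The radius in \<open>emeasure_closed_le_nbhd\<close> tends to 0, and the neighbourhoods
  decrease to the closed set.\<close>

lemma emeasure_closed_le_of_balls:
  fixes M N :: "'a::euclidean_space measure"
  assumes M: "finite_measure M" "sets M = sets borel" and N: "finite_measure N" "sets N = sets borel"
    and C: "closed C"
    and eq: "AE \<rho> in lborel. \<rho> > 0 \<longrightarrow> (AE z in lborel. emeasure M {x. norm (x - z) < \<rho>} = emeasure N {x. norm (x - z) < \<rho>})"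
  shows "emeasure M C \<le> emeasure N C"
proof (cases "C = {}")
  case False
  interpret N: finite_measure N by fact
  have le: "emeasure M C \<le> emeasure N {x. infdist x C < \<epsilon>}" if \<epsilon>: "\<epsilon> > 0" for \<epsilon>
  proof -
    have "\<exists>\<rho>. 0 < \<rho> \<and> \<rho> < \<epsilon> / 2 \<and> (AE z in lborel. emeasure M {x. norm (x - z) < \<rho>} = emeasure N {x. norm (x - z) < \<rho>})"
    proof (rule ccontr)
      assume *: "\<not> ?thesis"
      \<comment> \<open>The exceptional radii form a null set, so they cannot fill an
        interval.\<close>
      have "AE \<rho> in lborel. \<rho> \<notin> {0<..<\<epsilon>/2}"
        using eq by eventually_elim (use * in auto)
      then have "emeasure lborel {0<..<\<epsilon>/2} = 0"
        by (subst (asm) AE_iff_measurable[where N="{0<..<\<epsilon>/2}"]) auto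
      then show False using \<epsilon> by simp
    qed
    then obtain \<rho> where \<rho>: "0 < \<rho>" "\<rho> < \<epsilon> / 2"
      "AE z in lborel. emeasure M {x. norm (x - z) < \<rho>} = emeasure N {x. norm (x - z) < \<rho>}" by auto
    have "emeasure M C \<le> emeasure N {x. infdist x C < 2 * \<rho>}"
      by (rule emeasure_closed_le_nbhd[OF M N \<rho>(1) C False \<rho>(3)])
    also have "\<dots> \<le> emeasure N {x. infdist x C < \<epsilon>}"
      using \<rho> by (intro emeasure_mono) (auto simp: N(2) borel_Collect_infdist_less)
    finally show ?thesis .
  qed
  define A where "A = (\<lambda>k::nat. {x. infdist x C < 1 / (real k + 1)})"
  have A: "range A \<subseteq> sets N" by (auto simp: A_def N(2) borel_Collect_infdist_less)
  have "decseq A" unfolding A_def decseq_def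
  proof (intro allI impI subsetI CollectI)
    fix m n :: nat and x assume "m \<le> n" and "x \<in> {x. infdist x C < 1 / (real n + 1)}"
    then have "infdist x C < 1 / (real n + 1)" "1 / (real n + 1) \<le> 1 / (real m + 1)"
      by (auto simp: field_simps)
    then show "infdist x C < 1 / (real m + 1)" by linarith
  qed
  then have "(\<lambda>k. emeasure N (A k)) \<longlonglongrightarrow> emeasure N (\<Inter>k. A k)"
    using A by (intro Lim_emeasure_decseq) auto
  moreover have "(\<Inter>k. A k) = C"
  proof (intro equalityI subsetI)
    fix x assume x: "x \<in> (\<Inter>k. A k)"
    have "infdist x C = 0"
    proof (rule ccontr)
      assume "infdist x C \<noteq> 0"
      then have "infdist x C > 0" using infdist_nonneg[of x C] by linarith
      then obtain k where "inverse (real (Suc k)) < infdist x C" using reals_Archimedean by blast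
      moreover have "infdist x C < 1 / (real k + 1)" using x by (auto simp: A_def)
      ultimately show False by (simp add: inverse_eq_divide add.commute)
    qed
    then show "x \<in> C" using in_closed_iff_infdist_zero[OF C False] by simp
  next
    fix x assume "x \<in> C"
    then show "x \<in> (\<Inter>k. A k)" by (auto simp: A_def)
  qed
  ultimately have "(\<lambda>k. emeasure N (A k)) \<longlonglongrightarrow> emeasure N C" by simp
  then show ?thesis
    by (rule LIMSEQ_le_const) (auto simp: A_def intro!: exI[of _ 0] le)
qed simp

text \<open>
  Strict positive definiteness of the Riesz kernel, in a form without signed measures: the hypothesis
  says that \<open>M - N\<close> has energy zero.
\<close>

lemma riesz_energy_eq_imp_eq:
  fixes M N :: "'a::euclidean_space measure"
  assumes s: "s > 0"
    and M: "finite_measure M" "sets M = sets borel" and N: "finite_measure N" "sets N = sets borel"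
    and fin: "mutual_energy s M M < top" "mutual_energy s N N < top"
    and eq: "mutual_energy s M M + mutual_energy s N N = 2 * mutual_energy s M N"
  shows "M = N"
proof -
  interpret M: finite_measure M by fact
  interpret N: finite_measure N by fact
  note [measurable_cong] = M(2) N(2)
  obtain c where c: "c > 0" "c < top" "\<And>x y :: 'a. overlap s x y = c * riesz_kernel s x y"
    using overlap_eq_riesz_kernel[OF s] by blast
  define m where "m = (\<lambda>p. emeasure M {x. norm (x - snd p) < fst p})"
  define n where "n = (\<lambda>p. emeasure N {x. norm (x - snd p) < fst p})"
  define w where "w = (\<lambda>p::real \<times> 'a. ball_weight s DIM('a) (fst p))"
  define L where "L = (lborel \<Otimes>\<^sub>M lborel :: (real \<times> 'a) measure)"
  have sL[measurable_cong]: "sets L = sets (borel \<Otimes>\<^sub>M borel)" unfolding L_def by (rule sets_pair_measure_cong) simp_all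
  have [measurable]: "m \<in> borel_measurable L" "n \<in> borel_measurable L" "w \<in> borel_measurable L"
    unfolding m_def n_def w_def nn_integral_ball_mem[OF M(2), symmetric] nn_integral_ball_mem[OF N(2), symmetric] by measurable
  have E: "c * mutual_energy s K K' = (\<integral>\<^sup>+p. w p * (emeasure K {x. norm (x - snd p) < fst p} * emeasure K' {x. norm (x - snd p) < fst p}) \<partial>L)"
    if K: "finite_measure K" "sets K = sets borel" "finite_measure K'" "sets K' = sets borel" for K K' :: "'a measure"
  proof -
    interpret K: finite_measure K by fact
    interpret K': finite_measure K' by fact
    note [measurable_cong] = K(2,4)
    have "c * mutual_energy s K K' = (\<integral>\<^sup>+x. \<integral>\<^sup>+y. overlap s x y \<partial>K' \<partial>K)"
      unfolding c(3) mutual_energy_def by (simp add: nn_integral_cmult)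
    then show ?thesis unfolding w_def L_def using mutual_energy_overlap[OF K] by simp
  qed
  have EMM: "c * mutual_energy s M M = (\<integral>\<^sup>+p. w p * (m p * m p) \<partial>L)"
    and ENN: "c * mutual_energy s N N = (\<integral>\<^sup>+p. w p * (n p * n p) \<partial>L)"
    and EMN: "c * mutual_energy s M N = (\<integral>\<^sup>+p. w p * (m p * n p) \<partial>L)"
    unfolding m_def n_def by (rule E[OF M M] E[OF N N] E[OF M N])+
  define f where "f = (\<lambda>p. w p * (m p * m p + n p * n p))"
  define g where "g = (\<lambda>p. w p * (2 * (m p * n p)))"
  have [measurable]: "f \<in> borel_measurable L" "g \<in> borel_measurable L" unfolding f_def g_def by measurable
  have f: "(\<integral>\<^sup>+p. f p \<partial>L) = c * (mutual_energy s M M + mutual_energy s N N)"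
    unfolding f_def distrib_left EMM ENN by (rule nn_integral_add) measurable
  have "g = (\<lambda>p. 2 * (w p * (m p * n p)))" by (simp add: g_def fun_eq_iff mult.left_commute)
  then have "(\<integral>\<^sup>+p. g p \<partial>L) = 2 * (c * mutual_energy s M N)"
    unfolding EMN by (simp add: nn_integral_cmult)
  also have "\<dots> = (\<integral>\<^sup>+p. f p \<partial>L)" unfolding f eq by (simp add: mult.left_commute)
  finally have gf: "(\<integral>\<^sup>+p. g p \<partial>L) = (\<integral>\<^sup>+p. f p \<partial>L)" .
  have ffin: "(\<integral>\<^sup>+p. f p \<partial>L) \<noteq> top"
    unfolding f using c(2) fin by (simp add: ennreal_mult_eq_top_iff less_top)
  have mreal: "m p = ennreal (measure M {x. norm (x - snd p) < fst p})"
    and nreal: "n p = ennreal (measure N {x. norm (x - snd p) < fst p})" for p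
    by (simp_all add: m_def n_def M.emeasure_eq_measure N.emeasure_eq_measure)
  have le: "g p \<le> f p" for p
    unfolding f_def g_def mreal nreal by (intro mult_left_mono ennreal_sum_squares) auto
  \<comment> \<open>The two integrals are finite and equal while \<open>g p \<le> f p\<close>
    throughout, so \<open>f\<close> and \<open>g\<close> agree almost everywhere. This is the
    equality case of the inequality for squares.\<close>
  have "(\<integral>\<^sup>+p. f p - g p \<partial>L) = (\<integral>\<^sup>+p. f p \<partial>L) - (\<integral>\<^sup>+p. g p \<partial>L)"
    using gf ffin le by (intro nn_integral_diff) auto
  also have "\<dots> = 0" using gf ffin by (simp add: ennreal_diff_self)
  finally have "AE p in L. f p - g p = 0" by (subst (asm) nn_integral_0_iff_AE) auto
  then have "AE p in L. fst p > 0 \<longrightarrow> m p = n p"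
  proof (eventually_elim, intro impI)
    fix p :: "real \<times> 'a" assume fg: "f p - g p = 0" and p: "fst p > 0"
    have w: "w p \<noteq> 0" "w p \<noteq> top" using p by (auto simp: w_def ball_weight_def)
    have "f p \<le> g p" using fg by (simp add: ennreal_minus_eq_0)
    then have "m p * m p + n p * n p \<le> 2 * (m p * n p)"
      unfolding f_def g_def using w by (subst (asm) ennreal_mult_le_mult_iff) auto
    then show "m p = n p" unfolding mreal nreal
      by (auto dest!: ennreal_sum_squares(2)[rotated 2])
  qed
  then have AE: "AE \<rho> in lborel. AE z in lborel. \<rho> > 0 \<longrightarrow>
      emeasure M {x. norm (x - z) < \<rho>} = emeasure N {x. norm (x - z) < \<rho>}"
    unfolding L_def m_def n_def by (drule_tac lborel_pair.AE_pair) simp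
  have AE1: "AE \<rho> in lborel. \<rho> > 0 \<longrightarrow> (AE z in lborel. emeasure M {x. norm (x - z) < \<rho>} = emeasure N {x. norm (x - z) < \<rho>})"
    using AE by eventually_elim auto
  then have AE2: "AE \<rho> in lborel. \<rho> > 0 \<longrightarrow> (AE z in lborel. emeasure N {x. norm (x - z) < \<rho>} = emeasure M {x. norm (x - z) < \<rho>})"
    by (simp add: eq_commute)
  have closed_eq: "emeasure M C = emeasure N C" if "closed C" for C
    using emeasure_closed_le_of_balls[OF M N that AE1] emeasure_closed_le_of_balls[OF N M that AE2] by (rule antisym)
  show "M = N"
  proof (rule measure_eqI_generator_eq[where \<Omega>=UNIV and E="{C. closed C}" and A="\<lambda>_. UNIV"])
    show "Int_stable {C::'a set. closed C}" by (auto simp: Int_stable_def)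
  qed (auto simp: M(2) N(2) borel_eq_closed closed_eq)
qed

section \<open>The functions \<open>g\<close> and \<open>F\<close>\<close>

definition moment_weight :: "real \<Rightarrow> nat \<Rightarrow> real \<Rightarrow> real" where
  "moment_weight lam k v = v ^ k * (1 - v\<^sup>2) powr (lam - 1) * indicator {0<..<1} v"

text \<open>The Abel integral of \<open>\<phi> u * u ^ k\<close> over \<open>(0, \<rho>)\<close>
  after \<open>u = \<rho> * v\<close>, up to a power of \<open>\<rho>\<close>. Domain and singular
  weight no longer depend on \<open>\<rho>\<close>, so it can be differentiated under the integral
  sign.\<close>

definition moment :: "real \<Rightarrow> nat \<Rightarrow> (real \<Rightarrow> real) \<Rightarrow> real \<Rightarrow> real" where
  "moment lam k \<phi> \<rho> = (\<integral>v. \<phi> (\<rho> * v) * moment_weight lam k v \<partial>lborel)"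

lemma moment_weight_measurable [measurable]: "moment_weight lam k \<in> borel_measurable borel"
  unfolding moment_weight_def by measurable

lemma moment_weight_nonneg: "moment_weight lam k v \<ge> 0"
  by (simp add: moment_weight_def indicator_def)

lemma integrable_moment_weight:
  assumes "0 < lam"
  shows "integrable lborel (moment_weight lam k)"
proof (rule integrableI_nonneg)
  have "(\<integral>\<^sup>+v. ennreal (moment_weight lam k v) \<partial>lborel) =
      (\<integral>\<^sup>+r. ennreal (r ^ (Suc k - 1) * (1\<^sup>2 - r\<^sup>2) powr (lam - 1)) * indicator {0<..<1} r \<partial>lborel)"
    by (intro nn_integral_cong) (auto simp: moment_weight_def indicator_def)
  also have "\<dots> < \<infinity>" using nn_integral_radial_power[OF assms, of "Suc k" 1] by simp
  finally show "(\<integral>\<^sup>+v. ennreal (moment_weight lam k v) \<partial>lborel) < \<infinity>" .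
qed (auto simp: moment_weight_nonneg)

lemma moment_bound:
  assumes "\<And>x. x \<in> {0..R} \<Longrightarrow> \<bar>\<phi> x\<bar> \<le> B" "\<rho> \<in> {0..R}"
  shows "norm (\<phi> (\<rho> * v) * moment_weight lam k v) \<le> B * moment_weight lam k v"
proof (cases "v \<in> {0<..<1}")
  case True
  then have "\<rho> * v \<le> \<rho> * 1" using assms(2) by (intro mult_left_mono) auto
  then have "\<rho> * v \<in> {0..R}" using assms(2) True by auto
  then have "\<bar>\<phi> (\<rho> * v)\<bar> * moment_weight lam k v \<le> B * moment_weight lam k v"
    by (intro mult_right_mono assms(1) moment_weight_nonneg)
  then show ?thesis by (simp add: abs_mult moment_weight_nonneg)
qed (simp add: moment_weight_def)

lemma continuous_on_Icc_bounded:
  fixes \<phi> :: "real \<Rightarrow> real"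
  assumes "continuous_on {a..b} \<phi>"
  obtains B where "B \<ge> 0" "\<And>x. x \<in> {a..b} \<Longrightarrow> \<bar>\<phi> x\<bar> \<le> B"
proof -
  have "bounded (\<phi> ` {a..b})"
    by (intro compact_imp_bounded compact_continuous_image assms) simp
  then obtain B where "\<forall>x\<in>{a..b}. \<bar>\<phi> x\<bar> \<le> B" by (auto simp: bounded_iff)
  then show ?thesis using that[of "max B 0"] by (meson max.cobounded2 max.coboundedI1)
qed

lemma integrable_moment:
  assumes lam: "0 < lam" and \<phi>: "continuous_on UNIV \<phi>" and \<rho>: "\<rho> \<in> {0..R}"
  shows "integrable lborel (\<lambda>v. \<phi> (\<rho> * v) * moment_weight lam k v)"
proof -
  have [measurable]: "\<phi> \<in> borel_measurable borel" using \<phi> by (rule borel_measurable_continuous_onI)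
  obtain B where B: "\<And>x. x \<in> {0..R} \<Longrightarrow> \<bar>\<phi> x\<bar> \<le> B"
    using continuous_on_Icc_bounded[of 0 R \<phi>] continuous_on_subset[OF \<phi>] by blast
  have "integrable lborel (\<lambda>v. B * moment_weight lam k v)"
    using integrable_moment_weight[OF lam] by simp
  then show ?thesis
    by (rule Bochner_Integration.integrable_bound) (use moment_bound[OF B \<rho>] in \<open>auto intro!: AE_I2 order_trans[OF _ abs_ge_self]\<close>)
qed

lemma continuous_on_moment:
  assumes lam: "0 < lam" and \<phi>: "continuous_on UNIV \<phi>"
  shows "continuous_on {0..R} (moment lam k \<phi>)"
  unfolding continuous_on_sequentially
proof (intro allI ballI impI, elim conjE)
  fix X x assume x: "x \<in> {0..R}" and X: "\<forall>i. X i \<in> {0..R}" "X \<longlonglongrightarrow> x"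
  have [measurable]: "\<phi> \<in> borel_measurable borel" using \<phi> by (rule borel_measurable_continuous_onI)
  obtain B where B: "\<And>x. x \<in> {0..R} \<Longrightarrow> \<bar>\<phi> x\<bar> \<le> B"
    using continuous_on_Icc_bounded[of 0 R \<phi>] continuous_on_subset[OF \<phi>] by blast
  show "(moment lam k \<phi> \<circ> X) \<longlonglongrightarrow> moment lam k \<phi> x"
    unfolding moment_def o_def
  proof (rule integral_dominated_convergence[where w="\<lambda>v. B * moment_weight lam k v"])
    show "integrable lborel (\<lambda>v. B * moment_weight lam k v)"
      using integrable_moment_weight[OF lam] by simp
    show "AE v in lborel. (\<lambda>i. \<phi> (X i * v) * moment_weight lam k v) \<longlonglongrightarrow> \<phi> (x * v) * moment_weight lam k v"
      by (intro AE_I2 tendsto_mult tendsto_const continuous_on_tendsto_compose[OF \<phi>] tendsto_mult_right X) auto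
    show "AE v in lborel. norm (\<phi> (X i * v) * moment_weight lam k v) \<le> B * moment_weight lam k v" for i
      by (intro AE_I2 moment_bound[OF B]) (use X in auto)
  qed auto
qed

text \<open>The chain rule produces a factor \<open>v\<close>, which raises \<open>k\<close> by one.
  The difference quotients are dominated through a bound for \<open>\<phi>1\<close>, by the mean
  value inequality on \<open>{0..R}\<close>.\<close>

lemma moment_has_derivative:
  assumes lam: "0 < lam" and \<phi>: "continuous_on UNIV \<phi>" and \<phi>1: "continuous_on UNIV \<phi>1"
    and der: "\<And>r. r \<in> {0..R} \<Longrightarrow> (\<phi> has_real_derivative \<phi>1 r) (at r within {0..R})"
    and x: "x \<in> {0..R}"
  shows "(moment lam k \<phi> has_real_derivative moment lam (Suc k) \<phi>1 x) (at x within {0..R})"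
  unfolding has_field_derivative_iff tendsto_at_iff_sequentially
proof (intro allI impI)
  fix X assume X: "\<forall>i. X i \<in> {0..R} - {x}" "X \<longlonglongrightarrow> x"
  have [measurable]: "\<phi> \<in> borel_measurable borel" "\<phi>1 \<in> borel_measurable borel"
    using \<phi> \<phi>1 by (auto intro: borel_measurable_continuous_onI)
  obtain B where B: "B \<ge> 0" "\<And>x. x \<in> {0..R} \<Longrightarrow> \<bar>\<phi>1 x\<bar> \<le> B"
    using continuous_on_Icc_bounded[of 0 R \<phi>1] continuous_on_subset[OF \<phi>1] by blast
  let ?w = "moment_weight lam k"
  have mult: "r * v \<in> {0..R}" if "r \<in> {0..R}" "v \<in> {0<..<1}" for r v
    using that mult_left_mono[of v 1 r] by auto
  have eq: "(moment lam k \<phi> (X i) - moment lam k \<phi> x) / (X i - x) =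
      (\<integral>v. (\<phi> (X i * v) - \<phi> (x * v)) / (X i - x) * ?w v \<partial>lborel)" for i
  proof -
    have "moment lam k \<phi> (X i) - moment lam k \<phi> x = (\<integral>v. \<phi> (X i * v) * ?w v - \<phi> (x * v) * ?w v \<partial>lborel)"
      unfolding moment_def using X by (intro Bochner_Integration.integral_diff[symmetric] integrable_moment[OF lam \<phi>, of _ R] x) auto
    then show ?thesis
      by (simp flip: Bochner_Integration.integral_divide_zero) (simp add: left_diff_distrib diff_divide_distrib)
  qed
  have lim: "((\<lambda>i. (moment lam k \<phi> (X i) - moment lam k \<phi> x) / (X i - x)) \<longlonglongrightarrow> (\<integral>v. (v * \<phi>1 (x * v)) * ?w v \<partial>lborel))"
    unfolding eq
  proof (rule integral_dominated_convergence[where w="\<lambda>v. B * ?w v"])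
    show "integrable lborel (\<lambda>v. B * ?w v)" using integrable_moment_weight[OF lam] by simp
    show "AE v in lborel. (\<lambda>i. (\<phi> (X i * v) - \<phi> (x * v)) / (X i - x) * ?w v) \<longlonglongrightarrow> (v * \<phi>1 (x * v)) * ?w v"
    proof (intro AE_I2)
      fix v :: real
      show "(\<lambda>i. (\<phi> (X i * v) - \<phi> (x * v)) / (X i - x) * ?w v) \<longlonglongrightarrow> (v * \<phi>1 (x * v)) * ?w v"
      proof (cases "v \<in> {0<..<1}")
        case True
        have "((\<lambda>r. r * v) has_real_derivative v) (at x within {0..R})"
          by (auto intro!: derivative_eq_intros)
        moreover have "(\<phi> has_real_derivative \<phi>1 (x * v)) (at (x * v) within (\<lambda>r. r * v) ` {0..R})"
          by (rule DERIV_subset[OF der]) (use mult x True in auto)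
        ultimately have "((\<phi> \<circ> (\<lambda>r. r * v)) has_real_derivative \<phi>1 (x * v) * v) (at x within {0..R})"
          by (rule DERIV_image_chain[rotated])
        then have "(\<lambda>i. (\<phi> (X i * v) - \<phi> (x * v)) / (X i - x)) \<longlonglongrightarrow> \<phi>1 (x * v) * v"
          using X unfolding has_field_derivative_iff tendsto_at_iff_sequentially o_def by blast
        then show ?thesis by (intro tendsto_mult tendsto_const) (simp add: mult.commute)
      qed (simp add: moment_weight_def)
    qed
    show "AE v in lborel. norm ((\<phi> (X i * v) - \<phi> (x * v)) / (X i - x) * ?w v) \<le> B * ?w v" for i
    proof (intro AE_I2)
      fix v :: real
      show "norm ((\<phi> (X i * v) - \<phi> (x * v)) / (X i - x) * ?w v) \<le> B * ?w v"
      proof (cases "v \<in> {0<..<1}")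
        case True
        have Xi: "X i \<in> {0..R}" "X i \<noteq> x" using X by auto
        have "norm (\<phi> (X i * v) - \<phi> (x * v)) \<le> B * norm (X i * v - x * v)"
          by (rule field_differentiable_bound[of "{0..R}", OF _ der]) (use B mult Xi x True in auto)
        also have "\<dots> = B * (\<bar>X i - x\<bar> * \<bar>v\<bar>)" by (simp add: left_diff_distrib[symmetric] abs_mult)
        also have "\<dots> \<le> B * (\<bar>X i - x\<bar> * 1)" using True B(1) by (intro mult_left_mono) auto
        finally have "norm ((\<phi> (X i * v) - \<phi> (x * v)) / (X i - x)) \<le> B"
          using Xi by (simp add: divide_le_eq)
        then show ?thesis unfolding norm_mult by (intro mult_mono) (auto simp: moment_weight_nonneg B(1))
      qed (simp add: moment_weight_def)
    qed
  qed auto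
  have "(\<integral>v. (v * \<phi>1 (x * v)) * ?w v \<partial>lborel) = moment lam (Suc k) \<phi>1 x"
    unfolding moment_def by (intro Bochner_Integration.integral_cong) (auto simp: moment_weight_def)
  with lim show "((\<lambda>y. (moment lam k \<phi> y - moment lam k \<phi> x) / (y - x)) \<circ> X) \<longlonglongrightarrow> moment lam (Suc k) \<phi>1 x"
    by (simp add: o_def)
qed

text \<open>Bridge from the Bochner integral to the gauge integral in the formulas for
  \<open>g\<close> and \<open>F\<close>. The open interval keeps the singular endpoints out.\<close>

lemma integral_eq_lborel:
  fixes f :: "real \<Rightarrow> real"
  assumes "integrable lborel (\<lambda>x. indicator {a<..<b} x * f x)"
  shows "integral {a..b} f = (\<integral>x. indicator {a<..<b} x * f x \<partial>lborel)"
    and "f integrable_on {a..b}"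
proof -
  have "((\<lambda>x. indicator {a<..<b} x * f x) has_integral (\<integral>x. indicator {a<..<b} x * f x \<partial>lborel)) UNIV"
    by (rule has_integral_integral_lborel[OF assms])
  then have "(f has_integral (\<integral>x. indicator {a<..<b} x * f x \<partial>lborel)) {a<..<b}"
    by (subst has_integral_restrict_UNIV[symmetric]) (auto elim!: has_integral_eq[rotated] simp: indicator_def)
  then have "(f has_integral (\<integral>x. indicator {a<..<b} x * f x \<partial>lborel)) {a..b}"
    by (simp add: has_integral_Icc_iff_Ioo)
  then show "integral {a..b} f = (\<integral>x. indicator {a<..<b} x * f x \<partial>lborel)" "f integrable_on {a..b}"
    by (auto simp: has_integral_iff)
qed

lemma moment_eq_abel:
  assumes lam: "0 < lam" and \<phi>: "continuous_on UNIV \<phi>" and \<rho>: "\<rho> > 0"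
  shows "integrable lborel (\<lambda>u. indicator {0<..<\<rho>} u * (\<phi> u * u ^ k / (\<rho>\<^sup>2 - u\<^sup>2) powr (1 - lam)))"
    and "(\<integral>u. indicator {0<..<\<rho>} u * (\<phi> u * u ^ k / (\<rho>\<^sup>2 - u\<^sup>2) powr (1 - lam)) \<partial>lborel) =
      \<rho> powr (real k - 1 + 2 * lam) * moment lam k \<phi> \<rho>"
proof -
  define f where "f = (\<lambda>u. indicator {0<..<\<rho>} u * (\<phi> u * u ^ k / (\<rho>\<^sup>2 - u\<^sup>2) powr (1 - lam)))"
  have f: "\<rho> * f (0 + \<rho> * v) = \<rho> powr (real k - 1 + 2 * lam) * (\<phi> (\<rho> * v) * moment_weight lam k v)" for v
  proof (cases "v \<in> {0<..<1}")
    case True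
    then have v: "1 - v\<^sup>2 > 0" by (simp add: abs_square_less_1)
    have e1: "\<rho>\<^sup>2 - (\<rho> * v)\<^sup>2 = \<rho>\<^sup>2 * (1 - v\<^sup>2)" by (simp add: power_mult_distrib algebra_simps)
    have e2: "1 / (\<rho>\<^sup>2 * (1 - v\<^sup>2)) powr (1 - lam) = \<rho> powr (2 * lam - 2) * (1 - v\<^sup>2) powr (lam - 1)"
    proof -
      have "1 / (\<rho>\<^sup>2 * (1 - v\<^sup>2)) powr (1 - lam) = (\<rho>\<^sup>2 * (1 - v\<^sup>2)) powr (lam - 1)"
        using powr_minus_divide[of "\<rho>\<^sup>2 * (1 - v\<^sup>2)" "1 - lam"] by simp
      also have "\<dots> = (\<rho>\<^sup>2) powr (lam - 1) * (1 - v\<^sup>2) powr (lam - 1)"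
        using v by (intro powr_mult)
      also have "(\<rho>\<^sup>2) powr (lam - 1) = \<rho> powr (2 * lam - 2)"
        using \<rho> by (simp add: powr_powr flip: powr_numeral)
      finally show ?thesis .
    qed
    have "\<rho> * v < \<rho>" using True \<rho> by simp
    then have "f (0 + \<rho> * v) = \<phi> (\<rho> * v) * (\<rho> * v) ^ k * (1 / (\<rho>\<^sup>2 * (1 - v\<^sup>2)) powr (1 - lam))"
      using True \<rho> unfolding f_def e1[symmetric] by simp
    then have "\<rho> * f (0 + \<rho> * v) = (\<rho> powr 1 * \<rho> powr (real k) * \<rho> powr (2 * lam - 2)) * (\<phi> (\<rho> * v) * moment_weight lam k v)"
      unfolding e2 using True \<rho> by (simp add: moment_weight_def power_mult_distrib powr_realpow)
    also have "\<rho> powr 1 * \<rho> powr (real k) * \<rho> powr (2 * lam - 2) = \<rho> powr (real k - 1 + 2 * lam)"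
      by (simp only: powr_add[symmetric]) (simp add: algebra_simps)
    finally show ?thesis .
  next
    case False
    then have "\<not> (0 < \<rho> * v \<and> \<rho> * v < \<rho>)" using \<rho> by (auto simp: zero_less_mult_iff)
    then show ?thesis using False by (auto simp: f_def moment_weight_def)
  qed
  have "integrable lborel (\<lambda>v. \<rho> * f (0 + \<rho> * v))"
    unfolding f using integrable_moment[OF lam \<phi>, of \<rho> \<rho> k] \<rho> by simp
  then have "integrable lborel (\<lambda>v. f (0 + \<rho> * v))" using \<rho> by simp
  then have "integrable lborel f" using \<rho> by (subst (asm) lborel_integrable_real_affine_iff) auto
  then show "integrable lborel (\<lambda>u. indicator {0<..<\<rho>} u * (\<phi> u * u ^ k / (\<rho>\<^sup>2 - u\<^sup>2) powr (1 - lam)))"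
    unfolding f_def .
  have "(\<integral>u. f u \<partial>lborel) = \<rho> * (\<integral>v. f (0 + \<rho> * v) \<partial>lborel)"
    using \<rho> by (subst lborel_integral_real_affine[of \<rho> f 0]) auto
  also have "\<dots> = (\<integral>v. \<rho> * f (0 + \<rho> * v) \<partial>lborel)" by simp
  also have "\<dots> = \<rho> powr (real k - 1 + 2 * lam) * moment lam k \<phi> \<rho>"
    unfolding f moment_def by simp
  finally show "(\<integral>u. indicator {0<..<\<rho>} u * (\<phi> u * u ^ k / (\<rho>\<^sup>2 - u\<^sup>2) powr (1 - lam)) \<partial>lborel) =
      \<rho> powr (real k - 1 + 2 * lam) * moment lam k \<phi> \<rho>"
    unfolding f_def .
qed

lemma integrable_powr_from_0:
  assumes "a > -1" "c \<ge> 0"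
  shows "integrable lborel (\<lambda>v. indicator {0<..<c} v * v powr a :: real)"
proof (rule integrableI_nonneg)
  have "((\<lambda>v. v powr a) has_integral (c powr (a + 1) / (a + 1))) {0<..<c}"
    using has_integral_powr_from_0[OF assms] by (simp add: has_integral_Icc_iff_Ioo)
  then have "((\<lambda>v. indicator {0<..<c} v * v powr a) has_integral (c powr (a + 1) / (a + 1))) UNIV"
    by (subst (asm) has_integral_restrict_UNIV[symmetric]) (auto elim!: has_integral_eq[rotated] simp: indicator_def)
  then have "(\<integral>\<^sup>+v. ennreal (indicator {0<..<c} v * v powr a) \<partial>lborel) = ennreal (c powr (a + 1) / (a + 1))"
    by (intro nn_integral_has_integral_lborel) auto
  then show "(\<integral>\<^sup>+v. ennreal (indicator {0<..<c} v * v powr a) \<partial>lborel) < \<infinity>" by simp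
qed auto

text \<open>Writes a power with exponent \<open>lam\<close> as an integral of the singular kernel
  with exponent \<open>lam - 1\<close>, so that a later exchange of integrals can produce
  \<open>Nt\<close>.\<close>

lemma nn_integral_sq_diff_powr:
  fixes r \<tau> lam :: real
  assumes "0 < lam" "0 \<le> \<tau>" "\<tau> \<le> r"
  shows "(\<integral>\<^sup>+x. ennreal (indicator {\<tau><..<r} x * (2 * lam * x * (r\<^sup>2 - x\<^sup>2) powr (lam - 1))) \<partial>lborel) = ennreal ((r\<^sup>2 - \<tau>\<^sup>2) powr lam)"
proof -
  have pos: "r\<^sup>2 - x\<^sup>2 > 0" if "x \<in> {\<tau><..<r}" for x using that assms by (simp add: power_strict_mono)
  have "((\<lambda>x. 2 * lam * x * (r\<^sup>2 - x\<^sup>2) powr (lam - 1)) has_integral (- ((r\<^sup>2 - r\<^sup>2) powr lam) - - ((r\<^sup>2 - \<tau>\<^sup>2) powr lam))) {\<tau>..r}"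
  proof (rule fundamental_theorem_of_calculus_interior)
    have "r\<^sup>2 - x\<^sup>2 \<ge> 0" if "x \<in> {\<tau>..r}" for x using that assms by (simp add: power_mono)
    then show "continuous_on {\<tau>..r} (\<lambda>x. - ((r\<^sup>2 - x\<^sup>2) powr lam))"
      using assms by (intro continuous_intros continuous_on_powr') auto
    fix x assume "x \<in> {\<tau><..<r}"
    from pos[OF this] have "((\<lambda>x. - ((r\<^sup>2 - x\<^sup>2) powr lam)) has_real_derivative 2 * lam * x * (r\<^sup>2 - x\<^sup>2) powr (lam - 1)) (at x)"
      by (auto intro!: derivative_eq_intros)
    then show "((\<lambda>x. - ((r\<^sup>2 - x\<^sup>2) powr lam)) has_vector_derivative 2 * lam * x * (r\<^sup>2 - x\<^sup>2) powr (lam - 1)) (at x)"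
      by (simp add: has_real_derivative_iff_has_vector_derivative)
  qed (use assms in auto)
  then have "((\<lambda>x. 2 * lam * x * (r\<^sup>2 - x\<^sup>2) powr (lam - 1)) has_integral ((r\<^sup>2 - \<tau>\<^sup>2) powr lam)) {\<tau><..<r}"
    using assms by (simp add: has_integral_Icc_iff_Ioo)
  then have "((\<lambda>x. indicator {\<tau><..<r} x * (2 * lam * x * (r\<^sup>2 - x\<^sup>2) powr (lam - 1))) has_integral ((r\<^sup>2 - \<tau>\<^sup>2) powr lam)) UNIV"
    by (subst (asm) has_integral_restrict_UNIV[symmetric]) (auto elim!: has_integral_eq[rotated] simp: indicator_def)
  then show ?thesis
    using assms by (intro nn_integral_has_integral_lborel) (auto simp: indicator_def)
qed

text \<open>\<open>n\<close> is the dimension of the flat disk, one less than \<open>d\<close>. The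
  functions \<open>q\<close>, \<open>q1\<close>, \<open>q2\<close> stand for a profile and its
  derivatives, extended continuously to the line; differentiation takes place within
  \<open>{0..R}\<close>, one-sided at the endpoints.\<close>

locale radial_field =
  fixes n :: nat and lam R s :: real and q q1 q2 :: "real \<Rightarrow> real"
  assumes n2: "n \<ge> 2" and lam: "0 < lam" "lam < 1" and R: "0 < R" and s: "s = real n - 2 + 2 * lam"
    and contq: "continuous_on UNIV q" "continuous_on UNIV q1" "continuous_on UNIV q2"
    and derq: "\<And>r. r \<in> {0..R} \<Longrightarrow> (q has_real_derivative q1 r) (at r within {0..R})"
    and derq1: "\<And>r. r \<in> {0..R} \<Longrightarrow> (q1 has_real_derivative q2 r) (at r within {0..R})"
begin

text \<open>\<open>A0\<close>, \<open>A1\<close>, \<open>A2\<close> are the rescaled Abel transform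
  of the profile and its first two derivatives.\<close>

definition "A0 = moment lam (n - 1) q"
definition "A1 = moment lam n q1"
definition "A2 = moment lam (Suc n) q2"
text \<open>This is the function \<open>g\<close> of the theorem: \<open>r powr (1 - s)\<close>
  times the derivative of \<open>r powr s * A0 r\<close>. Its own derivative is
  \<open>gh'\<close>.\<close>

definition "gh r = s * A0 r + r * A1 r"
definition "gh' r = (s + 1) * A1 r + r * A2 r"

lemma s_pos: "s > 0" using n2 lam s by simp

lemma q_measurable [measurable]:
  "q \<in> borel_measurable borel" "q1 \<in> borel_measurable borel" "q2 \<in> borel_measurable borel"
  using contq by (auto intro: borel_measurable_continuous_onI)

lemma gh'_measurable [measurable]: "gh' \<in> borel_measurable borel"
  unfolding gh'_def A1_def A2_def moment_def by measurable

lemma A0_deriv: "x \<in> {0..R} \<Longrightarrow> (A0 has_real_derivative A1 x) (at x within {0..R})"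
  using moment_has_derivative[OF lam(1) contq(1,2) derq, of x "n - 1"] n2 by (simp add: A0_def A1_def)

lemma A1_deriv: "x \<in> {0..R} \<Longrightarrow> (A1 has_real_derivative A2 x) (at x within {0..R})"
  using moment_has_derivative[OF lam(1) contq(2,3) derq1, of x n] by (simp add: A1_def A2_def)

lemma gh_deriv: "x \<in> {0..R} \<Longrightarrow> (gh has_real_derivative gh' x) (at x within {0..R})"
  unfolding gh_def gh'_def
  by (auto intro!: derivative_eq_intros A0_deriv A1_deriv simp: algebra_simps)

lemma gh_cont: "continuous_on {0..R} gh"
  by (rule DERIV_continuous_on[OF gh_deriv])

lemma A0_cont: "continuous_on {0..R} A0"
  by (rule DERIV_continuous_on[OF A0_deriv])

lemma gh'_cont: "continuous_on {0..R} gh'"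
  unfolding gh'_def A1_def A2_def by (intro continuous_intros continuous_on_moment lam contq)

lemma gh'_bounded: obtains B where "B \<ge> 0" "\<And>x. x \<in> {0..R} \<Longrightarrow> \<bar>gh' x\<bar> \<le> B"
  using continuous_on_Icc_bounded[OF gh'_cont] by blast

lemma at_within_Ioo: "x \<in> {0<..<R} \<Longrightarrow> at x within {0..R} = at x"
  by (simp add: at_within_Icc_at)

lemma abel_q:
  assumes "\<rho> > 0"
  shows "integrable lborel (\<lambda>u. indicator {0<..<\<rho>} u * (q u * u ^ (n - 1) / (\<rho>\<^sup>2 - u\<^sup>2) powr (1 - lam)))"
    and "(\<integral>u. indicator {0<..<\<rho>} u * (q u * u ^ (n - 1) / (\<rho>\<^sup>2 - u\<^sup>2) powr (1 - lam)) \<partial>lborel) = \<rho> powr s * A0 \<rho>"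
proof -
  have "real (n - 1) - 1 + 2 * lam = s" using n2 s by (simp add: of_nat_diff)
  then show "(\<integral>u. indicator {0<..<\<rho>} u * (q u * u ^ (n - 1) / (\<rho>\<^sup>2 - u\<^sup>2) powr (1 - lam)) \<partial>lborel) = \<rho> powr s * A0 \<rho>"
    using moment_eq_abel(2)[OF lam(1) contq(1) assms, of "n - 1"] by (simp add: A0_def)
qed (rule moment_eq_abel(1)[OF lam(1) contq(1) assms])

text \<open>Here \<open>q'\<close> is the given profile, which agrees with the extended
  \<open>q\<close> on \<open>{0..R}\<close>; at an interior point the two-sided derivative sees only
  this interval.\<close>

lemma dens_g_eq:
  assumes q': "\<And>r. r \<in> {0..R} \<Longrightarrow> q' r = q r" and r: "r \<in> {0<..<R}"
  shows "dens_g (Suc n) lam q' r = gh r"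
proof -
  define H where "H = (\<lambda>\<rho>. integral {0..\<rho>} (\<lambda>u. q' u * u ^ (Suc n - 2) / (\<rho>\<^sup>2 - u\<^sup>2) powr (1 - lam)))"
  have H: "H \<rho> = \<rho> powr s * A0 \<rho>" if \<rho>: "\<rho> \<in> {0<..<R}" for \<rho>
  proof -
    have "H \<rho> = integral {0..\<rho>} (\<lambda>u. q u * u ^ (n - 1) / (\<rho>\<^sup>2 - u\<^sup>2) powr (1 - lam))"
      unfolding H_def using \<rho> q' by (intro integral_cong) auto
    also have "\<dots> = \<rho> powr s * A0 \<rho>"
      using integral_eq_lborel(1)[OF abel_q(1)] abel_q(2) \<rho> by simp
    finally show ?thesis .
  qed
  have "((\<lambda>\<rho>. \<rho> powr s * A0 \<rho>) has_real_derivative r powr (s - 1) * gh r) (at r)"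
  proof -
    have "(A0 has_real_derivative A1 r) (at r)" using A0_deriv[of r] r by (simp add: at_within_Ioo)
    moreover have "r powr s = r powr (s - 1) * r" using r by (simp add: powr_diff)
    ultimately show ?thesis using r by (auto intro!: derivative_eq_intros simp: gh_def algebra_simps)
  qed
  then have "(H has_real_derivative r powr (s - 1) * gh r) (at r)"
    by (rule has_field_derivative_transform_within_open[where S="{0<..<R}"]) (use r H in auto)
  then have "deriv H r = r powr (s - 1) * gh r" by (rule DERIV_imp_deriv)
  moreover have "real (Suc n) + 2 * lam - 4 = s - 1" using s by simp
  ultimately show ?thesis using r by (simp add: dens_g_def H_def)
qed

text \<open>Density at radius \<open>x\<close> of the mixture of ball densities with weight
  \<open>gh'\<close> on \<open>(0, R)\<close>: only balls of radius \<open>r > x\<close> reach that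
  far.\<close>

definition "Nt x = (\<integral>r. indicator {x<..<R} r * (gh' r * (r\<^sup>2 - x\<^sup>2) powr (lam - 1)) \<partial>lborel)"

lemma Nt_eq_translate: "Nt x = (\<integral>v. indicator {0<..<R - x} v * (gh' (x + v) * (v * (2 * x + v)) powr (lam - 1)) \<partial>lborel)"
proof -
  have "Nt x = (\<integral>v. indicator {x<..<R} (x + v) * (gh' (x + v) * ((x + v)\<^sup>2 - x\<^sup>2) powr (lam - 1)) \<partial>lborel)"
    unfolding Nt_def by (subst lborel_integral_real_affine[of 1 _ x]) auto
  moreover have "(x + v)\<^sup>2 - x\<^sup>2 = v * (2 * x + v)" for v by (simp add: power2_eq_square algebra_simps)
  moreover have "indicator {x<..<R} (x + v) = (indicator {0<..<R - x} v :: real)" for v by (auto simp: indicator_def)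
  ultimately show ?thesis by simp
qed

text \<open>After the translation the singularity sits at \<open>v = 0\<close> for every
  \<open>x\<close>, and \<open>2 * x + v \<ge> a\<close> yields an integrable dominating function.
  Staying away from 0 keeps this bound uniform.\<close>

lemma Nt_cont:
  assumes a: "0 < a"
  shows "continuous_on {a..R} Nt"
  unfolding continuous_on_sequentially
proof (intro allI ballI impI, elim conjE)
  fix X x assume x: "x \<in> {a..R}" and X: "\<forall>i. X i \<in> {a..R}" "X \<longlonglongrightarrow> x"
  obtain B where B: "B \<ge> 0" "\<And>x. x \<in> {0..R} \<Longrightarrow> \<bar>gh' x\<bar> \<le> B" by (rule gh'_bounded) blast
  define f where "f = (\<lambda>x v. indicator {0<..<R - x} v * (gh' (x + v) * (v * (2 * x + v)) powr (lam - 1)))"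
  have [measurable]: "f x \<in> borel_measurable lborel" for x unfolding f_def by measurable
  have Nt: "Nt y = (\<integral>v. f y v \<partial>lborel)" for y
    unfolding f_def by (rule Nt_eq_translate)
  show "(Nt \<circ> X) \<longlonglongrightarrow> Nt x"
    unfolding Nt o_def
  proof (rule integral_dominated_convergence[where w="\<lambda>v. B * a powr (lam - 1) * (indicator {0<..<R} v * v powr (lam - 1))"])
    show "integrable lborel (\<lambda>v. B * a powr (lam - 1) * (indicator {0<..<R} v * v powr (lam - 1)))"
      using integrable_powr_from_0[of "lam - 1" R] lam R by simp
    show "AE v in lborel. (\<lambda>i. f (X i) v) \<longlonglongrightarrow> f x v"
    \<comment> \<open>The moving upper limit \<open>R - X i\<close> can spoil convergence of the
      integrands only at the single point \<open>v = R - x\<close>.\<close>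
    proof (rule AE_mp[OF AE_lborel_singleton[of "R - x"]], intro AE_I2 impI)
      fix v :: real assume v: "v \<noteq> R - x"
      have lim: "(\<lambda>i. R - X i) \<longlonglongrightarrow> R - x" by (intro tendsto_intros X)
      consider "v \<le> 0" | "0 < v" "v < R - x" | "v > R - x" "0 < v" using v by linarith
      then show "(\<lambda>i. f (X i) v) \<longlonglongrightarrow> f x v"
      proof cases
        case 1
        then show ?thesis by (simp add: f_def)
      next
        case 2
        from order_tendstoD(1)[OF lim 2(2)] have ev: "eventually (\<lambda>i. v < R - X i) sequentially" .
        have "(\<lambda>i. gh' (X i + v)) \<longlonglongrightarrow> gh' (x + v)"
        proof (rule continuous_on_tendsto_compose[OF gh'_cont])
          show "(\<lambda>i. X i + v) \<longlonglongrightarrow> x + v" by (intro tendsto_intros X)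
          show "\<forall>\<^sub>F i in sequentially. X i + v \<in> {0..R}"
            using ev
          proof eventually_elim
            case (elim i)
            have "X i \<in> {a..R}" using X by auto
            then show ?case using elim a 2 by auto
          qed
        qed (use x a 2 in auto)
        moreover have "(\<lambda>i. (v * (2 * X i + v)) powr (lam - 1)) \<longlonglongrightarrow> (v * (2 * x + v)) powr (lam - 1)"
          using 2 x a by (intro tendsto_intros X) auto
        ultimately have "(\<lambda>i. gh' (X i + v) * (v * (2 * X i + v)) powr (lam - 1)) \<longlonglongrightarrow> gh' (x + v) * (v * (2 * x + v)) powr (lam - 1)"
          by (rule tendsto_mult)
        moreover have "\<forall>\<^sub>F i in sequentially. gh' (X i + v) * (v * (2 * X i + v)) powr (lam - 1) = f (X i) v"
          using ev by eventually_elim (use 2 in \<open>simp add: f_def\<close>)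
        ultimately have "(\<lambda>i. f (X i) v) \<longlonglongrightarrow> gh' (x + v) * (v * (2 * x + v)) powr (lam - 1)"
          by (rule Lim_transform_eventually)
        then show ?thesis using 2 by (simp add: f_def)
      next
        case 3
        from order_tendstoD(2)[OF lim 3(1)] have "\<forall>\<^sub>F i in sequentially. 0 = f (X i) v"
          by eventually_elim (simp add: f_def)
        then have "(\<lambda>i. f (X i) v) \<longlonglongrightarrow> 0" by (rule Lim_transform_eventually[OF tendsto_const])
        then show ?thesis using 3 by (simp add: f_def)
      qed
    qed
    show "AE v in lborel. norm (f (X i) v) \<le> B * a powr (lam - 1) * (indicator {0<..<R} v * v powr (lam - 1))" for i
    proof (intro AE_I2)
      fix v :: real
      have Xi: "X i \<in> {a..R}" using X by auto
      show "norm (f (X i) v) \<le> B * a powr (lam - 1) * (indicator {0<..<R} v * v powr (lam - 1))"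
      proof (cases "v \<in> {0<..<R - X i}")
        case True
        have "a * v \<le> (2 * X i + v) * v" using Xi True a by (intro mult_right_mono) auto
        then have "(v * (2 * X i + v)) powr (lam - 1) \<le> (a * v) powr (lam - 1)"
          using True a lam by (intro powr_mono2') (auto simp: mult.commute)
        moreover have "\<bar>gh' (X i + v)\<bar> \<le> B" using Xi True a by (intro B) auto
        ultimately have "\<bar>gh' (X i + v)\<bar> * (v * (2 * X i + v)) powr (lam - 1) \<le> B * (a * v) powr (lam - 1)"
          using B(1) by (intro mult_mono) auto
        moreover have "v < R" using True Xi a by auto
        ultimately show ?thesis using True a by (simp add: f_def abs_mult powr_mult mult_ac)
      next
        case False
        then show ?thesis using B(1) by (auto simp: f_def indicator_def)
      qed
    qed
  qed auto
qed

text \<open>Exchange of integrals over the triangle \<open>\<tau> < x < r < R\<close>, after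
  \<open>nn_integral_sq_diff_powr\<close> has replaced the power by an integral over
  \<open>x\<close>.\<close>

lemma integral_gh'_powr:
  assumes \<tau>: "\<tau> \<in> {0<..<R}"
  shows "integral {\<tau>..R} (\<lambda>r. gh' r * (r\<^sup>2 - \<tau>\<^sup>2) powr lam) = 2 * lam * integral {\<tau>..R} (\<lambda>x. x * Nt x)"
proof -
  obtain B where B: "B \<ge> 0" "\<And>x. x \<in> {0..R} \<Longrightarrow> \<bar>gh' x\<bar> \<le> B" by (rule gh'_bounded) blast
  define k where "k = (\<lambda>x r. indicator {\<tau><..<r} x * (2 * lam * x * (r\<^sup>2 - x\<^sup>2) powr (lam - 1)))"
  define F where "F = (\<lambda>x r. indicator {\<tau><..<R} r * gh' r * k x r)"
  have k_nonneg: "k x r \<ge> 0" for x r using lam \<tau> by (auto simp: k_def indicator_def)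
  have k_nn: "(\<integral>\<^sup>+x. ennreal (k x r) \<partial>lborel) = ennreal ((r\<^sup>2 - \<tau>\<^sup>2) powr lam)" if "\<tau> < r" for r
    unfolding k_def using lam \<tau> that by (intro nn_integral_sq_diff_powr) auto
  have k_meas [measurable]: "case_prod k \<in> borel_measurable (borel \<Otimes>\<^sub>M borel)"
  proof -
    have "k = (\<lambda>x r. (if \<tau> < x \<and> x < r then 1 else 0) * (2 * lam * x * (r\<^sup>2 - x\<^sup>2) powr (lam - 1)))"
      by (simp add: k_def fun_eq_iff indicator_def)
    then show ?thesis by simp
  qed
  have k_int: "integrable lborel (\<lambda>x. k x r)" "(\<integral>x. k x r \<partial>lborel) = (r\<^sup>2 - \<tau>\<^sup>2) powr lam" if "\<tau> < r" for r
  proof -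
    have "has_bochner_integral lborel (\<lambda>x. k x r) ((r\<^sup>2 - \<tau>\<^sup>2) powr lam)"
      using k_nn[OF that] k_nonneg by (intro has_bochner_integral_nn_integral) auto
    then show "integrable lborel (\<lambda>x. k x r)" "(\<integral>x. k x r \<partial>lborel) = (r\<^sup>2 - \<tau>\<^sup>2) powr lam"
      by (auto simp: has_bochner_integral_iff)
  qed
  have F_int: "integrable (lborel \<Otimes>\<^sub>M lborel) (case_prod F)"
  proof (rule integrableI_bounded)
    show "case_prod F \<in> borel_measurable (lborel \<Otimes>\<^sub>M lborel)" unfolding F_def by measurable
    have "(\<integral>\<^sup>+p. ennreal (norm (case_prod F p)) \<partial>(lborel \<Otimes>\<^sub>M lborel)) = (\<integral>\<^sup>+r. \<integral>\<^sup>+x. ennreal (norm (F x r)) \<partial>lborel \<partial>lborel)"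
      by (subst lborel_pair.nn_integral_snd[symmetric]) (auto simp: F_def)
    also have "\<dots> \<le> (\<integral>\<^sup>+r. ennreal (B * (R\<^sup>2) powr lam) * indicator {\<tau>..R} r \<partial>(lborel::real measure))"
    proof (rule nn_integral_mono)
      fix r :: real
      show "(\<integral>\<^sup>+x. ennreal (norm (F x r)) \<partial>lborel) \<le> ennreal (B * (R\<^sup>2) powr lam) * indicator {\<tau>..R} r"
      proof (cases "r \<in> {\<tau><..<R}")
        case True
        have "(\<integral>\<^sup>+x. ennreal (norm (F x r)) \<partial>lborel) = (\<integral>\<^sup>+x. ennreal \<bar>gh' r\<bar> * ennreal (k x r) \<partial>lborel)"
          using True k_nonneg by (intro nn_integral_cong) (auto simp: F_def abs_mult ennreal_mult')
        also have "\<dots> = ennreal (\<bar>gh' r\<bar> * (r\<^sup>2 - \<tau>\<^sup>2) powr lam)"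
          using True by (subst nn_integral_cmult) (auto simp: k_nn ennreal_mult')
        also have "\<dots> \<le> ennreal (B * (R\<^sup>2) powr lam)"
        proof (intro ennreal_leI mult_mono B powr_mono2)
          have "r\<^sup>2 \<le> R\<^sup>2" using True \<tau> by (intro power_mono) auto
          moreover have "\<tau>\<^sup>2 \<ge> 0" by simp
          ultimately show "r\<^sup>2 - \<tau>\<^sup>2 \<le> R\<^sup>2" by linarith
          show "0 \<le> r\<^sup>2 - \<tau>\<^sup>2" using True \<tau> by (simp add: power_mono)
        qed (use True \<tau> lam B in auto)
        finally show ?thesis using True by simp
      qed (simp add: F_def)
    qed
    also have "\<dots> < \<infinity>" by (simp add: nn_integral_cmult_indicator ennreal_mult_less_top emeasure_lborel_Icc_eq)
    finally show "(\<integral>\<^sup>+p. ennreal (norm (case_prod F p)) \<partial>(lborel \<Otimes>\<^sub>M lborel)) < \<infinity>" .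
  qed
  have inner1: "(\<integral>x. F x r \<partial>lborel) = indicator {\<tau><..<R} r * (gh' r * (r\<^sup>2 - \<tau>\<^sup>2) powr lam)" for r
    using k_int(2)[of r] by (cases "r \<in> {\<tau><..<R}") (auto simp: F_def)
  have inner2: "(\<integral>r. F x r \<partial>lborel) = indicator {\<tau><..<R} x * (2 * lam * (x * Nt x))" for x
  proof (cases "x \<in> {\<tau><..<R}")
    case True
    have "(\<integral>r. F x r \<partial>lborel) = (\<integral>r. 2 * lam * x * (indicator {x<..<R} r * (gh' r * (r\<^sup>2 - x\<^sup>2) powr (lam - 1))) \<partial>lborel)"
      using True by (intro Bochner_Integration.integral_cong) (auto simp: F_def k_def indicator_def)
    then show ?thesis using True by (simp add: Nt_def)
  next
    case False
    then have "F x r = 0" for r by (auto simp: F_def k_def indicator_def)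
    then show ?thesis using False by simp
  qed
  have "integrable lborel (\<lambda>r. \<integral>x. F x r \<partial>lborel)" using lborel_pair.integrable_snd[OF F_int] by simp
  then have "integral {\<tau>..R} (\<lambda>r. gh' r * (r\<^sup>2 - \<tau>\<^sup>2) powr lam) = (\<integral>r. \<integral>x. F x r \<partial>lborel \<partial>lborel)"
    unfolding inner1 by (rule integral_eq_lborel(1))
  also have "\<dots> = (\<integral>x. \<integral>r. F x r \<partial>lborel \<partial>lborel)"
    by (rule lborel_pair.Fubini_integral[OF F_int])
  also have "\<dots> = integral {\<tau>..R} (\<lambda>x. 2 * lam * (x * Nt x))"
  proof -
    have "integrable lborel (\<lambda>x. \<integral>r. F x r \<partial>lborel)" using lborel_pair.integrable_fst[OF F_int] by simp
    then show ?thesis unfolding inner2 by (rule integral_eq_lborel(1)[symmetric])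
  qed
  finally show ?thesis by simp
qed

text \<open>Differentiating the integral in \<open>F\<close> directly would produce the exponent
  \<open>lam - 2\<close>, which is not integrable. Integration by parts first moves a derivative
  onto \<open>gh\<close>; there remain a boundary term at \<open>R\<close> and an integral of
  \<open>x * Nt x\<close>, both differentiable in the lower limit.\<close>

lemma dens_F_eq:
  assumes q': "\<And>r. r \<in> {0..R} \<Longrightarrow> q' r = q r" and t: "t \<in> {0<..<R}"
  shows "dens_F (Suc n) lam R q' t = sin (lam * pi) * Gamma (s / 2) / (pi powr (real n / 2 + 1) * Gamma lam) *
    (Nt t - gh R * (R\<^sup>2 - t\<^sup>2) powr (lam - 1))"
proof -
  define H where "H = (\<lambda>\<tau>. integral {\<tau>..R} (\<lambda>r. dens_g (Suc n) lam q' r * r / (r\<^sup>2 - \<tau>\<^sup>2) powr (1 - lam)))"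
  \<comment> \<open>A base point strictly between 0 and \<open>t\<close>, because
    \<open>Nt_cont\<close> gives continuity only away from 0.\<close>
  define a where "a = t / 2"
  have a: "0 < a" "a < t" "a < R" using t by (auto simp: a_def)
  define J where "J = (\<lambda>\<tau>. integral {a..\<tau>} (\<lambda>x. x * Nt x))"
  have xN: "continuous_on {a..R} (\<lambda>x. x * Nt x)" by (intro continuous_intros Nt_cont a)
  have H: "H \<tau> = gh R * (R\<^sup>2 - \<tau>\<^sup>2) powr lam / (2 * lam) - (J R - J \<tau>)" if \<tau>: "\<tau> \<in> {a<..<R}" for \<tau>
  proof -
    have \<tau>0: "\<tau> \<in> {0<..<R}" using \<tau> a by auto
    have pos: "r\<^sup>2 - \<tau>\<^sup>2 > 0" if "r \<in> {\<tau><..<R}" for r using that \<tau>0 by (simp add: power_strict_mono)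
    have pos0: "r\<^sup>2 - \<tau>\<^sup>2 \<ge> 0" if "r \<in> {\<tau>..R}" for r using that \<tau>0 by (simp add: power_mono)
    have sub: "{\<tau>..R} \<subseteq> {0..R}" using \<tau>0 by auto
    have cp: "continuous_on {\<tau>..R} (\<lambda>r. (r\<^sup>2 - \<tau>\<^sup>2) powr lam)"
      using pos0 lam by (intro continuous_on_powr' continuous_intros) auto
    define u where "u = (\<lambda>r. gh' r * (r\<^sup>2 - \<tau>\<^sup>2) powr lam / (2 * lam))"
    have int1: "((\<lambda>r. u r + gh r * r * (r\<^sup>2 - \<tau>\<^sup>2) powr (lam - 1)) has_integral
        (gh R * (R\<^sup>2 - \<tau>\<^sup>2) powr lam / (2 * lam) - gh \<tau> * (\<tau>\<^sup>2 - \<tau>\<^sup>2) powr lam / (2 * lam))) {\<tau>..R}"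
    proof (rule fundamental_theorem_of_calculus_interior)
      show "continuous_on {\<tau>..R} (\<lambda>r. gh r * (r\<^sup>2 - \<tau>\<^sup>2) powr lam / (2 * lam))"
        using lam by (intro continuous_intros cp continuous_on_subset[OF gh_cont sub]) auto
      fix r assume r: "r \<in> {\<tau><..<R}"
      have "(gh has_real_derivative gh' r) (at r)"
        using gh_deriv[of r] at_within_Ioo[of r] r \<tau>0 by auto
      then have "((\<lambda>r. gh r * (r\<^sup>2 - \<tau>\<^sup>2) powr lam / (2 * lam)) has_real_derivative u r + gh r * r * (r\<^sup>2 - \<tau>\<^sup>2) powr (lam - 1)) (at r)"
        using pos[OF r] lam unfolding u_def
        by (auto intro!: derivative_eq_intros simp: field_simps)
      then show "((\<lambda>r. gh r * (r\<^sup>2 - \<tau>\<^sup>2) powr lam / (2 * lam)) has_vector_derivative u r + gh r * r * (r\<^sup>2 - \<tau>\<^sup>2) powr (lam - 1)) (at r)"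
        by (simp add: has_real_derivative_iff_has_vector_derivative)
    qed (use \<tau> in auto)
    have "continuous_on {\<tau>..R} u" unfolding u_def
      using lam by (intro continuous_intros cp continuous_on_subset[OF gh'_cont sub]) auto
    then have int2: "(u has_integral integral {\<tau>..R} u) {\<tau>..R}"
      by (intro integrable_integral integrable_continuous_real)
    have "((\<lambda>r. gh r * r * (r\<^sup>2 - \<tau>\<^sup>2) powr (lam - 1)) has_integral
        (gh R * (R\<^sup>2 - \<tau>\<^sup>2) powr lam / (2 * lam) - integral {\<tau>..R} u)) {\<tau>..R}"
      using has_integral_diff[OF int1 int2] by simp
    then have "((\<lambda>r. gh r * r * (r\<^sup>2 - \<tau>\<^sup>2) powr (lam - 1)) has_integral
        (gh R * (R\<^sup>2 - \<tau>\<^sup>2) powr lam / (2 * lam) - integral {\<tau>..R} u)) {\<tau><..<R}"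
      by (simp add: has_integral_Icc_iff_Ioo)
    then have "((\<lambda>r. dens_g (Suc n) lam q' r * r / (r\<^sup>2 - \<tau>\<^sup>2) powr (1 - lam)) has_integral
        (gh R * (R\<^sup>2 - \<tau>\<^sup>2) powr lam / (2 * lam) - integral {\<tau>..R} u)) {\<tau><..<R}"
    proof (rule has_integral_eq[rotated])
      fix r assume r: "r \<in> {\<tau><..<R}"
      have "dens_g (Suc n) lam q' r = gh r" using r \<tau>0 q' by (intro dens_g_eq) auto
      moreover have "(r\<^sup>2 - \<tau>\<^sup>2) powr (lam - 1) = 1 / (r\<^sup>2 - \<tau>\<^sup>2) powr (1 - lam)"
        using powr_minus_divide[of "r\<^sup>2 - \<tau>\<^sup>2" "1 - lam"] by simp
      ultimately show "gh r * r * (r\<^sup>2 - \<tau>\<^sup>2) powr (lam - 1) = dens_g (Suc n) lam q' r * r / (r\<^sup>2 - \<tau>\<^sup>2) powr (1 - lam)" by simp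
    qed
    then have "H \<tau> = gh R * (R\<^sup>2 - \<tau>\<^sup>2) powr lam / (2 * lam) - integral {\<tau>..R} u"
      unfolding H_def by (intro integral_unique) (simp add: has_integral_Icc_iff_Ioo)
    also have "integral {\<tau>..R} u = integral {\<tau>..R} (\<lambda>x. x * Nt x)"
      unfolding u_def using integral_gh'_powr[OF \<tau>0] lam by simp
    also have "\<dots> = J R - J \<tau>"
      unfolding J_def using \<tau> Henstock_Kurzweil_Integration.integral_combine[of a \<tau> R "\<lambda>x. x * Nt x"]
        integrable_continuous_real[OF xN] by simp
    finally show ?thesis .
  qed
  have "(J has_real_derivative t * Nt t) (at t within {a..R})"
    unfolding J_def using a t by (intro integral_has_real_derivative xN) auto
  then have J: "(J has_real_derivative t * Nt t) (at t)" using a t by (simp add: at_within_Icc_at)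
  have "R\<^sup>2 - t\<^sup>2 > 0" using t by (simp add: power_strict_mono)
  then have "((\<lambda>\<tau>. gh R * (R\<^sup>2 - \<tau>\<^sup>2) powr lam / (2 * lam) - (J R - J \<tau>)) has_real_derivative
      t * (Nt t - gh R * (R\<^sup>2 - t\<^sup>2) powr (lam - 1))) (at t)"
    using lam by (auto intro!: derivative_eq_intros J simp: algebra_simps)
  then have "(H has_real_derivative t * (Nt t - gh R * (R\<^sup>2 - t\<^sup>2) powr (lam - 1))) (at t)"
    by (rule has_field_derivative_transform_within_open[where S="{a<..<R}"]) (use t a H in auto)
  then have "deriv H t = t * (Nt t - gh R * (R\<^sup>2 - t\<^sup>2) powr (lam - 1))" by (rule DERIV_imp_deriv)
  moreover have e: "(real (Suc n) - 3) / 2 + lam = s / 2" "(real (Suc n) + 1) / 2 = real n / 2 + 1" using s by (auto simp: field_simps)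
  ultimately show ?thesis using t unfolding dens_F_def e H_def[symmetric] by simp
qed

text \<open>The identity that matches the weight to the energy kernel. On \<open>{0..\<rho>}\<close>
  an antiderivative is \<open>r powr s * (gh r - s * A0 r)\<close>, because
  \<open>r powr s * A0 r\<close> has derivative \<open>r powr (s - 1) * gh r\<close>; on
  \<open>{\<rho>..R}\<close> the kernel is constant. The term with \<open>A0\<close> is, up to the
  sphere area, the integral of the profile against the ball density of radius
  \<open>\<rho>\<close>.\<close>

lemma integral_gh'_min:
  assumes \<rho>: "\<rho> \<in> {0<..R}"
  shows "integral {0..R} (\<lambda>r. gh' r * (min r \<rho>) powr s) = gh R * \<rho> powr s - s * (\<rho> powr s * A0 \<rho>)"
proof -
  have c0: "continuous_on {0..R} (\<lambda>r. r powr s)"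
    using s_pos by (intro continuous_on_powr' continuous_intros) auto
  have "((\<lambda>r. gh' r * r powr s) has_integral (\<rho> powr s * (gh \<rho> - s * A0 \<rho>) - 0 powr s * (gh 0 - s * A0 0))) {0..\<rho>}"
  proof (rule fundamental_theorem_of_calculus_interior)
    have "continuous_on {0..R} (\<lambda>r. r powr s * (gh r - s * A0 r))"
      by (intro continuous_intros c0 gh_cont A0_cont)
    then show "continuous_on {0..\<rho>} (\<lambda>r. r powr s * (gh r - s * A0 r))"
      by (rule continuous_on_subset) (use \<rho> in auto)
    fix r assume r: "r \<in> {0<..<\<rho>}"
    then have r': "r \<in> {0<..<R}" using \<rho> by auto
    have d: "(gh has_real_derivative gh' r) (at r)" "(A0 has_real_derivative A1 r) (at r)"
      using gh_deriv[of r] A0_deriv[of r] at_within_Ioo[OF r'] r' by auto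
    have "r powr s = r powr (s - 1) * r" using r by (simp add: powr_diff)
    then have e: "s * r powr (s - 1) * (gh r - s * A0 r) + (gh' r - s * A1 r) * r powr s = gh' r * r powr s"
      by (simp add: gh_def algebra_simps)
    have "((\<lambda>r. r powr s) has_real_derivative s * r powr (s - 1)) (at r)"
      using r by (auto intro!: derivative_eq_intros)
    from DERIV_mult[OF this DERIV_diff[OF d(1) DERIV_cmult[OF d(2), of s]]]
    have "((\<lambda>r. r powr s * (gh r - s * A0 r)) has_real_derivative gh' r * r powr s) (at r)"
      unfolding e .
    then show "((\<lambda>r. r powr s * (gh r - s * A0 r)) has_vector_derivative gh' r * r powr s) (at r)"
      by (simp add: has_real_derivative_iff_has_vector_derivative)
  qed (use \<rho> in auto)
  then have 1: "((\<lambda>r. gh' r * (min r \<rho>) powr s) has_integral (\<rho> powr s * (gh \<rho> - s * A0 \<rho>))) {0..\<rho>}"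
    by (auto elim!: has_integral_eq[rotated])
  have "(gh' has_integral (gh R - gh \<rho>)) {\<rho>..R}"
  proof (rule fundamental_theorem_of_calculus)
    fix r assume r: "r \<in> {\<rho>..R}"
    have "(gh has_real_derivative gh' r) (at r within {\<rho>..R})"
      by (rule DERIV_subset[OF gh_deriv]) (use r \<rho> in auto)
    then show "(gh has_vector_derivative gh' r) (at r within {\<rho>..R})"
      by (simp add: has_real_derivative_iff_has_vector_derivative)
  qed (use \<rho> in auto)
  then have "((\<lambda>r. gh' r * \<rho> powr s) has_integral ((gh R - gh \<rho>) * \<rho> powr s)) {\<rho>..R}"
    by (rule has_integral_mult_left)
  then have 2: "((\<lambda>r. gh' r * (min r \<rho>) powr s) has_integral ((gh R - gh \<rho>) * \<rho> powr s)) {\<rho>..R}"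
    by (auto elim!: has_integral_eq[rotated] simp: min_def)
  have "((\<lambda>r. gh' r * (min r \<rho>) powr s) has_integral (\<rho> powr s * (gh \<rho> - s * A0 \<rho>) + (gh R - gh \<rho>) * \<rho> powr s)) {0..R}"
    by (rule has_integral_combine[OF _ _ 1 2]) (use \<rho> in auto)
  then show ?thesis by (simp add: has_integral_iff algebra_simps)
qed

end

section \<open>Mixtures of equilibrium densities\<close>

lemma ball_potential_measurable [measurable]:
  fixes g :: "'b \<Rightarrow> 'a::euclidean_space"
  assumes [measurable]: "f \<in> borel_measurable M" "g \<in> borel_measurable M"
  shows "(\<lambda>p. ball_potential s lam (f p) (g p)) \<in> borel_measurable M"
  unfolding ball_potential_def by measurable

text \<open>For this \<open>s\<close> the degrees of homogeneity of the kernel, the density and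
  Lebesgue measure, namely \<open>- s\<close>, \<open>2 * lam - 2\<close> and
  \<open>DIM('a)\<close>, add up to 0.\<close>

lemma ball_potential_scale:
  fixes x :: "'a::euclidean_space"
  assumes s: "s = real DIM('a) - 2 + 2 * lam" and \<rho>: "\<rho> > 0"
  shows "ball_potential s lam \<rho> (\<rho> *\<^sub>R x) = ball_potential s lam 1 x"
proof -
  have "riesz_kernel s (\<rho> *\<^sub>R x) (\<rho> *\<^sub>R y) * ennreal (ball_density lam \<rho> (\<rho> *\<^sub>R y)) * ennreal (\<rho> ^ DIM('a)) =
      riesz_kernel s x y * ennreal (ball_density lam 1 y)" if "x \<noteq> y" for y
  proof (cases "norm y < 1")
    case True
    have n: "norm (\<rho> *\<^sub>R x - \<rho> *\<^sub>R y) = \<rho> * norm (x - y)" using \<rho> by (simp flip: scaleR_diff_right)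
    have k: "riesz_kernel s (\<rho> *\<^sub>R x) (\<rho> *\<^sub>R y) = ennreal ((\<rho> * norm (x - y)) powr - s)"
      using that \<rho> by (subst riesz_kernel_eq_ennreal) (simp_all add: n)
    have p: "1 - (norm y)\<^sup>2 > 0" using True by (simp add: abs_square_less_1)
    have "\<rho>\<^sup>2 - (\<rho> * norm y)\<^sup>2 = \<rho>\<^sup>2 * (1 - (norm y)\<^sup>2)" by (simp add: power_mult_distrib algebra_simps)
    then have d: "ball_density lam \<rho> (\<rho> *\<^sub>R y) = (\<rho>\<^sup>2) powr (lam - 1) * (1 - (norm y)\<^sup>2) powr (lam - 1)"
      using True \<rho> p by (simp add: ball_density_def powr_mult)
    have "(\<rho>\<^sup>2) powr (lam - 1) = \<rho> powr (2 * lam - 2)" using \<rho> by (simp add: powr_powr flip: powr_numeral)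
    moreover have "\<rho> powr - s * \<rho> powr (2 * lam - 2) * \<rho> ^ DIM('a) = 1"
    proof -
      have "\<rho> powr - s * \<rho> powr (2 * lam - 2) * \<rho> powr (real DIM('a)) = \<rho> powr 0"
        unfolding powr_add[symmetric] by (simp add: s)
      then show ?thesis using \<rho> by (simp add: powr_realpow)
    qed
    ultimately have "(\<rho> * norm (x - y)) powr - s * ball_density lam \<rho> (\<rho> *\<^sub>R y) * \<rho> ^ DIM('a) =
        norm (x - y) powr - s * ((1 - (norm y)\<^sup>2) powr (lam - 1))"
      unfolding d using \<rho> by (simp add: powr_mult mult_ac)
    then have eq: "ennreal ((\<rho> * norm (x - y)) powr - s * ball_density lam \<rho> (\<rho> *\<^sub>R y) * \<rho> ^ DIM('a)) =
        ennreal (norm (x - y) powr - s * ball_density lam 1 y)"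
      using True by (simp add: ball_density_def)
    have mult3: "ennreal a * ennreal b * ennreal c = ennreal (a * b * c)" if "a \<ge> 0" "b \<ge> 0" "c \<ge> 0" for a b c
      using that by (simp add: ennreal_mult)
    have "ennreal ((\<rho> * norm (x - y)) powr - s) * ennreal (ball_density lam \<rho> (\<rho> *\<^sub>R y)) * ennreal (\<rho> ^ DIM('a)) =
        ennreal (norm (x - y) powr - s * ball_density lam 1 y)"
      unfolding eq[symmetric] by (rule mult3) (use \<rho> in simp_all)
    also have "\<dots> = ennreal (norm (x - y) powr - s) * ennreal (ball_density lam 1 y)"
      by (rule ennreal_mult) simp_all
    finally show ?thesis unfolding k riesz_kernel_eq_ennreal[OF that] .
  next
    case False
    then have "\<not> \<rho> * norm y < \<rho>" using \<rho> by simp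
    then show ?thesis using False \<rho> by (simp add: ball_density_def)
  qed
  note key = this
  have AE: "AE y in lborel. ennreal (\<rho> ^ DIM('a)) * (riesz_kernel s (\<rho> *\<^sub>R x) (\<rho> *\<^sub>R y) * ennreal (ball_density lam \<rho> (\<rho> *\<^sub>R y))) =
      riesz_kernel s x y * ennreal (ball_density lam 1 y)"
  proof (rule AE_mp[OF AE_lborel_singleton[of x]], intro AE_I2 impI)
    fix y assume "y \<noteq> x"
    then show "ennreal (\<rho> ^ DIM('a)) * (riesz_kernel s (\<rho> *\<^sub>R x) (\<rho> *\<^sub>R y) * ennreal (ball_density lam \<rho> (\<rho> *\<^sub>R y))) =
        riesz_kernel s x y * ennreal (ball_density lam 1 y)"
      by (subst mult.commute, intro key) simp
  qed
  have "ball_potential s lam \<rho> (\<rho> *\<^sub>R x) = ennreal (\<rho> ^ DIM('a)) * (\<integral>\<^sup>+y. riesz_kernel s (\<rho> *\<^sub>R x) (\<rho> *\<^sub>R y) * ennreal (ball_density lam \<rho> (\<rho> *\<^sub>R y)) \<partial>lborel)"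
    unfolding ball_potential_def by (rule nn_integral_lborel_scaleR[OF _ \<rho>]) measurable
  also have "\<dots> = (\<integral>\<^sup>+y. ennreal (\<rho> ^ DIM('a)) * (riesz_kernel s (\<rho> *\<^sub>R x) (\<rho> *\<^sub>R y) * ennreal (ball_density lam \<rho> (\<rho> *\<^sub>R y))) \<partial>lborel)"
    by (rule nn_integral_cmult[symmetric]) measurable
  also have "\<dots> = ball_potential s lam 1 x"
    unfolding ball_potential_def by (rule nn_integral_cong_AE[OF AE])
  finally show ?thesis .
qed

lemma ball_potential_symmetric:
  "(\<integral>\<^sup>+x. ball_potential s lam a x * ennreal (ball_density lam b x) \<partial>(lborel :: 'a measure)) =
   (\<integral>\<^sup>+x. ball_potential s lam b x * ennreal (ball_density lam a x) \<partial>(lborel :: 'a::euclidean_space measure))"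
proof -
  have "(\<integral>\<^sup>+x. ball_potential s lam a x * ennreal (ball_density lam b x) \<partial>(lborel :: 'a measure)) =
     (\<integral>\<^sup>+x. \<integral>\<^sup>+y. riesz_kernel s x y * ennreal (ball_density lam a y) * ennreal (ball_density lam b x) \<partial>(lborel :: 'a measure) \<partial>lborel)"
    by (simp add: ball_potential_def nn_integral_multc)
  also have "\<dots> = (\<integral>\<^sup>+y. \<integral>\<^sup>+x. riesz_kernel s x y * ennreal (ball_density lam a y) * ennreal (ball_density lam b x) \<partial>(lborel :: 'a measure) \<partial>lborel)"
    by (rule lborel_pair.Fubini'[symmetric]) measurable
  also have "\<dots> = (\<integral>\<^sup>+y. \<integral>\<^sup>+x. riesz_kernel s y x * ennreal (ball_density lam b x) * ennreal (ball_density lam a y) \<partial>(lborel :: 'a measure) \<partial>lborel)"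
    by (intro nn_integral_cong) (subst riesz_kernel_commute, simp add: mult_ac)
  also have "\<dots> = (\<integral>\<^sup>+y. ball_potential s lam b y * ennreal (ball_density lam a y) \<partial>(lborel :: 'a measure))"
    by (simp add: ball_potential_def nn_integral_multc)
  finally show ?thesis .
qed

lemma ball_const_nonneg: "0 < lam \<Longrightarrow> lam < 1 \<Longrightarrow> ball_const n lam \<ge> 0"
  using Beta_real_pos[of "1 - lam" lam] by (simp add: ball_const_def sphere_area_def)

lemma mass_const_nonneg: "0 < lam \<Longrightarrow> n > 0 \<Longrightarrow> mass_const n lam \<ge> 0"
  using Beta_real_pos[of "n / 2" lam] by (simp add: mass_const_def sphere_area_def)

text \<open>On the smaller ball the potential of the larger one is constant, so the energy is this
  constant times the mass of the smaller density; symmetry covers the other order.\<close>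

lemma ball_mutual_energy:
  assumes lam: "0 < lam" "lam < 1" and s: "s = real DIM('a::euclidean_space) - 2 + 2 * lam"
    and a: "a > 0" and b: "b > 0"
  shows "(\<integral>\<^sup>+x. ball_potential s lam a x * ennreal (ball_density lam b x) \<partial>(lborel :: 'a measure)) =
    ennreal (ball_const DIM('a) lam * mass_const DIM('a) lam * min a b powr s)"
proof -
  have *: "(\<integral>\<^sup>+x. ball_potential s lam a x * ennreal (ball_density lam b x) \<partial>(lborel :: 'a measure)) =
    ennreal (ball_const DIM('a) lam * mass_const DIM('a) lam * b powr s)" if ab: "b \<le> a" "a > 0" "b > 0" for a b
  proof -
    have "(\<integral>\<^sup>+x. ball_potential s lam a x * ennreal (ball_density lam b x) \<partial>(lborel :: 'a measure)) =
        (\<integral>\<^sup>+x. ennreal (ball_const DIM('a) lam) * ennreal (ball_density lam b x) \<partial>(lborel :: 'a measure))"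
    proof (rule nn_integral_cong)
      fix x :: 'a
      show "ball_potential s lam a x * ennreal (ball_density lam b x) = ennreal (ball_const DIM('a) lam) * ennreal (ball_density lam b x)"
      proof (cases "norm x < b")
        case True
        then show ?thesis using ab by (subst ball_potential_inside[OF lam s]) auto
      qed (simp add: ball_density_def)
    qed
    also have "\<dots> = ennreal (ball_const DIM('a) lam) * ennreal (mass_const DIM('a) lam * b powr s)"
      using nn_integral_ball_density[OF lam(1) s ab(3)] by (simp add: nn_integral_cmult)
    finally show ?thesis using ball_const_nonneg[OF lam] by (simp add: ennreal_mult'[symmetric] mult.assoc)
  qed
  show ?thesis
  proof (cases "b \<le> a")
    case True
    then show ?thesis using *[OF True a b] by simp
  next
    case False
    then show ?thesis using *[of a b] a b by (subst ball_potential_symmetric) simp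
  qed
qed

text \<open>Radii above \<open>R\<close> count as \<open>R\<close>, so a weight with respect to
  Lebesgue measure can also carry an atom at \<open>R\<close>.\<close>

definition mix_density :: "real \<Rightarrow> real \<Rightarrow> (real \<Rightarrow> ennreal) \<Rightarrow> 'a::euclidean_space \<Rightarrow> ennreal" where
  "mix_density lam R c y = (\<integral>\<^sup>+\<rho>. c \<rho> * ennreal (ball_density lam (min R \<rho>) y) \<partial>lborel)"

definition mix :: "real \<Rightarrow> real \<Rightarrow> (real \<Rightarrow> ennreal) \<Rightarrow> 'a::euclidean_space measure" where
  "mix lam R c = density lborel (mix_density lam R c)"

definition mix_potential :: "real \<Rightarrow> real \<Rightarrow> real \<Rightarrow> (real \<Rightarrow> ennreal) \<Rightarrow> 'a::euclidean_space \<Rightarrow> ennreal" where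
  "mix_potential s lam R c x = (\<integral>\<^sup>+\<rho>. c \<rho> * ball_potential s lam (min R \<rho>) x \<partial>lborel)"

lemma sets_mix [simp, measurable_cong]: "sets (mix lam R c) = sets borel"
  by (simp add: mix_def)

text \<open>The weight is nonnegative; a signed mixture is treated as two instances, one for each
  part of its weight. \<open>TA\<close> ties the space \<open>'a\<close> to the locale.\<close>

locale ball_mixture =
  fixes lam R s :: real and c :: "real \<Rightarrow> ennreal" and TA :: "'a::euclidean_space itself"
  assumes lam: "0 < lam" "lam < 1" and s: "s = real DIM('a) - 2 + 2 * lam" and s_pos: "s > 0" and R: "R > 0"
    and c_measurable [measurable]: "c \<in> borel_measurable borel"
    and c0: "\<And>\<rho>. \<rho> \<le> 0 \<Longrightarrow> c \<rho> = 0" and c_fin: "(\<integral>\<^sup>+\<rho>. c \<rho> \<partial>lborel) < top"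
begin

lemma mix_density_measurable [measurable]: "(mix_density lam R c :: 'a \<Rightarrow> ennreal) \<in> borel_measurable borel"
  unfolding mix_density_def by measurable

lemma mix_potential_measurable [measurable]: "(mix_potential s lam R c :: 'a \<Rightarrow> ennreal) \<in> borel_measurable borel"
  unfolding mix_potential_def by measurable

lemma nn_integral_mix:
  assumes [measurable]: "f \<in> borel_measurable (borel :: 'a measure)"
  shows "(\<integral>\<^sup>+y. f y \<partial>mix lam R c) = (\<integral>\<^sup>+\<rho>. c \<rho> * (\<integral>\<^sup>+y. f y * ennreal (ball_density lam (min R \<rho>) y) \<partial>lborel) \<partial>lborel)"
proof -
  have "(\<integral>\<^sup>+y. f y \<partial>mix lam R c) = (\<integral>\<^sup>+y. \<integral>\<^sup>+\<rho>. c \<rho> * ennreal (ball_density lam (min R \<rho>) y) * f y \<partial>lborel \<partial>lborel)"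
    unfolding mix_def by (subst nn_integral_density) (auto simp: mix_density_def nn_integral_multc)
  also have "\<dots> = (\<integral>\<^sup>+\<rho>. \<integral>\<^sup>+y. c \<rho> * ennreal (ball_density lam (min R \<rho>) y) * f y \<partial>lborel \<partial>lborel)"
    by (rule lborel_pair.Fubini') measurable
  also have "\<dots> = (\<integral>\<^sup>+\<rho>. c \<rho> * (\<integral>\<^sup>+y. f y * ennreal (ball_density lam (min R \<rho>) y) \<partial>lborel) \<partial>lborel)"
    by (intro nn_integral_cong) (subst nn_integral_cmult[symmetric], simp_all add: mult_ac)
  finally show ?thesis .
qed

lemma riesz_potential_mix: "(\<integral>\<^sup>+y. riesz_kernel s x y \<partial>mix lam R c) = mix_potential s lam R c (x :: 'a)"
  unfolding mix_potential_def ball_potential_def by (rule nn_integral_mix) measurable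

lemma emeasure_mix: "emeasure (mix lam R c :: 'a measure) UNIV = (\<integral>\<^sup>+\<rho>. c \<rho> * ennreal (mass_const DIM('a) lam * min R \<rho> powr s) \<partial>lborel)"
proof -
  have "emeasure (mix lam R c :: 'a measure) UNIV = (\<integral>\<^sup>+y. 1 \<partial>(mix lam R c :: 'a measure))"
    by (simp add: mix_def)
  also have "\<dots> = (\<integral>\<^sup>+\<rho>. c \<rho> * (\<integral>\<^sup>+y. ennreal (ball_density lam (min R \<rho>) (y::'a)) \<partial>lborel) \<partial>lborel)"
    by (subst nn_integral_mix) simp_all
  also have "\<dots> = (\<integral>\<^sup>+\<rho>. c \<rho> * ennreal (mass_const DIM('a) lam * min R \<rho> powr s) \<partial>lborel)"
  proof (rule nn_integral_cong)
    fix \<rho> :: real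
    show "c \<rho> * (\<integral>\<^sup>+y. ennreal (ball_density lam (min R \<rho>) (y::'a)) \<partial>lborel) = c \<rho> * ennreal (mass_const DIM('a) lam * min R \<rho> powr s)"
      using c0[of \<rho>] nn_integral_ball_density[OF lam(1) s, of "min R \<rho>"] R by (cases "\<rho> \<le> 0") auto
  qed
  finally show ?thesis .
qed

lemma finite_measure_mix: "finite_measure (mix lam R c :: 'a measure)"
proof (rule finite_measureI)
  have "emeasure (mix lam R c :: 'a measure) UNIV \<le> (\<integral>\<^sup>+\<rho>. c \<rho> * ennreal (mass_const DIM('a) lam * R powr s) \<partial>lborel)"
    unfolding emeasure_mix
  proof (intro nn_integral_mono)
    fix \<rho> :: real
    show "c \<rho> * ennreal (mass_const DIM('a) lam * min R \<rho> powr s) \<le> c \<rho> * ennreal (mass_const DIM('a) lam * R powr s)"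
    proof (cases "\<rho> \<le> 0")
      case False
      then show ?thesis using s_pos R lam
        by (intro mult_left_mono ennreal_leI powr_mono2 mass_const_nonneg) auto
    qed (simp add: c0)
  qed
  also have "\<dots> < top" using c_fin by (simp add: nn_integral_multc ennreal_mult_less_top)
  finally show "emeasure (mix lam R c :: 'a measure) (space (mix lam R c)) \<noteq> \<infinity>"
    by (simp add: mix_def)
qed

lemma mix_potential_le: "mix_potential s lam R c (x :: 'a) \<le> ennreal (ball_const DIM('a) lam) * (\<integral>\<^sup>+\<rho>. c \<rho> \<partial>lborel)"
proof -
  have "mix_potential s lam R c x \<le> (\<integral>\<^sup>+\<rho>. c \<rho> * ennreal (ball_const DIM('a) lam) \<partial>lborel)"
    unfolding mix_potential_def
  proof (rule nn_integral_mono)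
    fix \<rho> :: real
    show "c \<rho> * ball_potential s lam (min R \<rho>) x \<le> c \<rho> * ennreal (ball_const DIM('a) lam)"
    proof (cases "\<rho> \<le> 0")
      case False
      then show ?thesis using s_pos R lam
        by (intro mult_left_mono ball_potential_le[OF lam s]) auto
    qed (simp add: c0)
  qed
  then show ?thesis by (simp add: nn_integral_multc mult.commute)
qed

lemma mix_potential_less_top: "mix_potential s lam R c (x :: 'a) < top"
  by (rule order.strict_trans1[OF mix_potential_le]) (use c_fin in \<open>simp add: ennreal_mult_less_top\<close>)

lemma mix_potential_norm_cong: "norm x = norm y \<Longrightarrow> mix_potential s lam R c (x :: 'a) = mix_potential s lam R c (y :: 'a)"
  unfolding mix_potential_def using ball_potential_norm_cong[of x y] by simp

lemma mix_potential_ball_density: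
  assumes \<rho>: "\<rho> \<in> {0<..R}"
  shows "(\<integral>\<^sup>+x. mix_potential s lam R c x * ennreal (ball_density lam \<rho> x) \<partial>(lborel :: 'a measure)) =
     (\<integral>\<^sup>+r. c r * ennreal (ball_const DIM('a) lam * mass_const DIM('a) lam * min r \<rho> powr s) \<partial>lborel)"
proof -
  have "(\<integral>\<^sup>+x. mix_potential s lam R c x * ennreal (ball_density lam \<rho> x) \<partial>(lborel :: 'a measure)) =
    (\<integral>\<^sup>+x. \<integral>\<^sup>+r. c r * ball_potential s lam (min R r) x * ennreal (ball_density lam \<rho> x) \<partial>lborel \<partial>(lborel :: 'a measure))"
    by (simp add: mix_potential_def nn_integral_multc)
  also have "\<dots> = (\<integral>\<^sup>+r. \<integral>\<^sup>+x. c r * ball_potential s lam (min R r) x * ennreal (ball_density lam \<rho> x) \<partial>(lborel :: 'a measure) \<partial>lborel)"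
    by (rule lborel_pair.Fubini') measurable
  also have "\<dots> = (\<integral>\<^sup>+r. c r * (\<integral>\<^sup>+x. ball_potential s lam (min R r) x * ennreal (ball_density lam \<rho> x) \<partial>(lborel :: 'a measure)) \<partial>lborel)"
    by (simp add: mult.assoc nn_integral_cmult)
  also have "\<dots> = (\<integral>\<^sup>+r. c r * ennreal (ball_const DIM('a) lam * mass_const DIM('a) lam * min r \<rho> powr s) \<partial>lborel)"
  proof (rule nn_integral_cong)
    fix r :: real
    show "c r * (\<integral>\<^sup>+x. ball_potential s lam (min R r) x * ennreal (ball_density lam \<rho> x) \<partial>(lborel :: 'a measure)) =
      c r * ennreal (ball_const DIM('a) lam * mass_const DIM('a) lam * min r \<rho> powr s)"
    proof (cases "r \<le> 0")
      case False
      then have "min (min R r) \<rho> = min r \<rho>" using \<rho> by auto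
      then show ?thesis using False R \<rho> ball_mutual_energy[OF lam s, of "min R r" \<rho>] by simp
    qed (simp add: c0)
  qed
  finally show ?thesis .
qed

text \<open>On the ray through \<open>e\<close> the potential of the unit ball is a decreasing
  function \<open>\<Phi>\<close>, and that of the ball of radius \<open>\<rho>\<close> is
  \<open>\<Phi> (r / \<rho>)\<close>. A monotone function has countably many discontinuities, so for
  a given \<open>x\<close> only a null set of radii is bad, and dominated convergence applies. This
  avoids a continuity proof for \<open>\<Phi>\<close> across the sphere.\<close>

lemma mix_potential_continuous:
  fixes e :: 'a
  assumes e: "norm e = 1"
  shows "continuous_on {0..R} (\<lambda>r. enn2real (mix_potential s lam R c (r *\<^sub>R e)))"
  unfolding continuous_on_sequentially
proof (intro allI ballI impI, elim conjE)
  fix X x assume x: "x \<in> {0..R}" and X: "\<forall>i. X i \<in> {0..R}" "X \<longlonglongrightarrow> x"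
  let ?W = "ennreal (ball_const DIM('a) lam)"
  define \<Phi> where "\<Phi> = (\<lambda>z. ball_potential s lam 1 (z *\<^sub>R e))"
  have \<Phi>_top: "\<Phi> z < top" for z
    unfolding \<Phi>_def using ball_potential_le[OF lam s, of 1 "z *\<^sub>R e"] s_pos by (auto intro: order.strict_trans1)
  have bp: "ball_potential s lam \<rho> (r *\<^sub>R e) = \<Phi> (r / \<rho>)" if "\<rho> > 0" for \<rho> r
    using ball_potential_scale[OF s that, of "(r / \<rho>) *\<^sub>R e"] that by (simp add: \<Phi>_def)
  have \<Phi>1: "\<Phi> z = ?W" if "0 \<le> z" "z \<le> 1" for z
    unfolding \<Phi>_def using that e by (intro ball_potential_inside[OF lam s]) auto
  have mono: "\<Phi> z' \<le> \<Phi> z" if z: "0 \<le> z" "z \<le> z'" for z z'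
  proof (cases "z \<le> 1")
    case True
    then show ?thesis using \<Phi>1[of z] z ball_potential_le[OF lam s, of 1 "z' *\<^sub>R e"] s_pos by (simp add: \<Phi>_def)
  next
    case False
    then show ?thesis unfolding \<Phi>_def using z e s_pos by (intro ball_potential_antimono) auto
  qed
  \<comment> \<open>The sign makes the decreasing \<open>\<Phi>\<close> increasing, as
    \<open>mono_on_ctble_discont\<close> expects.\<close>
  define g where "g = (\<lambda>z. - enn2real (\<Phi> z))"
  have "mono_on {0..} g" unfolding g_def
    by (intro mono_onI) (use mono \<Phi>_top in \<open>auto intro!: enn2real_mono\<close>)
  then have "countable {a \<in> {0..}. \<not> continuous (at a within {0..}) g}" (is "countable ?D")
    by (rule mono_on_ctble_discont)
  then have "countable ((\<lambda>z. x / z) ` ?D)" by (rule countable_image)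
  then have AE: "AE \<rho> in lborel. \<rho> \<notin> (\<lambda>z. x / z) ` ?D"
    by (intro AE_not_in countable_imp_null_set_lborel)
  have AE_c: "AE \<rho> in lborel. c \<rho> \<noteq> \<infinity>"
    using c_fin by (intro nn_integral_noteq_infinite) auto
  have AE_lim: "AE \<rho> in lborel. (\<lambda>i. c \<rho> * ball_potential s lam (min R \<rho>) (X i *\<^sub>R e)) \<longlonglongrightarrow> c \<rho> * ball_potential s lam (min R \<rho>) (x *\<^sub>R e)"
    using AE AE_c
  proof eventually_elim
    case (elim \<rho>)
    show ?case
    proof (cases "\<rho> \<le> 0")
      case False
      have "(\<lambda>i. \<Phi> (X i / min R \<rho>)) \<longlonglongrightarrow> \<Phi> (x / min R \<rho>)"
      proof (cases "R \<le> \<rho>")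
        case True
        then have "\<Phi> (X i / min R \<rho>) = \<Phi> (x / min R \<rho>)" for i
          using X x R by (subst (1 2) \<Phi>1) auto
        then show ?thesis by simp
      next
        case False': False
        have "x / \<rho> \<notin> ?D"
        proof
          assume D: "x / \<rho> \<in> ?D"
          show False
          \<comment> \<open>For \<open>x = 0\<close> the image of the bad set gives no information
            on \<open>\<rho>\<close>; here \<open>\<Phi>\<close> is constant to the right of 0, so 0
            is not a discontinuity.\<close>
          proof (cases "x = 0")
            case True
            have "continuous (at 0 within {0..}) g"
            proof (rule continuous_transform_within[of _ _ _ 1])
              show "continuous (at 0 within {0..}) (\<lambda>z::real. - enn2real ?W)" by simp
              fix z :: real assume "z \<in> {0..}" "dist z 0 < 1"
              then show "- enn2real ?W = g z" using \<Phi>1[of z] by (simp add: g_def)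
            qed auto
            then show False using D True by simp
          next
            case False
            then have "\<rho> = x / (x / \<rho>)" using \<open>\<not> \<rho> \<le> 0\<close> by simp
            then show False using elim D by blast
          qed
        qed
        then have cont: "continuous (at (x / \<rho>) within {0..}) g" using x False by auto
        have lim: "(\<lambda>i. X i / \<rho>) \<longlonglongrightarrow> x / \<rho>" using False by (intro tendsto_divide tendsto_const X) auto
        have mem: "X i / \<rho> \<in> {0..}" for i
        proof -
          have "X i \<ge> 0" using X(1) by auto
          then show ?thesis using False by simp
        qed
        have "(\<lambda>i. g (X i / \<rho>)) \<longlonglongrightarrow> g (x / \<rho>)"
          by (rule continuous_within_tendsto_compose'[OF cont mem lim])
        then have "(\<lambda>i. - g (X i / \<rho>)) \<longlonglongrightarrow> - g (x / \<rho>)" by (rule tendsto_minus)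
        then have "(\<lambda>i. ennreal (- g (X i / \<rho>))) \<longlonglongrightarrow> ennreal (- g (x / \<rho>))" by (rule tendsto_ennrealI)
        then show ?thesis using \<Phi>_top False' by (simp add: g_def ennreal_enn2real_if less_top[symmetric])
      qed
      then have lim: "(\<lambda>i. c \<rho> * \<Phi> (X i / min R \<rho>)) \<longlonglongrightarrow> c \<rho> * \<Phi> (x / min R \<rho>)"
        by (rule ennreal_tendsto_cmult[rotated]) (use elim(2) in \<open>simp add: less_top\<close>)
      have bp': "ball_potential s lam (min R \<rho>) (r *\<^sub>R e) = \<Phi> (r / min R \<rho>)" for r
        using False R by (intro bp) auto
      show ?thesis unfolding bp' by (rule lim)
    qed (simp add: c0)
  qed
  show "((\<lambda>r. enn2real (mix_potential s lam R c (r *\<^sub>R e))) \<circ> X) \<longlonglongrightarrow> enn2real (mix_potential s lam R c (x *\<^sub>R e))"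
    unfolding o_def
  proof (rule tendsto_enn2real)
    show "enn2real (mix_potential s lam R c (x *\<^sub>R e)) \<ge> 0" by simp
  next
    have "(\<lambda>i. mix_potential s lam R c (X i *\<^sub>R e)) \<longlonglongrightarrow> mix_potential s lam R c (x *\<^sub>R e)"
      unfolding mix_potential_def
    proof (rule nn_integral_dominated_convergence[where w="\<lambda>\<rho>. c \<rho> * ?W"])
      show "(\<integral>\<^sup>+\<rho>. c \<rho> * ?W \<partial>lborel) < \<infinity>" using c_fin by (simp add: nn_integral_multc ennreal_mult_less_top)
      show "AE \<rho> in lborel. c \<rho> * ball_potential s lam (min R \<rho>) (X i *\<^sub>R e) \<le> c \<rho> * ?W" for i
      proof (intro AE_I2)
        fix \<rho> :: real
        show "c \<rho> * ball_potential s lam (min R \<rho>) (X i *\<^sub>R e) \<le> c \<rho> * ?W"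
          using ball_potential_le[OF lam s, of "min R \<rho>" "X i *\<^sub>R e"] s_pos R c0[of \<rho>]
          by (cases "\<rho> \<le> 0") (auto intro!: mult_left_mono)
      qed
    qed (use AE_lim in auto)
    then show "(\<lambda>i. mix_potential s lam R c (X i *\<^sub>R e)) \<longlonglongrightarrow> ennreal (enn2real (mix_potential s lam R c (x *\<^sub>R e)))"
      using mix_potential_less_top[of "x *\<^sub>R e"] by simp
  qed
qed

end

section \<open>Abel inversion\<close>

lemma sphere_area_Gamma:
  assumes "n > 0"
  shows "sphere_area n = 2 * pi powr (n / 2) / Gamma (n / 2)"
proof -
  have "Gamma (n / 2 + 1) = (n / 2) * Gamma (n / 2)"
    using assms by (intro Gamma_plus1) auto
  then show ?thesis unfolding sphere_area_def unit_ball_vol_def using assms by (simp only:) simp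
qed

text \<open>The numerical factor in front of \<open>F\<close>, for \<open>d = n + 1\<close>.\<close>

definition field_const :: "nat \<Rightarrow> real \<Rightarrow> real \<Rightarrow> real" where
  "field_const n lam s = sin (lam * pi) * Gamma (s / 2) / (pi powr (real n / 2 + 1) * Gamma lam)"

text \<open>The origin of the constant in \<open>F\<close>: the sine cancels against
  \<open>ball_const\<close> by the reflection formula for Gamma, the factor \<open>s\<close> comes
  from \<open>integral_gh'_min\<close>, and the sphere area on the right is the one in the integral
  of the field against a ball density.\<close>

lemma field_const_normalization:
  assumes lam: "0 < lam" "lam < 1" and n: "n \<ge> 2" and s: "s = real n - 2 + 2 * lam"
  shows "field_const n lam s * (ball_const n lam * mass_const n lam) * s = sphere_area n"
proof -
  define S where "S = sphere_area n"
  have n0: "n > 0" using n by simp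
  have s_pos: "s > 0" using n lam s by simp
  have sinp: "sin (lam * pi) > 0" using lam by (intro sin_gt_zero) auto
  have G: "Gamma lam > 0" "Gamma (1 - lam) > 0" "Gamma (s / 2) > 0" "Gamma (real n / 2) > 0"
    using lam n0 s_pos by auto
  have refl: "Gamma (1 - lam) * Gamma lam = pi / sin (lam * pi)"
  proof -
    have "Gamma (complex_of_real lam) * Gamma (complex_of_real (1 - lam)) = of_real pi / sin (of_real (lam * pi))"
      using Gamma_reflection_complex[of "of_real lam"] by (simp add: mult.commute)
    then have "complex_of_real (Gamma lam * Gamma (1 - lam)) = complex_of_real (pi / sin (lam * pi))"
      by (simp only: Gamma_complex_of_real sin_of_real flip: of_real_mult of_real_divide)
    then show ?thesis by (simp only: of_real_eq_iff mult.commute)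
  qed
  have 1: "ball_const n lam = S * (pi / sin (lam * pi)) / 2"
    unfolding ball_const_def Beta_def S_def refl[symmetric] by simp
  have "real n / 2 + lam = s / 2 + 1" using s by (simp add: field_simps)
  moreover have "Gamma (s / 2 + 1) = (s / 2) * Gamma (s / 2)" using s_pos by (intro Gamma_plus1) auto
  ultimately have 2: "mass_const n lam = S * Gamma (real n / 2) * Gamma lam / (s * Gamma (s / 2))"
    unfolding mass_const_def Beta_def S_def by simp
  have 3: "S = 2 * pi powr (real n / 2) / Gamma (real n / 2)" unfolding S_def by (rule sphere_area_Gamma[OF n0])
  have 4: "pi powr (real n / 2 + 1) = pi powr (real n / 2) * pi" by (simp add: powr_add)
  have "field_const n lam s * (ball_const n lam * mass_const n lam) * s = S * (S * Gamma (real n / 2) / (2 * pi powr (real n / 2)))"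
    unfolding field_const_def 1 2 4 using sinp G G[THEN less_imp_neq] s_pos by (simp add: field_simps)
  also have "S * Gamma (real n / 2) / (2 * pi powr (real n / 2)) = 1"
    unfolding 3 using G by simp
  finally show ?thesis by (simp add: S_def)
qed

text \<open>With \<open>v = (\<rho>\<^sup>2 - t\<^sup>2) / (r\<^sup>2 - t\<^sup>2)\<close> this is a
  Beta integral. That its value depends on neither \<open>t\<close> nor \<open>r\<close> is what
  inverts the Abel transform.\<close>

lemma nn_integral_abel_kernel:
  assumes lam: "0 < lam" "lam < 1" and t: "0 \<le> t" "t < r"
  shows "(\<integral>\<^sup>+\<rho>. ennreal ((\<rho>\<^sup>2 - t\<^sup>2) powr (lam - 1) * (2 * \<rho> * (r\<^sup>2 - \<rho>\<^sup>2) powr (- lam))) * indicator {t<..<r} \<rho> \<partial>lborel) =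
     ennreal (Beta lam (1 - lam))"
proof -
  define d where "d = r\<^sup>2 - t\<^sup>2"
  have d: "d > 0" using t by (simp add: d_def power_strict_mono)
  have "ennreal (Beta lam (1 - lam)) = (\<integral>\<^sup>+v. ennreal (v powr (lam - 1) * (1 - v) powr (1 - lam - 1)) *
      indicator {(t\<^sup>2 - t\<^sup>2) / d..(r\<^sup>2 - t\<^sup>2) / d} v \<partial>lborel)"
    using lam d by (subst nn_integral_Beta[symmetric]) (auto simp: d_def)
  also have "\<dots> = (\<integral>\<^sup>+\<rho>. ennreal (((\<rho>\<^sup>2 - t\<^sup>2) / d) powr (lam - 1) * (1 - (\<rho>\<^sup>2 - t\<^sup>2) / d) powr (1 - lam - 1)) * ennreal (2 * \<rho> / d) * indicator {t..r} \<rho> \<partial>lborel)"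
    by (rule nn_integral_substitution_aux) (use t d in \<open>auto intro!: derivative_eq_intros continuous_intros\<close>)
  also have "\<dots> = (\<integral>\<^sup>+\<rho>. ennreal ((\<rho>\<^sup>2 - t\<^sup>2) powr (lam - 1) * (2 * \<rho> * (r\<^sup>2 - \<rho>\<^sup>2) powr (- lam))) * indicator {t<..<r} \<rho> \<partial>lborel)"
  proof (rule nn_integral_cong_AE, rule AE_mp[OF AE_lborel_doubleton[of t r]], intro AE_I2 impI)
    fix \<rho> assume \<rho>: "\<rho> \<noteq> t \<and> \<rho> \<noteq> r"
    show "ennreal (((\<rho>\<^sup>2 - t\<^sup>2) / d) powr (lam - 1) * (1 - (\<rho>\<^sup>2 - t\<^sup>2) / d) powr (1 - lam - 1)) * ennreal (2 * \<rho> / d) * indicator {t..r} \<rho> =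
      ennreal ((\<rho>\<^sup>2 - t\<^sup>2) powr (lam - 1) * (2 * \<rho> * (r\<^sup>2 - \<rho>\<^sup>2) powr (- lam))) * indicator {t<..<r} \<rho>"
    proof (cases "t < \<rho> \<and> \<rho> < r")
      case True
      have e: "1 - (\<rho>\<^sup>2 - t\<^sup>2) / d = (r\<^sup>2 - \<rho>\<^sup>2) / d" using d by (simp add: field_simps d_def)
      have p: "\<rho>\<^sup>2 - t\<^sup>2 > 0" "r\<^sup>2 - \<rho>\<^sup>2 > 0" using True t by (auto simp: power_strict_mono)
      define P1 P2 where "P1 = \<rho>\<^sup>2 - t\<^sup>2" and "P2 = r\<^sup>2 - \<rho>\<^sup>2"
      have "(P1 / d) powr (lam - 1) * (P2 / d) powr (1 - lam - 1) * (2 * \<rho> / d) =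
         P1 powr (lam - 1) * (2 * \<rho> * P2 powr (- lam)) / (d powr (lam - 1) * d powr (- lam) * d)"
        using p d by (simp add: powr_divide P1_def P2_def)
      also have "d powr (lam - 1) * d powr (- lam) * d = 1"
      proof -
        have "d powr (lam - 1) * d powr (- lam) * d powr 1 = d powr 0" by (simp only: powr_add[symmetric]) simp
        then show ?thesis using d by simp
      qed
      finally show ?thesis using True t d unfolding e P1_def P2_def
        by (subst ennreal_mult''[symmetric]) simp_all
    qed (use \<rho> in \<open>auto simp: indicator_def\<close>)
  qed
  finally show ?thesis ..
qed

text \<open>Integrating against \<open>2 \<rho> (r\<^sup>2 - \<rho>\<^sup>2) powr (- lam)\<close> inverts the Abel transform in the radius \<open>\<rho>\<close>.\<close>

lemma nn_integral_ball_eqI: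
  fixes f g :: "'a::euclidean_space \<Rightarrow> ennreal"
  assumes lam: "0 < lam" "lam < 1" and [measurable]: "f \<in> borel_measurable borel" "g \<in> borel_measurable borel"
    and eq: "\<And>\<rho>. \<rho> \<in> {0<..R} \<Longrightarrow>
      (\<integral>\<^sup>+x. f x * ennreal (ball_density lam \<rho> x) \<partial>lborel) = (\<integral>\<^sup>+x. g x * ennreal (ball_density lam \<rho> x) \<partial>lborel)"
    and r: "r \<in> {0<..R}"
  shows "(\<integral>\<^sup>+x. f x * indicator (ball 0 r) x \<partial>lborel) = (\<integral>\<^sup>+x. g x * indicator (ball 0 r) x \<partial>lborel)"
proof -
  define h where "h = (\<lambda>\<rho>. ennreal (2 * \<rho> * (r\<^sup>2 - \<rho>\<^sup>2) powr (- lam)) * indicator {0<..<r} \<rho>)"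
  have [measurable]: "h \<in> borel_measurable borel" unfolding h_def by measurable
  have [measurable]: "ball (0::'a) r \<in> sets borel" by simp
  let ?B = "ennreal (Beta lam (1 - lam))"
  \<comment> \<open>The cutoff in \<open>ball_density\<close> restricts the radii to
    \<open>(norm x, r)\<close>, where \<open>nn_integral_abel_kernel\<close> applies.\<close>
  have inner: "(\<integral>\<^sup>+\<rho>. h \<rho> * ennreal (ball_density lam \<rho> x) \<partial>lborel) = ?B * indicator (ball 0 r) x" for x :: 'a
  proof (cases "norm x < r")
    case True
    have "(\<integral>\<^sup>+\<rho>. h \<rho> * ennreal (ball_density lam \<rho> x) \<partial>lborel) =
      (\<integral>\<^sup>+\<rho>. ennreal ((\<rho>\<^sup>2 - (norm x)\<^sup>2) powr (lam - 1) * (2 * \<rho> * (r\<^sup>2 - \<rho>\<^sup>2) powr (- lam))) * indicator {norm x<..<r} \<rho> \<partial>lborel)"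
    proof (rule nn_integral_cong)
      fix \<rho> :: real
      show "h \<rho> * ennreal (ball_density lam \<rho> x) = ennreal ((\<rho>\<^sup>2 - (norm x)\<^sup>2) powr (lam - 1) * (2 * \<rho> * (r\<^sup>2 - \<rho>\<^sup>2) powr (- lam))) * indicator {norm x<..<r} \<rho>"
      proof (cases "norm x < \<rho> \<and> \<rho> < r")
        case True
        then have "\<rho> > 0" using norm_ge_zero[of x] by linarith
        then show ?thesis using True by (simp add: h_def ball_density_def ennreal_mult''[symmetric] mult.commute)
      next
        case False
        then show ?thesis by (auto simp: h_def ball_density_def indicator_def)
      qed
    qed
    then show ?thesis using nn_integral_abel_kernel[OF lam _ True] True by simp
  next
    case False
    then have h0: "h \<rho> * ennreal (ball_density lam \<rho> x) = 0" for \<rho>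
      by (auto simp: h_def ball_density_def indicator_def)
    show ?thesis unfolding h0 using False by simp
  qed
  have transform: "(\<integral>\<^sup>+\<rho>. h \<rho> * (\<integral>\<^sup>+x. f x * ennreal (ball_density lam \<rho> x) \<partial>lborel) \<partial>lborel) = ?B * (\<integral>\<^sup>+x. f x * indicator (ball 0 r) x \<partial>lborel)"
    if [measurable]: "f \<in> borel_measurable borel" for f :: "'a \<Rightarrow> ennreal"
  proof -
    have "(\<integral>\<^sup>+\<rho>. h \<rho> * (\<integral>\<^sup>+x. f x * ennreal (ball_density lam \<rho> x) \<partial>lborel) \<partial>lborel) =
       (\<integral>\<^sup>+\<rho>. \<integral>\<^sup>+x. f x * (h \<rho> * ennreal (ball_density lam \<rho> x)) \<partial>lborel \<partial>lborel)"
      by (intro nn_integral_cong) (subst nn_integral_cmult[symmetric], simp_all add: mult_ac)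
    also have "\<dots> = (\<integral>\<^sup>+x. \<integral>\<^sup>+\<rho>. f x * (h \<rho> * ennreal (ball_density lam \<rho> x)) \<partial>lborel \<partial>lborel)"
      by (rule lborel_pair.Fubini') measurable
    also have "\<dots> = (\<integral>\<^sup>+x. ?B * (f x * indicator (ball 0 r) x) \<partial>lborel)"
      by (intro nn_integral_cong) (simp add: nn_integral_cmult inner mult_ac)
    also have "\<dots> = ?B * (\<integral>\<^sup>+x. f x * indicator (ball 0 r) x \<partial>lborel)"
      by (rule nn_integral_cmult) measurable
    finally show ?thesis .
  qed
  have "(\<integral>\<^sup>+\<rho>. h \<rho> * (\<integral>\<^sup>+x. f x * ennreal (ball_density lam \<rho> x) \<partial>lborel) \<partial>lborel) =
     (\<integral>\<^sup>+\<rho>. h \<rho> * (\<integral>\<^sup>+x. g x * ennreal (ball_density lam \<rho> x) \<partial>lborel) \<partial>lborel)"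
  proof (rule nn_integral_cong)
    fix \<rho> :: real
    show "h \<rho> * (\<integral>\<^sup>+x. f x * ennreal (ball_density lam \<rho> x) \<partial>lborel) = h \<rho> * (\<integral>\<^sup>+x. g x * ennreal (ball_density lam \<rho> x) \<partial>lborel)"
      using r eq[of \<rho>] by (cases "\<rho> \<in> {0<..<r}") (auto simp: h_def)
  qed
  then have "?B * (\<integral>\<^sup>+x. f x * indicator (ball 0 r) x \<partial>lborel) = ?B * (\<integral>\<^sup>+x. g x * indicator (ball 0 r) x \<partial>lborel)"
    by (simp add: transform)
  then show ?thesis
    using Beta_real_pos[of lam "1 - lam"] lam by (simp add: ennreal_mult_cancel_left)
qed

lemma nn_integral_continuous_Icc:
  fixes u :: "real \<Rightarrow> real"
  assumes "continuous_on {a..b} u" "\<And>x. x \<in> {a..b} \<Longrightarrow> u x \<ge> 0" and [measurable]: "u \<in> borel_measurable borel"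
  shows "(\<integral>\<^sup>+x. ennreal (u x) * indicator {a..b} x \<partial>lborel) = ennreal (integral {a..b} u)"
proof -
  have "(u has_integral integral {a..b} u) {a..b}"
    using assms by (intro integrable_integral integrable_continuous_real)
  then have "((\<lambda>x. u x * indicator {a..b} x) has_integral integral {a..b} u) UNIV"
    by (subst (asm) has_integral_restrict_UNIV[symmetric]) (auto elim!: has_integral_eq[rotated] simp: indicator_def)
  then have "(\<integral>\<^sup>+x. ennreal (u x * indicator {a..b} x) \<partial>lborel) = ennreal (integral {a..b} u)"
    using assms(2) by (intro nn_integral_has_integral_lborel) (auto simp: indicator_def)
  moreover have "ennreal (u x * indicator {a..b} x) = ennreal (u x) * indicator {a..b} x" for x
    by (auto simp: indicator_def)
  ultimately show ?thesis by simp
qed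

text \<open>Differentiating the integral over a ball in its radius recovers the profile times
  \<open>r ^ (DIM('a) - 1)\<close>, hence the profile at interior radii; continuity adds the two
  endpoints.\<close>

lemma radial_eqI:
  fixes \<phi> \<psi> :: "real \<Rightarrow> real"
  assumes R: "R > 0" and cont: "continuous_on {0..R} \<phi>" "continuous_on {0..R} \<psi>"
    and nonneg: "\<And>r. r \<in> {0..R} \<Longrightarrow> \<phi> r \<ge> 0" "\<And>r. r \<in> {0..R} \<Longrightarrow> \<psi> r \<ge> 0"
    and [measurable]: "\<phi> \<in> borel_measurable borel" "\<psi> \<in> borel_measurable borel"
    and eq: "\<And>r. r \<in> {0<..R} \<Longrightarrow> (\<integral>\<^sup>+x. ennreal (\<phi> (norm x)) * indicator (ball 0 r) x \<partial>(lborel :: 'a::euclidean_space measure)) =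
      (\<integral>\<^sup>+x. ennreal (\<psi> (norm x)) * indicator (ball 0 r) x \<partial>(lborel :: 'a measure))"
    and r: "r \<in> {0..R}"
  shows "\<phi> r = \<psi> r"
proof -
  define w where "w = (\<lambda>r::real. r ^ (DIM('a) - 1))"
  have int: "(\<integral>\<^sup>+x. ennreal (u (norm x)) * indicator (ball 0 r) x \<partial>(lborel :: 'a measure)) = ennreal (sphere_area DIM('a)) * ennreal (integral {0..r} (\<lambda>t. w t * u t))"
    if r: "r \<in> {0<..R}" and u: "continuous_on {0..R} u" "\<And>r. r \<in> {0..R} \<Longrightarrow> u r \<ge> 0" and [measurable]: "u \<in> borel_measurable borel" for u r
  proof -
    have "(\<integral>\<^sup>+x. ennreal (u (norm x)) * indicator (ball 0 r) x \<partial>(lborel :: 'a measure)) =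
       (\<integral>\<^sup>+x. ennreal (u (norm x)) * indicator {..<r} (norm x) \<partial>(lborel :: 'a measure))"
      by (intro nn_integral_cong) (auto simp: indicator_def)
    also have "\<dots> = ennreal (sphere_area DIM('a)) * (\<integral>\<^sup>+t. indicator {0<..} t * ennreal (t ^ (DIM('a) - 1)) * (ennreal (u t) * indicator {..<r} t) \<partial>lborel)"
      unfolding emeasure_sphere_area[symmetric] by (rule nn_integral_radial) measurable
    also have "(\<integral>\<^sup>+t. indicator {0<..} t * ennreal (t ^ (DIM('a) - 1)) * (ennreal (u t) * indicator {..<r} t) \<partial>lborel) =
      (\<integral>\<^sup>+t. ennreal (w t * u t) * indicator {0..r} t \<partial>lborel)"
    proof (rule nn_integral_cong_AE, rule AE_mp[OF AE_lborel_doubleton[of 0 r]], intro AE_I2 impI)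
      fix t assume "t \<noteq> 0 \<and> t \<noteq> r"
      then show "indicator {0<..} t * ennreal (t ^ (DIM('a) - 1)) * (ennreal (u t) * indicator {..<r} t) = ennreal (w t * u t) * indicator {0..r} t"
        using u(2)[of t] r by (auto simp: indicator_def w_def ennreal_mult)
    qed
    also have "\<dots> = ennreal (integral {0..r} (\<lambda>t. w t * u t))"
      using r u by (intro nn_integral_continuous_Icc) (auto simp: w_def intro!: continuous_intros intro: continuous_on_subset)
    finally show ?thesis .
  qed
  have cw: "continuous_on {0..R} (\<lambda>t. w t * \<phi> t)" "continuous_on {0..R} (\<lambda>t. w t * \<psi> t)"
    unfolding w_def by (intro continuous_intros cont)+
  have eq_int: "integral {0..r} (\<lambda>t. w t * \<phi> t) = integral {0..r} (\<lambda>t. w t * \<psi> t)" if r: "r \<in> {0<..R}" for r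
  proof -
    have "ennreal (integral {0..r} (\<lambda>t. w t * \<phi> t)) = ennreal (integral {0..r} (\<lambda>t. w t * \<psi> t))"
    proof -
      have "ennreal (sphere_area DIM('a)) * ennreal (integral {0..r} (\<lambda>t. w t * \<phi> t)) =
          ennreal (sphere_area DIM('a)) * ennreal (integral {0..r} (\<lambda>t. w t * \<psi> t))"
        using eq[OF r] int[OF r cont(1) nonneg(1)] int[OF r cont(2) nonneg(2)] by (metis assms(6,7))
      then show ?thesis using sphere_area_pos[of "DIM('a)"] by (simp add: ennreal_mult_cancel_left)
    qed
    moreover have "integral {0..r} (\<lambda>t. w t * u t) \<ge> 0" if "continuous_on {0..R} u" "\<And>r. r \<in> {0..R} \<Longrightarrow> u r \<ge> 0" for u
      using r that by (intro integral_nonneg integrable_continuous_real)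
         (auto simp: w_def intro!: continuous_intros intro: continuous_on_subset)
    ultimately show ?thesis using cont nonneg by simp
  qed
  have Ioo: "\<phi> x = \<psi> x" if x: "x \<in> {0<..<R}" for x
  proof -
    have "((\<lambda>r. integral {0..r} (\<lambda>t. w t * \<phi> t)) has_real_derivative w x * \<phi> x) (at x within {0..R})"
      "((\<lambda>r. integral {0..r} (\<lambda>t. w t * \<psi> t)) has_real_derivative w x * \<psi> x) (at x within {0..R})"
      using x by (auto intro!: integral_has_real_derivative cw)
    then have d: "((\<lambda>r. integral {0..r} (\<lambda>t. w t * \<phi> t)) has_real_derivative w x * \<phi> x) (at x)"
      "((\<lambda>r. integral {0..r} (\<lambda>t. w t * \<psi> t)) has_real_derivative w x * \<psi> x) (at x)"
      using x by (auto simp: at_within_Icc_at)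
    have "((\<lambda>r. integral {0..r} (\<lambda>t. w t * \<psi> t)) has_real_derivative w x * \<phi> x) (at x)"
      by (rule has_field_derivative_transform_within_open[OF d(1), of "{0<..<R}"]) (use x eq_int in auto)
    then have "w x * \<phi> x = w x * \<psi> x" using d(2) by (rule DERIV_unique)
    then show ?thesis using x by (simp add: w_def)
  qed
  have cl: "closure {0<..<R} = {0..R}" using R by simp
  have "\<phi> r - \<psi> r = 0"
  proof (rule continuous_constant_on_closure[where S="{0<..<R}" and f="\<lambda>x. \<phi> x - \<psi> x"])
    show "continuous_on (closure {0<..<R}) (\<lambda>x. \<phi> x - \<psi> x)" unfolding cl by (intro continuous_intros cont)
  qed (use Ioo r cl in auto)
  then show ?thesis by simp
qed

section \<open>Potential of the candidate density\<close>

text \<open>\<open>C\<close> stays arbitrary here: the potential identity below holds for every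
  value, and only the total mass singles out \<open>dens_C\<close>.\<close>

locale radial_field_space = radial_field n lam R s q q1 q2
  for n lam R s q q1 q2 +
  fixes C :: real and TA :: "'a::euclidean_space itself"
  assumes n_DIM: "n = DIM('a)" and q_nonneg: "\<And>r. r \<in> {0..R} \<Longrightarrow> q r \<ge> 0"
begin

definition "K = field_const n lam s"
definition "W = ball_const n lam"
definition "m = mass_const n lam"

text \<open>
  Radii \<open>\<rho>\<close> in \<open>[R, R + 1)\<close> are truncated to \<open>R\<close> in \<open>mix_density\<close>, so the value of \<open>b\<close> there encodes
  a point mass at the radius \<open>R\<close>.
\<close>

definition b :: "real \<Rightarrow> real" where
  "b \<rho> = indicator {0<..<R} \<rho> * (K * gh' \<rho>) + indicator {R..<R + 1} \<rho> * (C - K * gh R)"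

lemma s_DIM: "s = real DIM('a) - 2 + 2 * lam" using s n_DIM by simp

lemma b_measurable [measurable]: "b \<in> borel_measurable borel"
  unfolding b_def by measurable

lemma b_bounded: obtains B where "B \<ge> 0" "\<And>\<rho>. \<bar>b \<rho>\<bar> \<le> B * indicator {0<..<R + 1} \<rho>"
proof -
  obtain B where B: "B \<ge> 0" "\<And>x. x \<in> {0..R} \<Longrightarrow> \<bar>gh' x\<bar> \<le> B" by (rule gh'_bounded) blast
  have "\<bar>b \<rho>\<bar> \<le> (\<bar>K\<bar> * B + \<bar>C - K * gh R\<bar>) * indicator {0<..<R + 1} \<rho>" for \<rho>
  proof -
    consider "\<rho> \<in> {0<..<R}" | "\<rho> \<in> {R..<R + 1}" | "\<rho> \<notin> {0<..<R + 1}" using R by force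
    then show ?thesis
    proof cases
      case 1
      then have "\<bar>K\<bar> * \<bar>gh' \<rho>\<bar> \<le> \<bar>K\<bar> * B" by (intro mult_left_mono B) auto
      then show ?thesis using 1 by (simp add: b_def abs_mult)
    next
      case 2
      then show ?thesis using B R by (simp add: b_def)
    next
      case 3
      then show ?thesis using R by (auto simp: b_def indicator_def)
    qed
  qed
  then show ?thesis using B by (intro that[of "\<bar>K\<bar> * B + \<bar>C - K * gh R\<bar>"]) auto
qed

lemma b_eq_0: "\<rho> \<le> 0 \<Longrightarrow> b \<rho> = 0"
  using R by (simp add: b_def)

lemma integrable_b_mult:
  assumes [measurable]: "k \<in> borel_measurable borel" and k: "\<And>\<rho>. \<rho> > 0 \<Longrightarrow> \<bar>k \<rho>\<bar> \<le> D" and D: "D \<ge> 0"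
  shows "integrable lborel (\<lambda>\<rho>. b \<rho> * k \<rho>)"
proof -
  obtain B where B: "B \<ge> 0" "\<And>\<rho>. \<bar>b \<rho>\<bar> \<le> B * indicator {0<..<R + 1} \<rho>" by (rule b_bounded) blast
  show ?thesis
  proof (rule Bochner_Integration.integrable_bound[where f="\<lambda>\<rho>. B * D * indicator {0<..<R + 1} \<rho>"])
    show "integrable lborel (\<lambda>\<rho>. B * D * indicator {0<..<R + 1} \<rho> :: real)"
      using R by (intro integrable_mult_right integrable_real_indicator) auto
    show "AE \<rho> in lborel. norm (b \<rho> * k \<rho>) \<le> norm (B * D * indicator {0<..<R + 1} \<rho>)"
    proof (intro AE_I2)
      fix \<rho> :: real
      show "norm (b \<rho> * k \<rho>) \<le> norm (B * D * indicator {0<..<R + 1} \<rho>)"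
      proof (cases "\<rho> > 0")
        case True
        have "\<bar>b \<rho>\<bar> * \<bar>k \<rho>\<bar> \<le> (B * indicator {0<..<R + 1} \<rho>) * D"
          using B k[OF True] by (intro mult_mono) auto
        then show ?thesis using B D by (simp add: abs_mult mult_ac)
      qed (simp add: b_eq_0)
    qed
  qed simp
qed

text \<open>\<open>ennreal\<close> sends negative numbers to 0, so \<open>ennreal (b \<rho>)\<close>
  and \<open>ennreal (- b \<rho>)\<close> are the positive and the negative part of the signed
  weight.\<close>

lemma nn_integral_b:
  assumes int: "integrable lborel (\<lambda>\<rho>. b \<rho> * k \<rho>)" and k: "\<And>\<rho>. k \<rho> \<ge> 0"
  shows "(\<integral>\<^sup>+\<rho>. ennreal (b \<rho>) * ennreal (k \<rho>) \<partial>lborel) < top"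
    and "(\<integral>\<^sup>+\<rho>. ennreal (- b \<rho>) * ennreal (k \<rho>) \<partial>lborel) < top"
    and "enn2real (\<integral>\<^sup>+\<rho>. ennreal (b \<rho>) * ennreal (k \<rho>) \<partial>lborel) - enn2real (\<integral>\<^sup>+\<rho>. ennreal (- b \<rho>) * ennreal (k \<rho>) \<partial>lborel) =
      (\<integral>\<rho>. b \<rho> * k \<rho> \<partial>lborel)"
proof -
  have e: "ennreal (b \<rho>) * ennreal (k \<rho>) = ennreal (b \<rho> * k \<rho>)" "ennreal (- b \<rho>) * ennreal (k \<rho>) = ennreal (- (b \<rho> * k \<rho>))" for \<rho>
    using k[of \<rho>] by (simp_all add: ennreal_mult''[symmetric])
  show "(\<integral>\<^sup>+\<rho>. ennreal (b \<rho>) * ennreal (k \<rho>) \<partial>lborel) < top" "(\<integral>\<^sup>+\<rho>. ennreal (- b \<rho>) * ennreal (k \<rho>) \<partial>lborel) < top"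
    unfolding e using integrableD(2)[OF int] integrableD(2)[OF integrable_minus[OF int]] by (auto simp: less_top)
  show "enn2real (\<integral>\<^sup>+\<rho>. ennreal (b \<rho>) * ennreal (k \<rho>) \<partial>lborel) - enn2real (\<integral>\<^sup>+\<rho>. ennreal (- b \<rho>) * ennreal (k \<rho>) \<partial>lborel) =
      (\<integral>\<rho>. b \<rho> * k \<rho> \<partial>lborel)"
    unfolding e by (rule real_lebesgue_integral_def[OF int, symmetric])
qed

sublocale pos: ball_mixture lam R s "\<lambda>\<rho>. ennreal (b \<rho>)" "TYPE('a)"
proof (rule ball_mixture.intro)
  show "(\<integral>\<^sup>+\<rho>. ennreal (b \<rho>) \<partial>lborel) < top"
    using nn_integral_b(1)[OF integrable_b_mult[of "\<lambda>_. 1" 1]] by simp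
qed (auto simp: b_eq_0 intro: lam s_DIM s_pos R)

sublocale neg: ball_mixture lam R s "\<lambda>\<rho>. ennreal (- b \<rho>)" "TYPE('a)"
proof (rule ball_mixture.intro)
  show "(\<integral>\<^sup>+\<rho>. ennreal (- b \<rho>) \<partial>lborel) < top"
    using nn_integral_b(2)[OF integrable_b_mult[of "\<lambda>_. 1" 1]] by simp
qed (auto simp: b_eq_0 intro: lam s_DIM s_pos R)

lemma W_m_nonneg: "W \<ge> 0" "m \<ge> 0"
  using lam n2 by (auto simp: W_def m_def intro!: ball_const_nonneg mass_const_nonneg)

lemma integrable_gh'_mult:
  assumes [measurable]: "k \<in> borel_measurable borel" and k: "continuous_on {0..R} k"
  shows "integrable lborel (\<lambda>r. indicator {0<..<R} r * (gh' r * k r))"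
proof -
  obtain B where B: "B \<ge> 0" "\<And>x. x \<in> {0..R} \<Longrightarrow> \<bar>gh' x * k x\<bar> \<le> B"
    using continuous_on_Icc_bounded[OF continuous_on_mult[OF gh'_cont k]] by blast
  have "integrable lborel (\<lambda>r. B * indicator {0<..<R} r)"
    using R by (intro integrable_mult_right integrable_real_indicator) auto
  then show ?thesis
    by (rule Bochner_Integration.integrable_bound)
      (use B in \<open>auto intro!: AE_I2 simp: indicator_def abs_mult\<close>)
qed

text \<open>The part \<open>- K * gh R\<close> of the atom cancels the boundary term of
  \<open>integral_gh'_min\<close>. What remains is \<open>C * W\<close> times the mass of the ball
  density, minus the integral of the profile against it.\<close>

lemma integral_b_min:
  assumes \<rho>: "\<rho> \<in> {0<..R}"
  shows "integrable lborel (\<lambda>r. b r * (W * m * min r \<rho> powr s))"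
    and "(\<integral>r. b r * (W * m * min r \<rho> powr s) \<partial>lborel) = C * W * m * \<rho> powr s - sphere_area n * (\<rho> powr s * A0 \<rho>)"
proof -
  define k where "k = (\<lambda>r. min r \<rho> powr s)"
  have [measurable]: "k \<in> borel_measurable borel" unfolding k_def by measurable
  have k: "min r \<rho> powr s \<le> \<rho> powr s" if "r > 0" for r
    using that \<rho> s_pos by (auto intro!: powr_mono2)
  show "integrable lborel (\<lambda>r. b r * (W * m * min r \<rho> powr s))"
    using W_m_nonneg k
    by (intro integrable_b_mult[where D="W * m * \<rho> powr s"]) (auto simp: abs_mult intro!: mult_left_mono)
  have kc: "continuous_on {0..R} k"
    unfolding k_def using s_pos \<rho> by (intro continuous_on_powr' continuous_intros) auto
  have 1: "integrable lborel (\<lambda>r. indicator {0<..<R} r * (gh' r * k r))" by (rule integrable_gh'_mult[OF _ kc]) simp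
  have i1: "(\<integral>r. indicator {0<..<R} r * (gh' r * k r) \<partial>lborel) = gh R * \<rho> powr s - s * (\<rho> powr s * A0 \<rho>)"
    using integral_eq_lborel(1)[OF 1] integral_gh'_min[OF \<rho>] by (simp add: k_def)
  have 2: "integrable lborel (\<lambda>r. indicator {R..<R + 1} r * \<rho> powr s)" by simp
  have i2: "(\<integral>r. indicator {R..<R + 1} r * \<rho> powr s \<partial>lborel) = \<rho> powr s" by simp
  have "b r * (W * m * k r) = K * (W * m) * (indicator {0<..<R} r * (gh' r * k r)) + (C - K * gh R) * (W * m) * (indicator {R..<R + 1} r * \<rho> powr s)" for r
  proof -
    have "k r = \<rho> powr s" if "R \<le> r" using that \<rho> by (simp add: k_def)
    then show ?thesis by (auto simp: b_def indicator_def)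
  qed
  then have "(\<integral>r. b r * (W * m * k r) \<partial>lborel) =
     K * (W * m) * (gh R * \<rho> powr s - s * (\<rho> powr s * A0 \<rho>)) + (C - K * gh R) * (W * m) * \<rho> powr s"
    using 1 2 by (simp add: i1 i2)
  also have "\<dots> = C * W * m * \<rho> powr s - (K * (W * m) * s) * (\<rho> powr s * A0 \<rho>)"
    by (simp add: algebra_simps)
  also have "K * (W * m) * s = sphere_area n"
    unfolding K_def W_def m_def by (rule field_const_normalization[OF lam n2 s])
  finally show "(\<integral>r. b r * (W * m * min r \<rho> powr s) \<partial>lborel) = C * W * m * \<rho> powr s - sphere_area n * (\<rho> powr s * A0 \<rho>)"
    by (simp add: k_def)
qed

text \<open>Identifies the term with \<open>A0\<close> in \<open>integral_b_min\<close> as the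
  integral of the field against a ball density.\<close>

lemma nn_integral_q_ball_density:
  assumes \<rho>: "\<rho> \<in> {0<..R}"
  shows "(\<integral>\<^sup>+x. ennreal (q (norm x)) * ennreal (ball_density lam \<rho> x) \<partial>(lborel :: 'a measure)) =
      ennreal (sphere_area n * (\<rho> powr s * A0 \<rho>))" and "\<rho> powr s * A0 \<rho> \<ge> 0"
proof -
  define f where "f = (\<lambda>r. ennreal (q r) * ennreal (if r < \<rho> then (\<rho>\<^sup>2 - r\<^sup>2) powr (lam - 1) else 0))"
  define u where "u = (\<lambda>r. indicator {0<..<\<rho>} r * (q r * r ^ (n - 1) / (\<rho>\<^sup>2 - r\<^sup>2) powr (1 - lam)))"
  have \<rho>0: "\<rho> > 0" using \<rho> by simp
  have u: "u r \<ge> 0" for r using q_nonneg[of r] \<rho> by (auto simp: u_def indicator_def)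
  have A: "(\<integral>r. u r \<partial>lborel) = \<rho> powr s * A0 \<rho>" unfolding u_def by (rule abel_q(2)[OF \<rho>0])
  show A_nonneg: "\<rho> powr s * A0 \<rho> \<ge> 0" unfolding A[symmetric] using u by simp
  have "(\<integral>\<^sup>+x. ennreal (q (norm x)) * ennreal (ball_density lam \<rho> x) \<partial>(lborel :: 'a measure)) = (\<integral>\<^sup>+x. f (norm x) \<partial>(lborel :: 'a measure))"
    by (simp add: f_def ball_density_def)
  also have "\<dots> = ennreal (sphere_area DIM('a)) * (\<integral>\<^sup>+r. indicator {0<..} r * ennreal (r ^ (DIM('a) - 1)) * f r \<partial>lborel)"
    unfolding emeasure_sphere_area[symmetric] by (rule nn_integral_radial) (simp add: f_def)
  also have "(\<integral>\<^sup>+r. indicator {0<..} r * ennreal (r ^ (DIM('a) - 1)) * f r \<partial>lborel) = (\<integral>\<^sup>+r. ennreal (u r) \<partial>lborel)"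
  proof (rule nn_integral_cong)
    fix r :: real
    have "(\<rho>\<^sup>2 - r\<^sup>2) powr (lam - 1) = 1 / (\<rho>\<^sup>2 - r\<^sup>2) powr (1 - lam)"
      using powr_minus_divide[of "\<rho>\<^sup>2 - r\<^sup>2" "1 - lam"] by simp
    then show "indicator {0<..} r * ennreal (r ^ (DIM('a) - 1)) * f r = ennreal (u r)"
      using q_nonneg[of r] \<rho> by (auto simp: f_def u_def indicator_def n_DIM ennreal_mult[symmetric] mult_ac)
  qed
  also have "\<dots> = ennreal (\<rho> powr s * A0 \<rho>)"
    unfolding A[symmetric] using u abel_q(1)[OF \<rho>0] by (intro nn_integral_eq_integral) (auto simp: u_def)
  finally show "(\<integral>\<^sup>+x. ennreal (q (norm x)) * ennreal (ball_density lam \<rho> x) \<partial>(lborel :: 'a measure)) =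
      ennreal (sphere_area n * (\<rho> powr s * A0 \<rho>))"
    using A_nonneg sphere_area_pos[of n] n2 by (simp add: n_DIM ennreal_mult less_imp_le)
qed

abbreviation "Upos \<equiv> mix_potential s lam R (\<lambda>\<rho>. ennreal (b \<rho>)) :: 'a \<Rightarrow> ennreal"
abbreviation "Uneg \<equiv> mix_potential s lam R (\<lambda>\<rho>. ennreal (- b \<rho>)) :: 'a \<Rightarrow> ennreal"

text \<open>The identity \<open>Upos - Uneg + q = C * W\<close> tested against a ball density. In
  \<open>ennreal\<close> the negative terms move to the other side, and \<open>C * W\<close> is
  split into its two parts by \<open>max 0\<close>.\<close>

lemma integral_ball_density_eq:
  assumes \<rho>: "\<rho> \<in> {0<..R}"
  shows "(\<integral>\<^sup>+x. (Upos x + ennreal (q (norm x)) + ennreal (max 0 (- (C * W)))) * ennreal (ball_density lam \<rho> x) \<partial>lborel) =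
    (\<integral>\<^sup>+x. (Uneg x + ennreal (max 0 (C * W))) * ennreal (ball_density lam \<rho> x) \<partial>lborel)"
proof -
  define k where "k = (\<lambda>r. W * m * min r \<rho> powr s)"
  have k: "k r \<ge> 0" for r using W_m_nonneg by (simp add: k_def)
  define p where "p = enn2real (\<integral>\<^sup>+r. ennreal (b r) * ennreal (k r) \<partial>lborel)"
  define p' where "p' = enn2real (\<integral>\<^sup>+r. ennreal (- b r) * ennreal (k r) \<partial>lborel)"
  have int: "integrable lborel (\<lambda>r. b r * k r)" unfolding k_def by (rule integral_b_min(1)[OF \<rho>])
  note B = nn_integral_b[OF int k]
  have pp: "p - p' = C * W * m * \<rho> powr s - sphere_area n * (\<rho> powr s * A0 \<rho>)"
    unfolding p_def p'_def using B(3) integral_b_min(2)[OF \<rho>] by (simp add: k_def)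
  have p0: "p \<ge> 0" "p' \<ge> 0" by (simp_all add: p_def p'_def)
  have kD: "k r = ball_const DIM('a) lam * mass_const DIM('a) lam * min r \<rho> powr s" for r
    by (simp add: k_def W_def m_def flip: n_DIM)
  have P: "(\<integral>\<^sup>+x. Upos x * ennreal (ball_density lam \<rho> x) \<partial>lborel) = ennreal p"
    unfolding p_def using pos.mix_potential_ball_density[OF \<rho>, folded kD] B(1) by (simp add: less_top)
  have P': "(\<integral>\<^sup>+x. Uneg x * ennreal (ball_density lam \<rho> x) \<partial>lborel) = ennreal p'"
    unfolding p'_def using neg.mix_potential_ball_density[OF \<rho>, folded kD] B(2) by (simp add: less_top)
  have const: "(\<integral>\<^sup>+x. ennreal c * ennreal (ball_density lam \<rho> x) \<partial>(lborel :: 'a measure)) = ennreal (c * (m * \<rho> powr s))" if "c \<ge> 0" for c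
  proof -
    have "(\<integral>\<^sup>+x. ennreal c * ennreal (ball_density lam \<rho> x) \<partial>(lborel :: 'a measure)) = ennreal c * ennreal (m * \<rho> powr s)"
      using nn_integral_ball_density[OF lam(1) s_DIM, of \<rho>] \<rho> by (simp add: nn_integral_cmult m_def flip: n_DIM)
    then show ?thesis using that by (simp add: ennreal_mult')
  qed
  let ?a = "sphere_area n * (\<rho> powr s * A0 \<rho>)"
  have a0: "?a \<ge> 0" using nn_integral_q_ball_density(2)[OF \<rho>] sphere_area_pos[of n] n2 by simp
  have m0: "m * \<rho> powr s \<ge> 0" using W_m_nonneg by simp
  have "(\<integral>\<^sup>+x. (Upos x + ennreal (q (norm x)) + ennreal (max 0 (- (C * W)))) * ennreal (ball_density lam \<rho> x) \<partial>lborel) =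
      (\<integral>\<^sup>+x. Upos x * ennreal (ball_density lam \<rho> x) \<partial>lborel) + (\<integral>\<^sup>+x. ennreal (q (norm x)) * ennreal (ball_density lam \<rho> x) \<partial>(lborel :: 'a measure)) +
      (\<integral>\<^sup>+x. ennreal (max 0 (- (C * W))) * ennreal (ball_density lam \<rho> x) \<partial>(lborel :: 'a measure))"
    unfolding distrib_right by (subst nn_integral_add, simp, simp, subst nn_integral_add, simp_all)
  also have "\<dots> = ennreal (p + ?a + max 0 (- (C * W)) * (m * \<rho> powr s))"
    unfolding P nn_integral_q_ball_density(1)[OF \<rho>] using p0 a0 m0
    by (subst const) (simp_all add: ennreal_plus[symmetric] del: ennreal_plus)
  also have "p + ?a + max 0 (- (C * W)) * (m * \<rho> powr s) = p' + max 0 (C * W) * (m * \<rho> powr s)"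
  proof -
    have "p + ?a = p' + C * W * (m * \<rho> powr s)" using pp by (simp add: algebra_simps)
    moreover have "max 0 (C * W) = C * W + max 0 (- (C * W))" by (simp add: max_def)
    ultimately show ?thesis by (simp only: distrib_right)
  qed
  also have "ennreal (p' + max 0 (C * W) * (m * \<rho> powr s)) = (\<integral>\<^sup>+x. Uneg x * ennreal (ball_density lam \<rho> x) \<partial>lborel) +
      (\<integral>\<^sup>+x. ennreal (max 0 (C * W)) * ennreal (ball_density lam \<rho> x) \<partial>(lborel :: 'a measure))"
    unfolding P' using p0 m0 by (subst const) (simp_all add: ennreal_plus[symmetric] del: ennreal_plus)
  also have "\<dots> = (\<integral>\<^sup>+x. (Uneg x + ennreal (max 0 (C * W))) * ennreal (ball_density lam \<rho> x) \<partial>lborel)"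
    unfolding distrib_right by (rule nn_integral_add[symmetric]) simp_all
  finally show ?thesis .
qed

text \<open>Abel inversion turns the tested identity into equal integrals over all centred balls,
  and continuity of the radial profiles makes it pointwise. It is wanted at every point, because it
  will be integrated against the extremal measure, whose absolute continuity is not known
  yet.\<close>

lemma potential_eq:
  fixes x :: 'a
  assumes x: "norm x \<le> R"
  shows "enn2real (Upos x) + q (norm x) = enn2real (Uneg x) + C * W"
proof -
  obtain e :: 'a where e: "norm e = 1" using vector_choose_size[of 1] by auto
  define \<phi> where "\<phi> = (\<lambda>r. enn2real (Upos (r *\<^sub>R e)) + q r + max 0 (- (C * W)))"
  define \<psi> where "\<psi> = (\<lambda>r. enn2real (Uneg (r *\<^sub>R e)) + max 0 (C * W))"
  have [measurable]: "\<phi> \<in> borel_measurable borel" "\<psi> \<in> borel_measurable borel"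
    unfolding \<phi>_def \<psi>_def by measurable
  have U: "Upos y = ennreal (enn2real (Upos (norm y *\<^sub>R e)))" "Uneg y = ennreal (enn2real (Uneg (norm y *\<^sub>R e)))" for y
  proof -
    have "Upos y = Upos (norm y *\<^sub>R e)" by (rule pos.mix_potential_norm_cong) (simp add: e)
    then show "Upos y = ennreal (enn2real (Upos (norm y *\<^sub>R e)))" using pos.mix_potential_less_top by simp
    have "Uneg y = Uneg (norm y *\<^sub>R e)" by (rule neg.mix_potential_norm_cong) (simp add: e)
    then show "Uneg y = ennreal (enn2real (Uneg (norm y *\<^sub>R e)))" using neg.mix_potential_less_top by simp
  qed
  have \<phi>: "Upos y + ennreal (q (norm y)) + ennreal (max 0 (- (C * W))) = ennreal (\<phi> (norm y))" if "norm y \<le> R" for y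
    unfolding U[of y] \<phi>_def using q_nonneg[of "norm y"] that by (simp add: ennreal_plus)
  have \<psi>: "Uneg y + ennreal (max 0 (C * W)) = ennreal (\<psi> (norm y))" for y
    unfolding U[of y] \<psi>_def by (simp add: ennreal_plus)
  have "\<phi> (norm x) = \<psi> (norm x)"
  proof (rule radial_eqI[OF R, where 'a='a and \<phi>=\<phi> and \<psi>=\<psi>])
    show "continuous_on {0..R} \<phi>" "continuous_on {0..R} \<psi>"
      unfolding \<phi>_def \<psi>_def
      by (intro continuous_intros pos.mix_potential_continuous neg.mix_potential_continuous e continuous_on_subset[OF contq(1)] subset_UNIV)+
    show "\<phi> r \<ge> 0" "\<psi> r \<ge> 0" if "r \<in> {0..R}" for r
      using q_nonneg[OF that] by (auto simp: \<phi>_def \<psi>_def intro!: add_nonneg_nonneg)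
    fix r assume r: "r \<in> {0<..R}"
    have "(\<integral>\<^sup>+x. ennreal (\<phi> (norm x)) * indicator (ball 0 r) x \<partial>(lborel :: 'a measure)) =
       (\<integral>\<^sup>+x. (Upos x + ennreal (q (norm x)) + ennreal (max 0 (- (C * W)))) * indicator (ball 0 r) x \<partial>lborel)"
    proof (rule nn_integral_cong)
      fix x :: 'a
      show "ennreal (\<phi> (norm x)) * indicator (ball 0 r) x = (Upos x + ennreal (q (norm x)) + ennreal (max 0 (- (C * W)))) * indicator (ball 0 r) x"
        using \<phi>[of x] r by (cases "x \<in> ball 0 r") auto
    qed
    also have "\<dots> = (\<integral>\<^sup>+x. (Uneg x + ennreal (max 0 (C * W))) * indicator (ball 0 r) x \<partial>lborel)"
      by (rule nn_integral_ball_eqI[OF lam _ _ integral_ball_density_eq r]) measurable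
    also have "\<dots> = (\<integral>\<^sup>+x. ennreal (\<psi> (norm x)) * indicator (ball 0 r) x \<partial>(lborel :: 'a measure))"
      by (simp only: \<psi>)
    finally show "(\<integral>\<^sup>+x. ennreal (\<phi> (norm x)) * indicator (ball 0 r) x \<partial>(lborel :: 'a measure)) =
      (\<integral>\<^sup>+x. ennreal (\<psi> (norm x)) * indicator (ball 0 r) x \<partial>(lborel :: 'a measure))" .
  qed (use x in auto)
  moreover have "enn2real (Upos (norm x *\<^sub>R e)) = enn2real (Upos x)"  "enn2real (Uneg (norm x *\<^sub>R e)) = enn2real (Uneg x)"
    using U[of x] by (metis enn2real_ennreal enn2real_nonneg)+
  moreover have "max 0 (C * W) - max 0 (- (C * W)) = C * W" by (simp add: max_def)
  ultimately show ?thesis by (simp add: \<phi>_def \<psi>_def)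
qed

lemma integrable_Nt:
  assumes x: "x \<in> {0<..<R}"
  shows "integrable lborel (\<lambda>r. indicator {x<..<R} r * (gh' r * (r\<^sup>2 - x\<^sup>2) powr (lam - 1)))"
proof -
  obtain B where B: "B \<ge> 0" "\<And>x. x \<in> {0..R} \<Longrightarrow> \<bar>gh' x\<bar> \<le> B" by (rule gh'_bounded) blast
  have "integrable lborel (\<lambda>v. indicator {0<..<R - x} v * v powr (lam - 1) :: real)"
    using x lam by (intro integrable_powr_from_0) auto
  then have "integrable lborel (\<lambda>r. indicator {0<..<R - x} (- x + 1 * r) * (- x + 1 * r) powr (lam - 1) :: real)"
    by (subst lborel_integrable_real_affine_iff) auto
  then have int: "integrable lborel (\<lambda>r. B * x powr (lam - 1) * (indicator {0<..<R - x} (- x + 1 * r) * (- x + 1 * r) powr (lam - 1)))"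
    by simp
  show ?thesis
  proof (rule Bochner_Integration.integrable_bound[OF int], simp, intro AE_I2)
    fix r :: real
    show "norm (indicator {x<..<R} r * (gh' r * (r\<^sup>2 - x\<^sup>2) powr (lam - 1))) \<le>
      norm (B * x powr (lam - 1) * (indicator {0<..<R - x} (- x + 1 * r) * (- x + 1 * r) powr (lam - 1)))"
    proof (cases "r \<in> {x<..<R}")
      case True
      have "x * (r - x) \<le> (r + x) * (r - x)" using True x by (intro mult_right_mono) auto
      also have "\<dots> = r\<^sup>2 - x\<^sup>2" by (simp add: power2_eq_square algebra_simps)
      finally have "(r\<^sup>2 - x\<^sup>2) powr (lam - 1) \<le> (x * (r - x)) powr (lam - 1)"
        using True x lam by (intro powr_mono2') auto
      then have "\<bar>gh' r\<bar> * (r\<^sup>2 - x\<^sup>2) powr (lam - 1) \<le> B * (x * (r - x)) powr (lam - 1)"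
        using True x B by (intro mult_mono B) auto
      then show ?thesis using True x B(1) by (simp add: abs_mult powr_mult mult_ac)
    qed simp
  qed
qed

text \<open>The weight on \<open>(0, R)\<close> contributes \<open>K * Nt\<close>, and the atom at
  \<open>R\<close> contributes the density of the full ball with factor
  \<open>C - K * gh R\<close>.\<close>

lemma mix_density_eq:
  fixes y :: 'a
  assumes y: "norm y \<in> {0<..<R}"
  shows "mix_density lam R (\<lambda>\<rho>. ennreal (b \<rho>)) y < top" "mix_density lam R (\<lambda>\<rho>. ennreal (- b \<rho>)) y < top"
    and "enn2real (mix_density lam R (\<lambda>\<rho>. ennreal (b \<rho>)) y) - enn2real (mix_density lam R (\<lambda>\<rho>. ennreal (- b \<rho>)) y) =
      C * (R\<^sup>2 - (norm y)\<^sup>2) powr (lam - 1) + K * (Nt (norm y) - gh R * (R\<^sup>2 - (norm y)\<^sup>2) powr (lam - 1))"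
proof -
  define k where "k = (\<lambda>\<rho>. ball_density lam (min R \<rho>) y)"
  define w where "w = (R\<^sup>2 - (norm y)\<^sup>2) powr (lam - 1)"
  have eq: "b \<rho> * k \<rho> = K * (indicator {norm y<..<R} \<rho> * (gh' \<rho> * (\<rho>\<^sup>2 - (norm y)\<^sup>2) powr (lam - 1))) + (C - K * gh R) * w * indicator {R..<R + 1} \<rho>" for \<rho>
  proof -
    have "\<rho> > 0" if "norm y < \<rho>" using that norm_ge_zero[of y] by linarith
    then show ?thesis using y R by (auto simp: b_def k_def w_def ball_density_def indicator_def min_def)
  qed
  have int: "integrable lborel (\<lambda>\<rho>. b \<rho> * k \<rho>)"
    unfolding eq using integrable_Nt[OF y] by simp
  have val: "(\<integral>\<rho>. b \<rho> * k \<rho> \<partial>lborel) = K * Nt (norm y) + (C - K * gh R) * w"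
    unfolding eq using integrable_Nt[OF y] by (simp add: Nt_def)
  have "k \<rho> \<ge> 0" for \<rho> by (simp add: k_def)
  note B = nn_integral_b[OF int this]
  show "mix_density lam R (\<lambda>\<rho>. ennreal (b \<rho>)) y < top" "mix_density lam R (\<lambda>\<rho>. ennreal (- b \<rho>)) y < top"
    using B(1,2) by (simp_all add: mix_density_def k_def)
  show "enn2real (mix_density lam R (\<lambda>\<rho>. ennreal (b \<rho>)) y) - enn2real (mix_density lam R (\<lambda>\<rho>. ennreal (- b \<rho>)) y) =
      C * (R\<^sup>2 - (norm y)\<^sup>2) powr (lam - 1) + K * (Nt (norm y) - gh R * (R\<^sup>2 - (norm y)\<^sup>2) powr (lam - 1))"
    using B(3) unfolding val by (simp add: mix_density_def k_def w_def algebra_simps)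
qed

end

section \<open>Variational conditions\<close>

definition add_measure :: "'b measure \<Rightarrow> 'b measure \<Rightarrow> 'b measure" where
  "add_measure M N = measure_of (space M) (sets M) (\<lambda>A. emeasure M A + emeasure N A)"

lemma sets_add_measure [simp, measurable_cong]: "sets (add_measure M N) = sets M"
  and space_add_measure [simp]: "space (add_measure M N) = space M"
  by (simp_all add: add_measure_def)

lemma emeasure_add_measure:
  assumes "sets N = sets M" "A \<in> sets M"
  shows "emeasure (add_measure M N) A = emeasure M A + emeasure N A"
proof (rule emeasure_measure_of[OF add_measure_def])
  show "sets M \<subseteq> Pow (space M)" by (rule sets.space_closed)
  show "positive (sets (add_measure M N)) (\<lambda>A. emeasure M A + emeasure N A)"
    by (simp add: positive_def)
  show "countably_additive (sets (add_measure M N)) (\<lambda>A. emeasure M A + emeasure N A)"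
  proof (rule countably_additiveI)
    fix A :: "nat \<Rightarrow> 'a set" assume A: "range A \<subseteq> sets (add_measure M N)" "disjoint_family A"
    then have "(\<Sum>i. emeasure M (A i)) = emeasure M (\<Union>i. A i)" "(\<Sum>i. emeasure N (A i)) = emeasure N (\<Union>i. A i)"
      using assms by (auto intro!: suminf_emeasure)
    then show "(\<Sum>i. emeasure M (A i) + emeasure N (A i)) = emeasure M (\<Union>i. A i) + emeasure N (\<Union>i. A i)"
      by (subst suminf_add[symmetric]) auto
  qed
qed (use assms in simp)

lemma nn_integral_add_measure:
  assumes f: "f \<in> borel_measurable M" and N: "sets N = sets M"
  shows "(\<integral>\<^sup>+x. f x \<partial>add_measure M N) = (\<integral>\<^sup>+x. f x \<partial>M) + (\<integral>\<^sup>+x. f x \<partial>N)"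
  using f
proof induction
  case (cong f g)
  have "space N = space M" by (rule sets_eq_imp_space_eq[OF N])
  then show ?case using cong
    by (metis (no_types, lifting) nn_integral_cong space_add_measure)
next
  case (set A)
  then show ?case using N by (simp add: emeasure_add_measure)
next
  case (mult u c)
  then have "u \<in> borel_measurable N" "u \<in> borel_measurable (add_measure M N)"
    using N by (simp_all cong: measurable_cong_sets)
  with mult show ?case by (simp add: nn_integral_cmult distrib_left)
next
  case (add u v)
  then have "u \<in> borel_measurable N" "u \<in> borel_measurable (add_measure M N)"
    "v \<in> borel_measurable N" "v \<in> borel_measurable (add_measure M N)"
    using N by (simp_all cong: measurable_cong_sets)
  with add show ?case by (simp add: nn_integral_add add_ac)
next
  case (seq U)
  have incU: "incseq U" and mU: "U i \<in> borel_measurable M"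
    and IH: "integral\<^sup>N (add_measure M N) (U i) = integral\<^sup>N M (U i) + integral\<^sup>N N (U i)" for i
    using seq by auto
  have m: "U i \<in> borel_measurable N" "U i \<in> borel_measurable (add_measure M N)" for i
    using N mU by (simp_all cong: measurable_cong_sets)
  have inc: "incseq (\<lambda>i. integral\<^sup>N K (U i))" for K
    using incU by (auto simp: incseq_def le_fun_def intro!: nn_integral_mono)
  have mct: "(\<integral>\<^sup>+x. Sup (range U) x \<partial>K) = (SUP i. integral\<^sup>N K (U i))" if "\<And>i. U i \<in> borel_measurable K" for K
    using nn_integral_monotone_convergence_SUP[OF incU that] by (simp add: image_comp)
  show ?case
    using inc by (simp only: mct m mU IH ennreal_SUP_add)
qed

lemma finite_measure_add_measure:
  assumes "finite_measure M" "finite_measure N" "sets N = sets M"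
  shows "finite_measure (add_measure M N)"
proof (rule finite_measureI)
  have "space N = space M" using assms(3) by (rule sets_eq_imp_space_eq)
  then show "emeasure (add_measure M N) (space (add_measure M N)) \<noteq> \<infinity>"
    using assms by (simp add: emeasure_add_measure finite_measure.emeasure_finite[of N] finite_measure.emeasure_finite[of M])
qed

lemma finite_measure_imp_sigma_finite: "finite_measure M \<Longrightarrow> sigma_finite_measure M"
  by (simp add: finite_measure_def)

lemma riesz_potential_measurable:
  fixes N :: "'a::euclidean_space measure"
  assumes "sigma_finite_measure N" and [measurable_cong]: "sets N = sets borel"
  shows "(\<lambda>x. \<integral>\<^sup>+y. riesz_kernel s x y \<partial>N) \<in> borel_measurable borel"
proof -
  interpret sigma_finite_measure N by fact
  show ?thesis by measurable
qed

lemma mutual_energy_commute: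
  fixes M N :: "'a::euclidean_space measure"
  assumes "sigma_finite_measure M" and [measurable_cong]: "sets M = sets borel"
    and "sigma_finite_measure N" and [measurable_cong]: "sets N = sets borel"
  shows "mutual_energy s M N = mutual_energy s N M"
proof -
  interpret M: sigma_finite_measure M by fact
  interpret N: sigma_finite_measure N by fact
  interpret pair_sigma_finite M N ..
  have "mutual_energy s M N = (\<integral>\<^sup>+y. \<integral>\<^sup>+x. riesz_kernel s x y \<partial>M \<partial>N)"
    unfolding mutual_energy_def by (rule Fubini'[symmetric]) measurable
  also have "\<dots> = mutual_energy s N M"
    unfolding mutual_energy_def by (subst riesz_kernel_commute) (rule refl)
  finally show ?thesis .
qed

lemma mutual_energy_add_left:
  fixes M N K :: "'a::euclidean_space measure"
  assumes M: "sets M = sets borel" and N: "sets N = sets borel"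
    and K: "sigma_finite_measure K" "sets K = sets borel"
  shows "mutual_energy s (add_measure M N) K = mutual_energy s M K + mutual_energy s N K"
  unfolding mutual_energy_def using riesz_potential_measurable[OF K, of s] M N
  by (intro nn_integral_add_measure) (simp_all cong: measurable_cong_sets)

lemma mutual_energy_add_right:
  fixes M N K :: "'a::euclidean_space measure"
  assumes M: "finite_measure M" "sets M = sets borel" and N: "finite_measure N" "sets N = sets borel"
    and K: "finite_measure K" "sets K = sets borel"
  shows "mutual_energy s K (add_measure M N) = mutual_energy s K M + mutual_energy s K N"
proof -
  have "mutual_energy s K (add_measure M N) = mutual_energy s (add_measure M N) K"
    using assms by (intro mutual_energy_commute finite_measure_imp_sigma_finite finite_measure_add_measure) auto
  also have "\<dots> = mutual_energy s M K + mutual_energy s N K"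
    using assms by (intro mutual_energy_add_left finite_measure_imp_sigma_finite) auto
  also have "\<dots> = mutual_energy s K M + mutual_energy s K N"
    using assms by (intro arg_cong2[where f="(+)"] mutual_energy_commute finite_measure_imp_sigma_finite) auto
  finally show ?thesis .
qed

lemma mutual_energy_scale_left:
  fixes M K :: "'a::euclidean_space measure"
  assumes M: "sets M = sets borel" and K: "sigma_finite_measure K" "sets K = sets borel"
  shows "mutual_energy s (scale_measure r M) K = r * mutual_energy s M K"
  unfolding mutual_energy_def using riesz_potential_measurable[OF K, of s] M
  by (intro nn_integral_scale_measure) (simp_all cong: measurable_cong_sets)

lemma finite_measure_scale_measure:
  assumes "finite_measure M"
  shows "finite_measure (scale_measure (ennreal r) M)"
  using assms finite_measure.emeasure_finite[OF assms]
  by (intro finite_measureI) (simp add: space_scale_measure ennreal_mult_eq_top_iff)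

text \<open>First-order condition for a minimum at \<open>t = 0\<close>: for small \<open>t\<close>
  the quadratic term cannot compensate a negative linear one.\<close>

lemma nonneg_of_quadratic:
  fixes A B :: real
  assumes "\<And>t. 0 < t \<Longrightarrow> t < 1 \<Longrightarrow> 0 \<le> 2 * t * A + t\<^sup>2 * B"
  shows "A \<ge> 0"
proof (rule ccontr)
  assume A: "\<not> A \<ge> 0"
  define t where "t = min (1/2) (- A / (\<bar>B\<bar> + 1))"
  have "A / (\<bar>B\<bar> + 1) < 0" using A by (intro divide_neg_pos) auto
  then have t: "0 < t" "t < 1" by (auto simp: t_def)
  have "t \<le> - A / (\<bar>B\<bar> + 1)" by (simp add: t_def)
  then have "t * (\<bar>B\<bar> + 1) \<le> - A" by (subst (asm) pos_le_divide_eq) auto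
  moreover have "t * B \<le> t * (\<bar>B\<bar> + 1)" using t by (intro mult_left_mono) auto
  ultimately have "2 * A + t * B < 0" using A by linarith
  then have "t * (2 * A + t * B) < 0" using t by (simp add: mult_pos_neg)
  then show False using assms[OF t] by (simp add: algebra_simps power2_eq_square)
qed

text \<open>The extremal problem carried over to \<open>'a\<close>, which is identified with the
  hyperplane of the disk. Competitors are unit measures on the ball of radius \<open>R\<close>, and
  \<open>M_supp\<close> says that the whole ball belongs to the support of \<open>M\<close>.\<close>

locale equilibrium =
  fixes R s :: real and Q :: "'a::euclidean_space \<Rightarrow> real" and M :: "'a measure"
  assumes s_pos: "s > 0" and Q_cont: "continuous_on UNIV Q" and Q_nonneg: "\<And>x. norm x \<le> R \<Longrightarrow> Q x \<ge> 0"
    and sets_M: "sets M = sets borel" and M1: "emeasure M UNIV = 1"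
    and M_conc: "AE x in M. norm x \<le> R" and M_fin: "mutual_energy s M M < top"
    and minimal: "\<And>N :: 'a measure. sets N = sets borel \<Longrightarrow> emeasure N UNIV = 1 \<Longrightarrow> AE x in N. norm x \<le> R \<Longrightarrow>
       mutual_energy s N N < top \<Longrightarrow>
       mutual_energy s M M + 2 * (\<integral>\<^sup>+x. ennreal (Q x) \<partial>M) \<le> mutual_energy s N N + 2 * (\<integral>\<^sup>+x. ennreal (Q x) \<partial>N)"
    and M_supp: "\<And>x U. norm x \<le> R \<Longrightarrow> open U \<Longrightarrow> x \<in> U \<Longrightarrow> emeasure M U > 0"
begin

lemma Q_measurable [measurable]: "Q \<in> borel_measurable borel"
  using Q_cont by (rule borel_measurable_continuous_onI)

lemma finite_M: "finite_measure M"
  using M1 sets_eq_imp_space_eq[OF sets_M] by (intro finite_measureI) simp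

definition "U x = (\<integral>\<^sup>+y. riesz_kernel s x y \<partial>M)"

lemma U_measurable [measurable]: "U \<in> borel_measurable borel"
  unfolding U_def by (rule riesz_potential_measurable[OF finite_measure_imp_sigma_finite[OF finite_M] sets_M])

lemma Q_bounded: obtains B where "B \<ge> 0" "\<And>x. norm x \<le> R \<Longrightarrow> Q x \<le> B"
proof -
  have "bounded (Q ` cball 0 R)"
    by (intro compact_imp_bounded compact_continuous_image continuous_on_subset[OF Q_cont]) auto
  then obtain B where B: "\<forall>x\<in>cball 0 R. \<bar>Q x\<bar> \<le> B" by (auto simp: bounded_iff)
  have "Q x \<le> max B 0" if "norm x \<le> R" for x
    using bspec[OF B, of x] that by (auto simp: max_def)
  then show ?thesis using that[of "max B 0"] by simp
qed

lemma Q_integral_finite: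
  assumes "sets N = sets borel" "emeasure N UNIV = 1" "AE x in N. norm x \<le> R"
  shows "(\<integral>\<^sup>+x. ennreal (Q x) \<partial>N) < top"
proof -
  obtain B where B: "B \<ge> 0" "\<And>x. norm x \<le> R \<Longrightarrow> Q x \<le> B" by (rule Q_bounded) blast
  have "(\<integral>\<^sup>+x. ennreal (Q x) \<partial>N) \<le> (\<integral>\<^sup>+x. ennreal B \<partial>N)"
    using assms(3) by (intro nn_integral_mono_AE) (auto elim!: eventually_mono intro!: ennreal_leI B)
  also have "\<dots> < top" using assms(2) sets_eq_imp_space_eq[OF assms(1)] by simp
  finally show ?thesis .
qed

definition "I = enn2real (mutual_energy s M M)"
definition "q0 = enn2real (\<integral>\<^sup>+x. ennreal (Q x) \<partial>M)"
text \<open>The equilibrium constant. It is the integral of \<open>U + Q\<close> against the unit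
  measure \<open>M\<close>, hence the only value \<open>U + Q\<close> could take if it is constant
  \<open>M\<close>-almost everywhere.\<close>

definition "c = I + q0"

lemma I_q0: "mutual_energy s M M = ennreal I" "(\<integral>\<^sup>+x. ennreal (Q x) \<partial>M) = ennreal q0" "I \<ge> 0" "q0 \<ge> 0"
  using M_fin Q_integral_finite[OF sets_M M1 M_conc] by (auto simp: I_def q0_def less_top)

text \<open>Compares \<open>M\<close> with the convex combinations of weights \<open>1 - t\<close>
  and \<open>t\<close> of \<open>M\<close> and \<open>N\<close>. The weighted energy is a quadratic
  polynomial in \<open>t\<close>, and minimality makes its derivative at 0 nonnegative.\<close>

lemma variation:
  assumes N: "sets N = sets borel" "emeasure N UNIV = 1" "AE x in N. norm x \<le> R" and N_fin: "mutual_energy s N N < top"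
  shows "ennreal c \<le> (\<integral>\<^sup>+x. U x + ennreal (Q x) \<partial>N)"
proof -
  have fN: "finite_measure N" using N(2) sets_eq_imp_space_eq[OF N(1)] by (intro finite_measureI) simp
  have UN: "(\<integral>\<^sup>+x. U x + ennreal (Q x) \<partial>N) = mutual_energy s N M + (\<integral>\<^sup>+x. ennreal (Q x) \<partial>N)"
    unfolding mutual_energy_def U_def[symmetric]
    by (rule nn_integral_add) (simp_all add: measurable_cong_sets[OF N(1) refl])
  show ?thesis
  proof (cases "mutual_energy s N M = top")
    case True
    then show ?thesis unfolding UN by simp
  next
    case False
    define j where "j = enn2real (mutual_energy s N M)"
    define k where "k = enn2real (mutual_energy s N N)"
    define r where "r = enn2real (\<integral>\<^sup>+x. ennreal (Q x) \<partial>N)"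
    have j: "mutual_energy s N M = ennreal j" "j \<ge> 0" using False by (auto simp: j_def less_top)
    have k: "mutual_energy s N N = ennreal k" "k \<ge> 0" using N_fin by (auto simp: k_def less_top)
    have r: "(\<integral>\<^sup>+x. ennreal (Q x) \<partial>N) = ennreal r" "r \<ge> 0"
      using Q_integral_finite[OF N] by (auto simp: r_def less_top)
    have j': "mutual_energy s M N = ennreal j"
      unfolding j(1)[symmetric] by (intro mutual_energy_commute finite_measure_imp_sigma_finite finite_M fN sets_M N)
    \<comment> \<open>The right side is the excess of the weighted energy of the combination over
      that of \<open>M\<close>.\<close>
    have "0 \<le> 2 * t * (j + r - c) + t\<^sup>2 * (I - 2 * j + k)" if t: "0 < t" "t < 1" for t
    proof -
      define M' where "M' = scale_measure (ennreal (1 - t)) M"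
      define N' where "N' = scale_measure (ennreal t) N"
      define P where "P = add_measure M' N'"
      have fin: "finite_measure M'" "finite_measure N'"
        unfolding M'_def N'_def by (intro finite_measure_scale_measure finite_M fN)+
      have sets: "sets M' = sets borel" "sets N' = sets borel" "sets P = sets borel" by (simp_all add: M'_def N'_def P_def sets_M N)
      have sf: "sigma_finite_measure M" "sigma_finite_measure N" "sigma_finite_measure M'" "sigma_finite_measure N'"
        using fin finite_M fN by (auto intro: finite_measure_imp_sigma_finite)
      have fP: "finite_measure P" unfolding P_def using fin sets by (intro finite_measure_add_measure) auto
      have P1: "emeasure P UNIV = 1"
        using t sets by (simp add: P_def emeasure_add_measure) (simp add: M'_def N'_def M1 N(2) ennreal_plus[symmetric] del: ennreal_plus)
      have Pc: "AE x in P. norm x \<le> R"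
      proof -
        have 0: "{x \<in> space borel. \<not> norm x \<le> R} \<in> sets (borel :: 'a measure)" by measurable
        have "emeasure M {x. \<not> norm x \<le> R} = 0"
          using M_conc by (subst (asm) AE_iff_measurable[OF _ refl]) (use 0 in \<open>auto simp: sets_M sets_eq_imp_space_eq[OF sets_M]\<close>)
        moreover have "emeasure N {x. \<not> norm x \<le> R} = 0"
          using N(3) by (subst (asm) AE_iff_measurable[OF _ refl]) (use 0 in \<open>auto simp: N(1) sets_eq_imp_space_eq[OF N(1)]\<close>)
        ultimately have "emeasure P {x. \<not> norm x \<le> R} = 0"
          using 0 sets by (simp add: P_def emeasure_add_measure) (simp add: M'_def N'_def)
        then show ?thesis
          by (subst AE_iff_measurable[OF _ refl]) (use 0 in \<open>auto simp: sets sets_eq_imp_space_eq[OF sets(3)]\<close>)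
      qed
      have "mutual_energy s P P = mutual_energy s M' P + mutual_energy s N' P"
        unfolding P_def by (intro mutual_energy_add_left sets finite_measure_imp_sigma_finite fP[unfolded P_def]) (simp add: sets)
      also have "mutual_energy s M' P = ennreal (1 - t) * mutual_energy s M P"
        unfolding M'_def by (intro mutual_energy_scale_left sets_M finite_measure_imp_sigma_finite fP sets)
      also have "mutual_energy s N' P = ennreal t * mutual_energy s N P"
        unfolding N'_def by (intro mutual_energy_scale_left N finite_measure_imp_sigma_finite fP sets)
      also have "mutual_energy s M P = mutual_energy s M M' + mutual_energy s M N'"
        unfolding P_def by (intro mutual_energy_add_right fin sets finite_M sets_M)
      also have "mutual_energy s N P = mutual_energy s N M' + mutual_energy s N N'"
        unfolding P_def by (intro mutual_energy_add_right fin sets fN N)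
      also have "mutual_energy s M M' = ennreal (1 - t) * mutual_energy s M M"
        by (rule trans[OF mutual_energy_commute[OF sf(1) sets_M sf(3) sets(1)]
              mutual_energy_scale_left[OF sets_M sf(1) sets_M, of s "ennreal (1 - t)", folded M'_def]])
      also have "mutual_energy s N M' = ennreal (1 - t) * mutual_energy s M N"
        by (rule trans[OF mutual_energy_commute[OF sf(2) N(1) sf(3) sets(1)]
              mutual_energy_scale_left[OF sets_M sf(2) N(1), of s "ennreal (1 - t)", folded M'_def]])
      also have "mutual_energy s M N' = ennreal t * mutual_energy s N M"
        by (rule trans[OF mutual_energy_commute[OF sf(1) sets_M sf(4) sets(2)]
              mutual_energy_scale_left[OF N(1) sf(1) sets_M, of s "ennreal t", folded N'_def]])
      also have "mutual_energy s N N' = ennreal t * mutual_energy s N N"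
        by (rule trans[OF mutual_energy_commute[OF sf(2) N(1) sf(4) sets(2)]
              mutual_energy_scale_left[OF N(1) sf(2) N(1), of s "ennreal t", folded N'_def]])
      also have "ennreal (1 - t) * (ennreal (1 - t) * mutual_energy s M M + ennreal t * mutual_energy s N M) +
          ennreal t * (ennreal (1 - t) * mutual_energy s M N + ennreal t * mutual_energy s N N) =
          ennreal ((1 - t) * ((1 - t) * I + t * j) + t * ((1 - t) * j + t * k))"
        unfolding I_q0 j j' k using t I_q0 j k by (simp add: ennreal_mult ennreal_plus)
      finally have EP: "mutual_energy s P P = ennreal ((1 - t) * ((1 - t) * I + t * j) + t * ((1 - t) * j + t * k))" .
      have "(\<integral>\<^sup>+x. ennreal (Q x) \<partial>P) = (\<integral>\<^sup>+x. ennreal (Q x) \<partial>M') + (\<integral>\<^sup>+x. ennreal (Q x) \<partial>N')"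
        unfolding P_def by (rule nn_integral_add_measure) (simp_all add: sets measurable_cong_sets[OF sets(1) refl])
      also have "\<dots> = ennreal ((1 - t) * q0 + t * r)"
        unfolding M'_def N'_def using t I_q0 r
        by (subst (1 2) nn_integral_scale_measure)
          (simp_all add: measurable_cong_sets[OF sets_M refl] measurable_cong_sets[OF N(1) refl] ennreal_mult ennreal_plus)
      finally have QP: "(\<integral>\<^sup>+x. ennreal (Q x) \<partial>P) = ennreal ((1 - t) * q0 + t * r)" .
      have "mutual_energy s M M + 2 * (\<integral>\<^sup>+x. ennreal (Q x) \<partial>M) \<le> mutual_energy s P P + 2 * (\<integral>\<^sup>+x. ennreal (Q x) \<partial>P)"
        by (rule minimal) (use sets P1 Pc EP in auto)
      then have "ennreal (I + 2 * q0) \<le> ennreal ((1 - t) * ((1 - t) * I + t * j) + t * ((1 - t) * j + t * k) + 2 * ((1 - t) * q0 + t * r))"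
        unfolding EP QP I_q0 using t I_q0 j k r
        by (simp add: ennreal_plus ennreal_mult)
      then have "I + 2 * q0 \<le> (1 - t) * ((1 - t) * I + t * j) + t * ((1 - t) * j + t * k) + 2 * ((1 - t) * q0 + t * r)"
        using t I_q0 j k r by (subst (asm) ennreal_le_iff) (auto intro!: add_nonneg_nonneg mult_nonneg_nonneg)
      then show ?thesis by (simp add: c_def algebra_simps power2_eq_square)
    qed
    then have "j + r - c \<ge> 0" by (rule nonneg_of_quadratic)
    then have "ennreal c \<le> ennreal (j + r)" by (intro ennreal_leI) simp
    then show ?thesis unfolding UN j r using j r by (simp add: ennreal_plus)
  qed
qed

end

section \<open>Two-sided bounds for the potential of the extremal measure\<close>

lemma riesz_kernel_tendsto:
  fixes x y :: "'a::euclidean_space"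
  assumes "s > 0" "X \<longlonglongrightarrow> x"
  shows "(\<lambda>k. riesz_kernel s (X k) y) \<longlonglongrightarrow> riesz_kernel s x y"
proof -
  have "continuous_on UNIV (\<lambda>x::'a. norm (x - y) powr s)"
    using assms(1) by (intro continuous_on_powr' continuous_intros) auto
  then have "continuous_on UNIV (\<lambda>x::'a. riesz_kernel s x y)"
    unfolding riesz_kernel_def by (intro continuous_on_inverse_ennreal continuous_on_ennreal)
  then show ?thesis using assms(2) by (rule continuous_on_tendsto_compose) auto
qed

text \<open>The indicator of the ball is at most a multiple of the ball density of radius
  \<open>2 * R\<close>, which is bounded below on the closed ball and has a bounded
  potential.\<close>

lemma ball_lebesgue_energy_finite:
  assumes lam: "0 < lam" "lam < 1" and s: "s = real DIM('a::euclidean_space) - 2 + 2 * lam" "s > 0" and R: "R > 0"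
  shows "(\<integral>\<^sup>+x. (\<integral>\<^sup>+y. riesz_kernel s x y * indicator (cball 0 R) y \<partial>lborel) * indicator (cball 0 R) x \<partial>(lborel :: 'a measure)) < top"
proof -
  define k where "k = ((2 * R)\<^sup>2) powr (1 - lam)"
  have ind: "indicator (cball 0 R) y \<le> ennreal k * ennreal (ball_density lam (2 * R) y)" for y :: 'a
  proof (cases "norm y \<le> R")
    case True
    then have "norm y < 2 * R" using R by simp
    then have "(norm y)\<^sup>2 < (2 * R)\<^sup>2" by (rule power_strict_mono) auto
    then have p: "(2 * R)\<^sup>2 - (norm y)\<^sup>2 > 0" by (simp only: diff_gt_0_iff_gt)
    have "((2 * R)\<^sup>2) powr (lam - 1) \<le> ((2 * R)\<^sup>2 - (norm y)\<^sup>2) powr (lam - 1)"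
      using p lam by (intro powr_mono2') auto
    then have "k * ((2 * R)\<^sup>2) powr (lam - 1) \<le> k * ball_density lam (2 * R) y"
      using \<open>norm y < 2 * R\<close> by (intro mult_left_mono) (auto simp: ball_density_def k_def)
    moreover have "k * ((2 * R)\<^sup>2) powr (lam - 1) = 1"
      unfolding k_def powr_add[symmetric] using R by simp
    ultimately have "ennreal 1 \<le> ennreal (k * ball_density lam (2 * R) y)" by (intro ennreal_leI) simp
    then show ?thesis using True by (simp add: ennreal_mult'' k_def)
  qed simp
  have inner: "(\<integral>\<^sup>+y. riesz_kernel s x y * indicator (cball 0 R) y \<partial>lborel) \<le> ennreal k * ennreal (ball_const DIM('a) lam)" for x :: 'a
  proof -
    have "(\<integral>\<^sup>+y. riesz_kernel s x y * indicator (cball 0 R) y \<partial>lborel) \<le>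
        (\<integral>\<^sup>+y. ennreal k * (riesz_kernel s x y * ennreal (ball_density lam (2 * R) y)) \<partial>lborel)"
      by (intro nn_integral_mono, subst mult.left_commute) (intro mult_left_mono ind, simp)
    also have "\<dots> = ennreal k * ball_potential s lam (2 * R) x"
      unfolding ball_potential_def by (rule nn_integral_cmult) measurable
    also have "\<dots> \<le> ennreal k * ennreal (ball_const DIM('a) lam)"
      using s R by (intro mult_left_mono ball_potential_le[OF lam s(1)]) auto
    finally show ?thesis .
  qed
  have "(\<integral>\<^sup>+x. (\<integral>\<^sup>+y. riesz_kernel s x y * indicator (cball 0 R) y \<partial>lborel) * indicator (cball 0 R) x \<partial>(lborel :: 'a measure)) \<le>
    (\<integral>\<^sup>+x. (ennreal k * ennreal (ball_const DIM('a) lam)) * indicator (cball 0 R) x \<partial>(lborel :: 'a measure))"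
    by (intro nn_integral_mono mult_right_mono inner) simp
  also have "\<dots> < top" using R
    by (subst nn_integral_cmult_indicator) (auto simp: ennreal_mult_less_top emeasure_cball)
  finally show ?thesis .
qed

text \<open>Conditioning on a set of positive measure keeps the energy finite; this supplies
  competitors for \<open>variation\<close>.\<close>

lemma mutual_energy_uniform_measure_finite:
  fixes \<tau> :: "'a::euclidean_space measure"
  assumes sf: "sigma_finite_measure \<tau>" and sets: "sets \<tau> = sets borel" and E[measurable]: "E \<in> sets borel"
    and E0: "emeasure \<tau> E \<noteq> 0" "emeasure \<tau> E < top"
    and en: "(\<integral>\<^sup>+x. (\<integral>\<^sup>+y. riesz_kernel s x y * indicator E y \<partial>\<tau>) * indicator E x \<partial>\<tau>) < top"
  shows "mutual_energy s (uniform_measure \<tau> E) (uniform_measure \<tau> E) < top"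
proof -
  interpret sigma_finite_measure \<tau> by fact
  note [measurable_cong] = sets
  define N where "N = uniform_measure \<tau> E"
  define g where "g = (\<lambda>x. \<integral>\<^sup>+y. riesz_kernel s x y * indicator E y \<partial>\<tau>)"
  have [measurable]: "g \<in> borel_measurable borel" unfolding g_def by measurable
  have "mutual_energy s N N = (\<integral>\<^sup>+x. g x / emeasure \<tau> E \<partial>N)"
    unfolding mutual_energy_def N_def g_def using E0
    by (intro nn_integral_cong nn_integral_uniform_measure) (auto simp: sets)
  also have "\<dots> = (\<integral>\<^sup>+x. g x / emeasure \<tau> E * indicator E x \<partial>\<tau>) / emeasure \<tau> E"
    unfolding N_def using E0 by (intro nn_integral_uniform_measure) (auto simp: sets)
  also have "(\<integral>\<^sup>+x. g x / emeasure \<tau> E * indicator E x \<partial>\<tau>) = (\<integral>\<^sup>+x. g x * indicator E x \<partial>\<tau>) / emeasure \<tau> E"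
  proof -
    have "(\<integral>\<^sup>+x. g x / emeasure \<tau> E * indicator E x \<partial>\<tau>) = (\<integral>\<^sup>+x. (g x * indicator E x) * inverse (emeasure \<tau> E) \<partial>\<tau>)"
      by (simp add: divide_ennreal_def mult_ac)
    also have "\<dots> = (\<integral>\<^sup>+x. g x * indicator E x \<partial>\<tau>) * inverse (emeasure \<tau> E)"
      by (rule nn_integral_multc) measurable
    finally show ?thesis by (simp add: divide_ennreal_def)
  qed
  finally have "mutual_energy s N N = (\<integral>\<^sup>+x. g x * indicator E x \<partial>\<tau>) / emeasure \<tau> E / emeasure \<tau> E" .
  then show ?thesis
    using en E0 by (simp add: less_top[symmetric] ennreal_divide_eq_top_iff N_def g_def)
qed

context equilibrium
begin

text \<open>Fatou's lemma, for a kernel that is continuous into \<open>ennreal\<close>, also on the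
  diagonal.\<close>

lemma U_lsc:
  assumes "X \<longlonglongrightarrow> x"
  shows "U x \<le> liminf (\<lambda>k. U (X k))"
proof -
  have "U x = (\<integral>\<^sup>+y. liminf (\<lambda>k. riesz_kernel s (X k) y) \<partial>M)"
    unfolding U_def by (intro nn_integral_cong lim_imp_Liminf[symmetric] riesz_kernel_tendsto[OF s_pos assms]) simp
  also have "\<dots> \<le> liminf (\<lambda>k. U (X k))"
    unfolding U_def by (rule nn_integral_liminf) (simp add: measurable_cong_sets[OF sets_M refl])
  finally show ?thesis .
qed

text \<open>If \<open>U + Q\<close> stayed below some \<open>d < c\<close> on a subset of the ball
  charged by \<open>\<tau>\<close>, then \<open>\<tau>\<close> conditioned on this set would violate
  \<open>variation\<close>; finite energy of \<open>\<tau>\<close> on the ball makes it admissible.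
  The lemma serves for \<open>\<tau> = M\<close> and for Lebesgue measure.\<close>

lemma U_ge_AE:
  assumes sf: "sigma_finite_measure \<tau>" and sets: "sets \<tau> = sets borel" and fin: "emeasure \<tau> (cball 0 R) < top"
    and en: "(\<integral>\<^sup>+x. (\<integral>\<^sup>+y. riesz_kernel s x y * indicator (cball 0 R) y \<partial>\<tau>) * indicator (cball 0 R) x \<partial>\<tau>) < top"
  shows "AE x in \<tau>. norm x \<le> R \<longrightarrow> ennreal c \<le> U x + ennreal (Q x)"
proof -
  interpret sigma_finite_measure \<tau> by fact
  note [measurable_cong] = sets
  define E where "E = (\<lambda>d. {x. norm x \<le> R \<and> U x + ennreal (Q x) \<le> ennreal d})"
  have E[measurable]: "E d \<in> sets borel" for d unfolding E_def by measurable
  have zero: "emeasure \<tau> (E d) = 0" if d: "d < c" for d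
  proof (rule ccontr)
    assume pos: "emeasure \<tau> (E d) \<noteq> 0"
    have "emeasure \<tau> (E d) \<le> emeasure \<tau> (cball 0 R)"
      by (intro emeasure_mono) (auto simp: E_def sets)
    then have less: "emeasure \<tau> (E d) < top" using fin by (rule order.strict_trans1)
    define N where "N = uniform_measure \<tau> (E d)"
    have setsN[measurable_cong]: "sets N = sets borel" by (simp add: N_def sets)
    have N1: "emeasure N UNIV = 1"
      unfolding N_def using pos less sets by (subst emeasure_uniform_measure) (auto simp: less_top ennreal_divide_self)
    have AE_E: "AE x in N. x \<in> E d"
      unfolding N_def by (intro AE_uniform_measureI) (auto simp: sets)
    define g where "g = (\<lambda>x. \<integral>\<^sup>+y. riesz_kernel s x y * indicator (E d) y \<partial>\<tau>)"
    have [measurable]: "g \<in> borel_measurable borel" unfolding g_def by measurable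
    have gle: "g x \<le> (\<integral>\<^sup>+y. riesz_kernel s x y * indicator (cball 0 R) y \<partial>\<tau>)" for x
      unfolding g_def by (intro nn_integral_mono mult_left_mono) (auto simp: E_def indicator_def)
    have "(\<integral>\<^sup>+x. g x * indicator (E d) x \<partial>\<tau>) \<le> (\<integral>\<^sup>+x. (\<integral>\<^sup>+y. riesz_kernel s x y * indicator (cball 0 R) y \<partial>\<tau>) * indicator (cball 0 R) x \<partial>\<tau>)"
      by (intro nn_integral_mono mult_mono gle) (auto simp: E_def indicator_def)
    then have "(\<integral>\<^sup>+x. g x * indicator (E d) x \<partial>\<tau>) < top" using en by (rule order.strict_trans1)
    then have N_fin: "mutual_energy s N N < top"
      unfolding N_def g_def using pos less by (intro mutual_energy_uniform_measure_finite sf sets E)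
    have "ennreal c \<le> (\<integral>\<^sup>+x. U x + ennreal (Q x) \<partial>N)"
      by (rule variation[OF setsN N1 _ N_fin]) (use AE_E in \<open>auto simp: E_def elim!: eventually_mono\<close>)
    also have "\<dots> \<le> (\<integral>\<^sup>+x. ennreal d \<partial>N)"
      by (intro nn_integral_mono_AE) (use AE_E in \<open>auto simp: E_def elim!: eventually_mono\<close>)
    also have "\<dots> = ennreal d" using N1 sets_eq_imp_space_eq[OF setsN] by simp
    finally have "ennreal c \<le> ennreal d" .
    moreover have "c \<ge> 0" using I_q0 by (simp add: c_def)
    \<comment> \<open>For negative \<open>d\<close> the value \<open>ennreal d\<close> is 0, so the
      inequality just obtained contradicts \<open>d < c\<close> only if \<open>c\<close> is
      positive. If \<open>c\<close> were 0, the strictly positive kernel would vanish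
      \<open>M\<close>-almost everywhere.\<close>
    moreover have "c > 0"
    proof (rule ccontr)
      assume "\<not> c > 0"
      then have "c = 0" using \<open>c \<ge> 0\<close> by simp
      then have "I = 0" using I_q0 by (simp add: c_def)
      then have "mutual_energy s M M = 0" using I_q0 by simp
      then have "AE x in M. U x = 0"
        unfolding mutual_energy_def U_def[symmetric]
        by (subst (asm) nn_integral_0_iff_AE) (auto simp: measurable_cong_sets[OF sets_M refl])
      then have "AE x in M. False"
      proof (rule AE_mp, intro AE_I2 impI)
        fix x assume "U x = 0"
        then have "AE y in M. riesz_kernel s x y = 0"
          unfolding U_def by (subst (asm) nn_integral_0_iff_AE) (auto simp: measurable_cong_sets[OF sets_M refl])
        moreover have "riesz_kernel s x y \<noteq> 0" for y by (simp add: riesz_kernel_def)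
        ultimately have "AE y in M. False" by simp
        then have "emeasure M (space M) = 0" by (subst (asm) AE_iff_null) (auto simp: null_sets_def)
        then show False using M1 sets_eq_imp_space_eq[OF sets_M] by simp
      qed
      then have "emeasure M (space M) = 0" by (subst (asm) AE_iff_null) (auto simp: null_sets_def)
      then show False using M1 sets_eq_imp_space_eq[OF sets_M] by simp
    qed
    ultimately show False using d by (simp add: ennreal_le_iff2)
  qed
  \<comment> \<open>Countably many levels below \<open>c\<close> exhaust the set where the
    inequality fails.\<close>
  have "AE x in \<tau>. \<forall>k::nat. x \<notin> E (c - 1 / (real k + 1))"
  proof (subst AE_all_countable, intro allI)
    fix k :: nat
    have "emeasure \<tau> (E (c - 1 / (real k + 1))) = 0" by (rule zero) simp
    then show "AE x in \<tau>. x \<notin> E (c - 1 / (real k + 1))"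
      by (intro AE_not_in) (auto simp: null_sets_def sets)
  qed
  then show ?thesis
  proof eventually_elim
    case (elim x)
    show ?case
    proof (intro impI, rule ccontr)
      assume x: "norm x \<le> R" and "\<not> ennreal c \<le> U x + ennreal (Q x)"
      then have less: "U x + ennreal (Q x) < ennreal c" by simp
      then obtain v where v: "U x + ennreal (Q x) = ennreal v" "v \<ge> 0" by (cases "U x + ennreal (Q x)") auto
      then have "v < c" using less by (simp add: ennreal_less_iff)
      then obtain k where "inverse (real (Suc k)) < c - v" using reals_Archimedean[of "c - v"] by auto
      then have "v \<le> c - 1 / (real k + 1)" by (simp add: inverse_eq_divide add.commute)
      then have "x \<in> E (c - 1 / (real k + 1))" using x v by (auto simp: E_def intro: ennreal_leI)
      then show False using elim by blast
    qed
  qed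
qed

lemma integral_U_Q: "(\<integral>\<^sup>+x. U x + ennreal (Q x) \<partial>M) = ennreal c"
proof -
  have "(\<integral>\<^sup>+x. U x + ennreal (Q x) \<partial>M) = mutual_energy s M M + (\<integral>\<^sup>+x. ennreal (Q x) \<partial>M)"
    unfolding mutual_energy_def U_def[symmetric]
    by (rule nn_integral_add) (simp_all add: measurable_cong_sets[OF sets_M refl])
  then show ?thesis unfolding I_q0 c_def using I_q0 by (simp add: ennreal_plus)
qed

lemma U_ge_AE_M: "AE x in M. norm x \<le> R \<longrightarrow> ennreal c \<le> U x + ennreal (Q x)"
proof (rule U_ge_AE)
  show "emeasure M (cball 0 R) < top" using finite_measure.emeasure_finite[OF finite_M] by (simp add: less_top)
  have "(\<integral>\<^sup>+x. (\<integral>\<^sup>+y. riesz_kernel s x y * indicator (cball 0 R) y \<partial>M) * indicator (cball 0 R) x \<partial>M) \<le> mutual_energy s M M"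
    unfolding mutual_energy_def
  proof (intro nn_integral_mono)
    fix x
    have "(\<integral>\<^sup>+y. riesz_kernel s x y * indicator (cball 0 R) y \<partial>M) * indicator (cball 0 R) x \<le>
        (\<integral>\<^sup>+y. riesz_kernel s x y \<partial>M) * 1"
      by (intro mult_mono nn_integral_mono) (auto simp: indicator_def)
    then show "(\<integral>\<^sup>+y. riesz_kernel s x y * indicator (cball 0 R) y \<partial>M) * indicator (cball 0 R) x \<le> (\<integral>\<^sup>+y. riesz_kernel s x y \<partial>M)" by simp
  qed
  then show "(\<integral>\<^sup>+x. (\<integral>\<^sup>+y. riesz_kernel s x y * indicator (cball 0 R) y \<partial>M) * indicator (cball 0 R) x \<partial>M) < top"
    using M_fin by (rule order.strict_trans1)
qed (use finite_M sets_M in \<open>auto intro: finite_measure_imp_sigma_finite\<close>)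

text \<open>If \<open>U + Q\<close> exceeded \<open>c\<close> at a point, then by lower
  semicontinuity it would exceed some \<open>d > c\<close> near this point in the ball. That
  neighbourhood has positive \<open>M\<close>-mass while \<open>U + Q \<ge> c\<close> holds
  \<open>M\<close>-almost everywhere, so the integral against \<open>M\<close> would be larger than
  \<open>c\<close>.\<close>

lemma U_le:
  assumes x: "norm x \<le> R"
  shows "U x + ennreal (Q x) \<le> ennreal c"
proof (rule ccontr)
  assume "\<not> U x + ennreal (Q x) \<le> ennreal c"
  then have "ennreal c < U x + ennreal (Q x)" by simp
  then obtain d where d: "c < d" "ennreal d < U x + ennreal (Q x)" "d \<ge> 0"
  proof -
    assume that: "\<And>d. c < d \<Longrightarrow> ennreal d < U x + ennreal (Q x) \<Longrightarrow> d \<ge> 0 \<Longrightarrow> thesis"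
    have c0: "c \<ge> 0" using I_q0 by (simp add: c_def)
    obtain z where z: "ennreal c < z" "z < U x + ennreal (Q x)" using dense[OF \<open>ennreal c < U x + ennreal (Q x)\<close>] by auto
    then obtain d where "z = ennreal d" "d \<ge> 0" by (cases z) auto
    then show thesis using that[of d] z c0 by (simp add: ennreal_less_iff)
  qed
  have "\<exists>k::nat. \<forall>y. norm y \<le> R \<longrightarrow> y \<in> ball x (1 / (real k + 1)) \<longrightarrow> ennreal d < U y + ennreal (Q y)"
  proof (rule ccontr)
    assume "\<not> ?thesis"
    then have "\<forall>k::nat. \<exists>y. norm y \<le> R \<and> y \<in> ball x (1 / (real k + 1)) \<and> U y + ennreal (Q y) \<le> ennreal d"
      by (simp add: not_less)
    then obtain X where X: "\<And>k::nat. norm (X k) \<le> R" "\<And>k. X k \<in> ball x (1 / (real k + 1))" "\<And>k. U (X k) + ennreal (Q (X k)) \<le> ennreal d"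
      by metis
    have "(\<lambda>k. dist (X k) x) \<longlonglongrightarrow> 0"
    proof (rule tendsto_sandwich[where f="\<lambda>_. 0" and h="\<lambda>k. 1 / (real k + 1)"])
      show "(\<lambda>k. 1 / (real k + 1)) \<longlonglongrightarrow> 0" using LIMSEQ_inverse_real_of_nat by (simp add: inverse_eq_divide add.commute)
      show "\<forall>\<^sub>F k in sequentially. dist (X k) x \<le> 1 / (real k + 1)"
        using X(2) by (intro always_eventually allI) (simp add: dist_commute less_imp_le)
    qed auto
    then have lim: "X \<longlonglongrightarrow> x" by (subst tendsto_dist_iff)
    have Qlim: "(\<lambda>k. Q (X k)) \<longlonglongrightarrow> Q x"
      by (rule continuous_on_tendsto_compose[OF Q_cont lim]) auto
    have Uk: "U (X k) \<le> ennreal (d - Q (X k))" for k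
    proof -
      have "U (X k) \<le> ennreal d - ennreal (Q (X k))"
        using X(3)[of k] by (simp add: ennreal_le_minus_iff)
      then show ?thesis using Q_nonneg[OF X(1)[of k]] by (simp add: ennreal_minus)
    qed
    have "U x \<le> liminf (\<lambda>k. U (X k))" by (rule U_lsc[OF lim])
    also have "\<dots> \<le> liminf (\<lambda>k. ennreal (d - Q (X k)))" by (intro Liminf_mono always_eventually allI Uk)
    also have "\<dots> = ennreal (d - Q x)"
      by (intro lim_imp_Liminf tendsto_ennrealI tendsto_intros Qlim) simp
    finally have "U x \<le> ennreal (d - Q x)" .
    \<comment> \<open>Guards against truncation: for \<open>Q x > d\<close> the term
      \<open>ennreal (d - Q x)\<close> would be 0, and adding \<open>Q x\<close> back would not give
      \<open>d\<close>.\<close>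
    moreover have "Q x \<le> d"
    proof (rule LIMSEQ_le_const2[OF Qlim], intro exI allI impI)
      fix k
      have "ennreal (Q (X k)) \<le> U (X k) + ennreal (Q (X k))" by simp
      also have "\<dots> \<le> ennreal d" by (rule X(3))
      finally show "Q (X k) \<le> d" using d by (simp add: ennreal_le_iff)
    qed
    ultimately have "U x + ennreal (Q x) \<le> ennreal (d - Q x) + ennreal (Q x)" by (intro add_right_mono)
    also have "\<dots> = ennreal d" using \<open>Q x \<le> d\<close> Q_nonneg[OF x] by (simp add: ennreal_plus[symmetric] del: ennreal_plus)
    finally show False using d by simp
  qed
  then obtain k :: nat where k: "\<And>y. norm y \<le> R \<Longrightarrow> y \<in> ball x (1 / (real k + 1)) \<Longrightarrow> ennreal d < U y + ennreal (Q y)" by blast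
  define V where "V = ball x (1 / (real k + 1))"
  have V: "emeasure M V > 0" unfolding V_def by (rule M_supp[OF x]) auto
  have c0: "c \<ge> 0" using I_q0 by (simp add: c_def)
  have "AE y in M. ennreal c + ennreal (d - c) * indicator V y \<le> U y + ennreal (Q y)"
    using U_ge_AE_M M_conc
  proof eventually_elim
    case (elim y)
    then show ?case
    proof (cases "y \<in> V")
      case True
      have "ennreal c + ennreal (d - c) = ennreal d" using c0 d by (simp add: ennreal_plus[symmetric] del: ennreal_plus)
      then show ?thesis using True k[of y] elim by (simp add: V_def less_imp_le)
    qed simp
  qed
  then have "(\<integral>\<^sup>+y. ennreal c + ennreal (d - c) * indicator V y \<partial>M) \<le> (\<integral>\<^sup>+y. U y + ennreal (Q y) \<partial>M)"
    by (rule nn_integral_mono_AE)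
  also have "\<dots> = ennreal c" by (rule integral_U_Q)
  also have "(\<integral>\<^sup>+y. ennreal c + ennreal (d - c) * indicator V y \<partial>M) = ennreal c + ennreal (d - c) * emeasure M V"
  proof -
    have [measurable]: "V \<in> sets M" by (simp add: V_def sets_M)
    have "(\<integral>\<^sup>+y. ennreal c + ennreal (d - c) * indicator V y \<partial>M) = (\<integral>\<^sup>+y. ennreal c \<partial>M) + (\<integral>\<^sup>+y. ennreal (d - c) * indicator V y \<partial>M)"
      by (rule nn_integral_add) measurable
    then show ?thesis using M1 sets_eq_imp_space_eq[OF sets_M] by (simp add: nn_integral_cmult_indicator)
  qed
  finally have "ennreal c + ennreal (d - c) * emeasure M V \<le> ennreal c + 0" by simp
  then have "ennreal (d - c) * emeasure M V \<le> 0" by (subst (asm) ennreal_add_left_cancel_le) auto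
  then show False using V d by (simp add: mult_eq_0_iff)
qed

text \<open>Equality is obtained up to a Lebesgue null set. This suffices, because it will be
  integrated against measures with a Lebesgue density.\<close>

lemma U_eq_AE:
  assumes lam: "0 < lam" "lam < 1" and s: "s = real DIM('a) - 2 + 2 * lam" and R: "R > 0"
  shows "AE x in lborel. norm x \<le> R \<longrightarrow> U x + ennreal (Q x) = ennreal c"
proof -
  have "AE x in lborel. norm x \<le> R \<longrightarrow> ennreal c \<le> U x + ennreal (Q x)"
    using R ball_lebesgue_energy_finite[OF lam s s_pos R]
    by (intro U_ge_AE sigma_finite_lborel) (auto simp: emeasure_cball)
  then show ?thesis by eventually_elim (auto intro: antisym U_le)
qed

end

section \<open>Identification of the extremal measure\<close>

text \<open>Polar coordinates over exactly the product measure that occurs in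
  \<open>has_polar_density\<close>.\<close>

lemma nn_integral_polar_disk:
  fixes F :: "'a::euclidean_space \<Rightarrow> ennreal"
  assumes [measurable]: "F \<in> borel_measurable borel"
  shows "(\<integral>\<^sup>+(r, w). F (r *\<^sub>R w) * ennreal (r ^ (DIM('a) - 1)) \<partial>(restrict_space lborel {0..R} \<Otimes>\<^sub>M sphere_measure)) =
    (\<integral>\<^sup>+x. F x * indicator (cball 0 R) x \<partial>lborel)"
proof -
  interpret S: finite_measure "sphere_measure :: 'a measure" by (rule finite_measure_sphere_measure)
  have [measurable]: "cball (0::'a) R \<in> sets borel" by simp
  interpret L: finite_measure "restrict_space lborel {0..R}"
    by (rule finite_measureI) (simp add: emeasure_restrict_space space_restrict_space emeasure_lborel_Icc_eq)
  interpret P: pair_sigma_finite "restrict_space lborel {0..R}" "sphere_measure :: 'a measure" ..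
  have id_r: "(\<lambda>x. x) \<in> restrict_space lborel {0..R} \<rightarrow>\<^sub>M borel" by (intro measurable_restrict_space1) simp
  have m: "(\<lambda>(r, w). F (r *\<^sub>R w) * ennreal (r ^ (DIM('a) - 1))) \<in> borel_measurable (restrict_space lborel {0..R} \<Otimes>\<^sub>M sphere_measure)"
    using measurable_compose[OF measurable_snd measurable_id_sphere_measure] measurable_compose[OF measurable_fst id_r] by measurable
  have "(\<integral>\<^sup>+(r, w). F (r *\<^sub>R w) * ennreal (r ^ (DIM('a) - 1)) \<partial>(restrict_space lborel {0..R} \<Otimes>\<^sub>M sphere_measure)) =
     (\<integral>\<^sup>+w. (\<integral>\<^sup>+r. F (r *\<^sub>R w) * ennreal (r ^ (DIM('a) - 1)) \<partial>restrict_space lborel {0..R}) \<partial>sphere_measure)"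
    by (subst P.nn_integral_snd[symmetric, OF m]) simp
  also have "\<dots> = (\<integral>\<^sup>+w. (\<integral>\<^sup>+r. indicator {0<..} r * ennreal (r ^ (DIM('a) - 1)) * (F (r *\<^sub>R w) * indicator (cball 0 R) (r *\<^sub>R w)) \<partial>lborel) \<partial>sphere_measure)"
  proof (rule nn_integral_cong)
    fix w :: 'a assume "w \<in> space sphere_measure"
    then have w: "norm w = 1" by simp
    have "(\<integral>\<^sup>+r. F (r *\<^sub>R w) * ennreal (r ^ (DIM('a) - 1)) \<partial>restrict_space lborel {0..R}) =
       (\<integral>\<^sup>+r. F (r *\<^sub>R w) * ennreal (r ^ (DIM('a) - 1)) * indicator {0..R} r \<partial>lborel)"
      by (rule nn_integral_restrict_space) simp
    also have "\<dots> = (\<integral>\<^sup>+r. indicator {0<..} r * ennreal (r ^ (DIM('a) - 1)) * (F (r *\<^sub>R w) * indicator (cball 0 R) (r *\<^sub>R w)) \<partial>lborel)"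
      by (rule nn_integral_cong_AE, rule AE_mp[OF AE_lborel_singleton[of 0]], intro AE_I2 impI)
        (use w in \<open>auto simp: indicator_def mult_ac\<close>)
    finally show "(\<integral>\<^sup>+r. F (r *\<^sub>R w) * ennreal (r ^ (DIM('a) - 1)) \<partial>restrict_space lborel {0..R}) =
       (\<integral>\<^sup>+r. indicator {0<..} r * ennreal (r ^ (DIM('a) - 1)) * (F (r *\<^sub>R w) * indicator (cball 0 R) (r *\<^sub>R w)) \<partial>lborel)" .
  qed
  also have "\<dots> = (\<integral>\<^sup>+x. F x * indicator (cball 0 R) x \<partial>lborel)"
    by (rule nn_integral_polar[symmetric]) measurable
  finally show ?thesis .
qed

lemma integral_polar_disk:
  fixes g :: "'a::euclidean_space \<Rightarrow> real"
  assumes g[measurable]: "g \<in> borel_measurable borel" and int: "integrable lborel (\<lambda>x. g x * indicator (cball 0 R) x)"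
  shows "integrable (restrict_space lborel {0..R} \<Otimes>\<^sub>M sphere_measure) (\<lambda>(r, w). g (r *\<^sub>R w) * r ^ (DIM('a) - 1))"
    and "(\<integral>(r, w). g (r *\<^sub>R w) * r ^ (DIM('a) - 1) \<partial>(restrict_space lborel {0..R} \<Otimes>\<^sub>M sphere_measure)) =
      (\<integral>x. g x * indicator (cball 0 R) x \<partial>lborel)"
proof -
  let ?P = "restrict_space lborel {0..R} \<Otimes>\<^sub>M (sphere_measure :: 'a measure)"
  define h where "h = (\<lambda>(r, w::'a). g (r *\<^sub>R w) * r ^ (DIM('a) - 1))"
  have id_r: "(\<lambda>x. x) \<in> restrict_space lborel {0..R} \<rightarrow>\<^sub>M borel" by (intro measurable_restrict_space1) simp
  have m: "h \<in> borel_measurable ?P" unfolding h_def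
    using measurable_compose[OF measurable_snd measurable_id_sphere_measure] measurable_compose[OF measurable_fst id_r] by measurable
  \<comment> \<open>The values \<open>t = 1\<close> and \<open>t = -1\<close> give the positive and
    the negative part of the real integral.\<close>
  have part: "(\<integral>\<^sup>+p. ennreal (t * h p) \<partial>?P) = (\<integral>\<^sup>+x. ennreal (t * (g x * indicator (cball 0 R) x)) \<partial>lborel)" for t :: real
  proof -
    have "(\<integral>\<^sup>+p. ennreal (t * h p) \<partial>?P) = (\<integral>\<^sup>+(r, w). ennreal (t * g (r *\<^sub>R w)) * ennreal (r ^ (DIM('a) - 1)) \<partial>?P)"
      by (intro nn_integral_cong) (auto simp: h_def space_pair_measure space_restrict_space ennreal_mult''[symmetric] mult.assoc)
    also have "\<dots> = (\<integral>\<^sup>+x. ennreal (t * g x) * indicator (cball 0 R) x \<partial>lborel)"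
      by (rule nn_integral_polar_disk) measurable
    also have "\<dots> = (\<integral>\<^sup>+x. ennreal (t * (g x * indicator (cball 0 R) x)) \<partial>lborel)"
      by (intro nn_integral_cong) (auto simp: indicator_def)
    finally show ?thesis .
  qed
  have parts: "(\<integral>\<^sup>+p. ennreal (h p) \<partial>?P) = (\<integral>\<^sup>+x. ennreal (g x * indicator (cball 0 R) x) \<partial>lborel)"
     "(\<integral>\<^sup>+p. ennreal (- h p) \<partial>?P) = (\<integral>\<^sup>+x. ennreal (- (g x * indicator (cball 0 R) x)) \<partial>lborel)"
    using part[of 1] part[of "-1"] by simp_all
  have i: "integrable ?P h"
    using int m unfolding real_integrable_def parts by simp
  then show "integrable ?P (\<lambda>(r, w). g (r *\<^sub>R w) * r ^ (DIM('a) - 1))" by (simp add: h_def)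
  have "(\<integral>p. h p \<partial>?P) = (\<integral>x. g x * indicator (cball 0 R) x \<partial>lborel)"
    by (simp only: real_lebesgue_integral_def[OF i] real_lebesgue_integral_def[OF int] parts)
  then show "(\<integral>(r, w). g (r *\<^sub>R w) * r ^ (DIM('a) - 1) \<partial>?P) = (\<integral>x. g x * indicator (cball 0 R) x \<partial>lborel)"
    by (simp add: h_def)
qed

lemma integral_radial:
  fixes h :: "real \<Rightarrow> real"
  assumes [measurable]: "h \<in> borel_measurable borel" and int: "integrable lborel (\<lambda>x::'a::euclidean_space. h (norm x))"
  shows "integrable lborel (\<lambda>r. indicator {0<..} r * r ^ (DIM('a) - 1) * h r)"
    and "(\<integral>x. h (norm x) \<partial>(lborel :: 'a measure)) = sphere_area DIM('a) * (\<integral>r. indicator {0<..} r * r ^ (DIM('a) - 1) * h r \<partial>lborel)"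
proof -
  define u where "u = (\<lambda>r. indicator {0<..} r * r ^ (DIM('a) - 1) * h r)"
  have [measurable]: "u \<in> borel_measurable borel" unfolding u_def by measurable
  have S: "sphere_area DIM('a) > 0" by (rule sphere_area_pos) simp
  have part: "(\<integral>\<^sup>+x. ennreal (t * h (norm x)) \<partial>(lborel :: 'a measure)) = ennreal (sphere_area DIM('a)) * (\<integral>\<^sup>+r. ennreal (t * u r) \<partial>lborel)" for t :: real
  proof -
    have "(\<integral>\<^sup>+x. ennreal (t * h (norm x)) \<partial>(lborel :: 'a measure)) =
        ennreal (sphere_area DIM('a)) * (\<integral>\<^sup>+r. indicator {0<..} r * ennreal (r ^ (DIM('a) - 1)) * ennreal (t * h r) \<partial>lborel)"
      unfolding emeasure_sphere_area[symmetric] by (rule nn_integral_radial[of "\<lambda>r. ennreal (t * h r)"]) measurable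
    also have "(\<integral>\<^sup>+r. indicator {0<..} r * ennreal (r ^ (DIM('a) - 1)) * ennreal (t * h r) \<partial>lborel) = (\<integral>\<^sup>+r. ennreal (t * u r) \<partial>lborel)"
      by (intro nn_integral_cong) (auto simp: u_def indicator_def ennreal_mult''[symmetric] mult_ac)
    finally show ?thesis .
  qed
  note parts = part[of 1, simplified] part[of "-1", simplified]
  have fin: "(\<integral>\<^sup>+r. ennreal (u r) \<partial>lborel) \<noteq> top" "(\<integral>\<^sup>+r. ennreal (- u r) \<partial>lborel) \<noteq> top"
    using int S unfolding real_integrable_def by (auto simp: parts ennreal_mult_eq_top_iff)
  then have i: "integrable lborel u" unfolding real_integrable_def by simp
  then show "integrable lborel (\<lambda>r. indicator {0<..} r * r ^ (DIM('a) - 1) * h r)" unfolding u_def .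
  have "(\<integral>x. h (norm x) \<partial>(lborel :: 'a measure)) = sphere_area DIM('a) * (\<integral>r. u r \<partial>lborel)"
    unfolding real_lebesgue_integral_def[OF i] real_lebesgue_integral_def[OF int] parts
    using S by (simp add: enn2real_mult right_diff_distrib)
  then show "(\<integral>x. h (norm x) \<partial>(lborel :: 'a measure)) = sphere_area DIM('a) * (\<integral>r. indicator {0<..} r * r ^ (DIM('a) - 1) * h r \<partial>lborel)"
    unfolding u_def .
qed

section \<open>Density and total mass of the candidate\<close>

context ball_mixture
begin

lemma AE_mix_norm_less: "AE x in (mix lam R c :: 'a measure). norm x < R"
proof -
  have "norm x < R" if "0 < mix_density lam R c x" for x :: 'a
    using that by (rule contrapos_pp) (auto simp: mix_density_def ball_density_def)
  then show ?thesis unfolding mix_def by (subst AE_density) (auto intro!: AE_I2)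
qed

lemma mutual_energy_mix: "mutual_energy s \<tau> (mix lam R c :: 'a measure) = (\<integral>\<^sup>+x. mix_potential s lam R c x \<partial>\<tau>)"
  by (simp add: mutual_energy_def riesz_potential_mix)

lemma mutual_energy_mix_finite:
  assumes "finite_measure \<tau>"
  shows "mutual_energy s \<tau> (mix lam R c :: 'a measure) < top"
proof -
  have "mutual_energy s \<tau> (mix lam R c :: 'a measure) \<le> (\<integral>\<^sup>+x. ennreal (ball_const DIM('a) lam) * (\<integral>\<^sup>+\<rho>. c \<rho> \<partial>lborel) \<partial>\<tau>)"
    unfolding mutual_energy_mix by (intro nn_integral_mono mix_potential_le)
  also have "\<dots> < top"
    using c_fin finite_measure.emeasure_finite[OF assms] by (simp add: ennreal_mult_eq_top_iff less_top[symmetric])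
  finally show ?thesis .
qed

lemma measure_mix:
  assumes [measurable]: "A \<in> sets (borel :: 'a measure)"
  shows "integrable lborel (\<lambda>x::'a. indicator A x * enn2real (mix_density lam R c x))"
    and "measure (mix lam R c) A = (\<integral>x. indicator A x * enn2real (mix_density lam R c x) \<partial>lborel)"
proof -
  interpret finite_measure "mix lam R c :: 'a measure" by (rule finite_measure_mix)
  have "(\<integral>\<^sup>+x. mix_density lam R c (x::'a) \<partial>lborel) = emeasure (mix lam R c :: 'a measure) UNIV"
    by (simp add: mix_def emeasure_density)
  then have "(\<integral>\<^sup>+x. mix_density lam R c (x::'a) \<partial>lborel) \<noteq> \<infinity>" by simp
  then have "AE x::'a in lborel. mix_density lam R c x \<noteq> \<infinity>"
    by (intro nn_integral_noteq_infinite) auto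
  then have AE: "AE x::'a in lborel. ennreal (indicator A x * enn2real (mix_density lam R c x)) = mix_density lam R c x * indicator A x"
    by eventually_elim (auto simp: indicator_def less_top)
  have em: "(\<integral>\<^sup>+x. ennreal (indicator A x * enn2real (mix_density lam R c x)) \<partial>lborel) = emeasure (mix lam R c) A"
    unfolding mix_def by (subst emeasure_density) (auto intro!: nn_integral_cong_AE AE)
  then have "has_bochner_integral lborel (\<lambda>x::'a. indicator A x * enn2real (mix_density lam R c x)) (measure (mix lam R c) A)"
    by (intro has_bochner_integral_nn_integral) (auto simp: emeasure_eq_measure)
  then show "integrable lborel (\<lambda>x::'a. indicator A x * enn2real (mix_density lam R c x))"
     "measure (mix lam R c) A = (\<integral>x. indicator A x * enn2real (mix_density lam R c x) \<partial>lborel)"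
    by (auto simp: has_bochner_integral_iff)
qed

end

context radial_field_space
begin

abbreviation "Mpos \<equiv> mix lam R (\<lambda>\<rho>. ennreal (b \<rho>)) :: 'a measure"
abbreviation "Mneg \<equiv> mix lam R (\<lambda>\<rho>. ennreal (- b \<rho>)) :: 'a measure"

text \<open>The candidate density, set to 0 at both endpoints and beyond; inside
  \<open>(0, R)\<close> it is \<open>dens_f\<close> once \<open>C\<close> is
  \<open>dens_C\<close>.\<close>

definition "profile r = indicator {0<..<R} r * (C * (R\<^sup>2 - r\<^sup>2) powr (lam - 1) + K * (Nt r - gh R * (R\<^sup>2 - r\<^sup>2) powr (lam - 1)))"

lemma Nt_measurable [measurable]: "Nt \<in> borel_measurable borel"
proof -
  have "Nt = (\<lambda>x. \<integral>r. (if x < r \<and> r < R then 1 else 0) * (gh' r * (r\<^sup>2 - x\<^sup>2) powr (lam - 1)) \<partial>lborel)"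
    by (auto simp: Nt_def fun_eq_iff indicator_def intro!: Bochner_Integration.integral_cong)
  then show ?thesis by simp
qed

lemma profile_measurable [measurable]: "profile \<in> borel_measurable borel"
  unfolding profile_def by measurable

lemma AE_norm_neq: "AE x in (lborel :: 'a measure). x \<noteq> 0 \<and> norm x \<noteq> R"
proof -
  have "sphere (0::'a) R \<in> null_sets lborel"
    using negligible_sphere[of "0::'a" R] by (simp add: negligible_iff_null_sets null_sets_completion_iff)
  then have "AE x in (lborel :: 'a measure). x \<notin> sphere 0 R" by (rule AE_not_in)
  then show ?thesis using AE_lborel_singleton[of "0::'a"] by eventually_elim auto
qed

text \<open>\<open>profile\<close> is the radial density of the signed measure
  \<open>Mpos - Mneg\<close>. The origin and the sphere of radius \<open>R\<close>, which
  \<open>mix_density_eq\<close> leaves out, are null sets.\<close>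

lemma measure_diff:
  assumes A[measurable]: "A \<in> sets (borel :: 'a measure)"
  shows "integrable lborel (\<lambda>x::'a. indicator A x * profile (norm x))"
    and "measure (Mpos :: 'a measure) A - measure (Mneg :: 'a measure) A = (\<integral>x. indicator A x * profile (norm x) \<partial>lborel)"
proof -
  have [measurable]: "(\<lambda>x::'a. indicator A x * profile (norm x)) \<in> borel_measurable borel" by measurable
  have AE: "AE x in lborel. indicator A x * enn2real (mix_density lam R (\<lambda>\<rho>. ennreal (b \<rho>)) x) -
      indicator A x * enn2real (mix_density lam R (\<lambda>\<rho>. ennreal (- b \<rho>)) x) = indicator A x * profile (norm (x :: 'a))"
    using AE_norm_neq
  proof eventually_elim
    case (elim x)
    show ?case
    proof (cases "norm x < R")
      case True
      then have "norm x \<in> {0<..<R}" using elim by auto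
      from mix_density_eq(3)[OF this] this show ?thesis by (simp add: profile_def right_diff_distrib[symmetric])
    next
      case False
      then have "ball_density lam (min R \<rho>) x = 0" for \<rho> by (auto simp: ball_density_def)
      then show ?thesis using False by (simp add: mix_density_def profile_def)
    qed
  qed
  have "integrable lborel (\<lambda>x. indicator A x * enn2real (mix_density lam R (\<lambda>\<rho>. ennreal (b \<rho>)) x) -
      indicator A x * enn2real (mix_density lam R (\<lambda>\<rho>. ennreal (- b \<rho>)) x))"
    by (intro Bochner_Integration.integrable_diff pos.measure_mix neg.measure_mix A)
  then show "integrable lborel (\<lambda>x::'a. indicator A x * profile (norm x))"
    by (rule integrable_cong_AE_imp) (use AE in \<open>auto simp: eq_commute\<close>)
  have "measure (Mpos :: 'a measure) A - measure (Mneg :: 'a measure) A = (\<integral>x. indicator A x * enn2real (mix_density lam R (\<lambda>\<rho>. ennreal (b \<rho>)) x) -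
      indicator A x * enn2real (mix_density lam R (\<lambda>\<rho>. ennreal (- b \<rho>)) x) \<partial>lborel)"
    unfolding pos.measure_mix(2)[OF A] neg.measure_mix(2)[OF A]
    by (intro Bochner_Integration.integral_diff[symmetric] pos.measure_mix neg.measure_mix A)
  also have "\<dots> = (\<integral>x. indicator A x * profile (norm x) \<partial>lborel)"
    by (intro integral_cong_AE AE) measurable
  finally show "measure (Mpos :: 'a measure) A - measure (Mneg :: 'a measure) A = (\<integral>x. indicator A x * profile (norm x) \<partial>lborel)" .
qed

lemma dens_f_eq_profile:
  assumes q': "\<And>r. r \<in> {0..R} \<Longrightarrow> q' r = q r" and C: "C = dens_C (Suc n) lam R q'" and r: "r \<in> {0<..<R}"
  shows "dens_f (Suc n) lam R q' r = profile r"
proof -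
  have "dens_F (Suc n) lam R q' r = K * (Nt r - gh R * (R\<^sup>2 - r\<^sup>2) powr (lam - 1))"
    unfolding K_def field_const_def by (rule dens_F_eq[OF q' r])
  then show ?thesis unfolding dens_f_def profile_def C[symmetric] using r by simp
qed

lemma mass_eq:
  assumes q': "\<And>r. r \<in> {0..R} \<Longrightarrow> q' r = q r"
  shows "measure (Mpos :: 'a measure) UNIV - measure (Mneg :: 'a measure) UNIV =
     sphere_area n * (C * (Beta (n / 2) lam / 2 * R powr s) + integral {0..R} (\<lambda>t. dens_F (Suc n) lam R q' t * t ^ (Suc n - 2)))"
proof -
  define e where "e = (\<lambda>r. indicator {0<..<R} r * (r ^ (n - 1) * (R\<^sup>2 - r\<^sup>2) powr (lam - 1)))"
  define F where "F = (\<lambda>r. indicator {0<..<R} r * (dens_F (Suc n) lam R q' r * r ^ (Suc n - 2)))"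
  have u: "indicator {0<..} r * r ^ (DIM('a) - 1) * profile r = C * e r + F r" for r
  proof (cases "r \<in> {0<..<R}")
    case True
    then have dF: "dens_F (Suc n) lam R q' r = K * (Nt r - gh R * (R\<^sup>2 - r\<^sup>2) powr (lam - 1))"
      unfolding K_def field_const_def by (intro dens_F_eq q')
    then show ?thesis using True by (simp add: profile_def e_def F_def n_DIM[symmetric] dF) (simp add: algebra_simps)
  qed (simp add: profile_def e_def F_def)
  have int_x: "integrable lborel (\<lambda>x::'a. profile (norm x))" using measure_diff(1)[of UNIV] by simp
  have int_u: "integrable lborel (\<lambda>r. C * e r + F r)"
    using integral_radial(1)[OF profile_measurable int_x] unfolding u .
  have e_nn: "(\<integral>\<^sup>+r. ennreal (e r) \<partial>lborel) = ennreal (Beta (n / 2) lam / 2 * R powr s)"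
  proof -
    have "(\<integral>\<^sup>+r. ennreal (e r) \<partial>lborel) = (\<integral>\<^sup>+r. ennreal (r ^ (n - 1) * (R\<^sup>2 - r\<^sup>2) powr (lam - 1)) * indicator {0<..<R} r \<partial>lborel)"
      by (intro nn_integral_cong) (auto simp: e_def indicator_def)
    then show ?thesis using nn_integral_radial_power[OF lam(1) _ R, of n] n2 s by simp
  qed
  have "has_bochner_integral lborel e (Beta (n / 2) lam / 2 * R powr s)"
  proof (rule has_bochner_integral_nn_integral[OF _ _ _ e_nn])
    show "0 \<le> Beta (n / 2) lam / 2 * R powr s" using Beta_real_pos[of "n / 2" lam] lam n2 by simp
  qed (auto simp: e_def indicator_def)
  then have e: "integrable lborel e" "(\<integral>r. e r \<partial>lborel) = Beta (n / 2) lam / 2 * R powr s"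
    by (auto simp: has_bochner_integral_iff)
  have "integrable lborel (\<lambda>r. (C * e r + F r) - C * e r)"
    by (intro Bochner_Integration.integrable_diff int_u integrable_mult_right e)
  then have F: "integrable lborel F" by simp
  have F_int: "(\<integral>r. F r \<partial>lborel) = integral {0..R} (\<lambda>t. dens_F (Suc n) lam R q' t * t ^ (Suc n - 2))"
    using integral_eq_lborel(1)[OF F[unfolded F_def]] by (simp add: F_def)
  have "measure (Mpos :: 'a measure) UNIV - measure (Mneg :: 'a measure) UNIV = (\<integral>x. profile (norm x) \<partial>(lborel :: 'a measure))"
    using measure_diff(2)[of UNIV] by simp
  also have "\<dots> = sphere_area n * (\<integral>r. C * e r + F r \<partial>lborel)"
    using integral_radial(2)[OF profile_measurable int_x] unfolding u unfolding n_DIM[symmetric] .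
  also have "(\<integral>r. C * e r + F r \<partial>lborel) = C * (\<integral>r. e r \<partial>lborel) + (\<integral>r. F r \<partial>lborel)"
    using e F by simp
  finally show ?thesis unfolding e F_int .
qed

text \<open>\<open>dens_C\<close> is the solution of this linear equation for \<open>C\<close>: its
  two Gamma quotients are \<open>2 / B\<close> and \<open>1 / S\<close>, by the Gamma formulas for
  the Beta function and for the sphere area.\<close>

lemma mass_eq_1:
  assumes q': "\<And>r. r \<in> {0..R} \<Longrightarrow> q' r = q r" and C: "C = dens_C (Suc n) lam R q'"
  shows "measure (Mpos :: 'a measure) UNIV - measure (Mneg :: 'a measure) UNIV = 1"
proof -
  define J where "J = integral {0..R} (\<lambda>t. dens_F (Suc n) lam R q' t * t ^ (Suc n - 2))"
  define S where "S = sphere_area n"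
  define B where "B = Beta (n / 2) lam"
  have n0: "n > 0" using n2 by simp
  have S: "S > 0" unfolding S_def by (rule sphere_area_pos[OF n0])
  have B: "B > 0" unfolding B_def using Beta_real_pos[of "n / 2" lam] lam n0 by simp
  have G: "Gamma (real n / 2) > 0" "Gamma lam > 0" using lam n0 by auto
  have S': "1 / S = Gamma (real n / 2) / (2 * pi powr (real n / 2))"
    unfolding S_def sphere_area_Gamma[OF n0] by simp
  have B': "2 / B = 2 * Gamma (real n / 2 + lam) / (Gamma lam * Gamma (real n / 2))"
    unfolding B_def Beta_def by simp
  have "(real (Suc n) - 1) / 2 = real n / 2" "real (Suc n) + 2 * lam - 3 = s" using s by auto
  then have "C = 2 / B * (1 / R powr s) * (1 / S - J)"
    unfolding C dens_C_def B' S' J_def by simp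
  then have "S * (C * (B / 2 * R powr s) + J) = 1"
    using S B R by (simp add: field_simps)
  moreover have "measure (Mpos :: 'a measure) UNIV - measure (Mneg :: 'a measure) UNIV = S * (C * (B / 2 * R powr s) + J)"
    unfolding S_def B_def J_def by (rule mass_eq) (rule q')
  ultimately show ?thesis by (simp only:)
qed

end

text \<open>Brings the candidate and the extremal measure together; the equation \<open>mass\<close>
  is the only condition on \<open>C\<close>.\<close>

locale disk_problem = radial_field_space n lam R s q q1 q2 C "TYPE('a::euclidean_space)" + equilibrium R s "\<lambda>x::'a. q (norm x)" M
  for n lam R s q q1 q2 C M +
  assumes mass: "measure (Mpos :: 'a measure) UNIV - measure (Mneg :: 'a measure) UNIV = 1"
begin

text \<open>\<open>potential_eq\<close> integrated against a measure on the ball; the sign of the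
  constant is handled as in \<open>integral_ball_density_eq\<close>.\<close>

lemma potential_integral_eq:
  assumes \<tau>: "finite_measure \<tau>" "sets \<tau> = sets (borel :: 'a measure)" "AE x in \<tau>. norm x \<le> R"
  shows "enn2real (mutual_energy s \<tau> Mpos) + enn2real (\<integral>\<^sup>+x. ennreal (q (norm x)) \<partial>\<tau>) =
     enn2real (mutual_energy s \<tau> Mneg) + C * W * measure \<tau> UNIV"
    and "(\<integral>\<^sup>+x. ennreal (q (norm x)) \<partial>\<tau>) < top"
proof -
  interpret finite_measure \<tau> by fact
  note [measurable_cong] = \<tau>(2)
  have sp: "space \<tau> = UNIV" using sets_eq_imp_space_eq[OF \<tau>(2)] by simp
  obtain B where B: "B \<ge> 0" "\<And>x::'a. norm x \<le> R \<Longrightarrow> q (norm x) \<le> B" by (rule Q_bounded) blast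
  have "(\<integral>\<^sup>+x. ennreal (q (norm x)) \<partial>\<tau>) \<le> (\<integral>\<^sup>+x. ennreal B \<partial>\<tau>)"
    using \<tau>(3) by (intro nn_integral_mono_AE) (auto elim!: eventually_mono intro!: ennreal_leI B)
  also have "\<dots> < top" by (simp add: ennreal_mult_eq_top_iff less_top[symmetric])
  finally show qfin: "(\<integral>\<^sup>+x. ennreal (q (norm x)) \<partial>\<tau>) < top" .
  have pw: "Upos x + ennreal (q (norm x)) + ennreal (max 0 (- (C * W))) = Uneg x + ennreal (max 0 (C * W))" if x: "norm x \<le> R" for x
  proof -
    have U: "Upos x = ennreal (enn2real (Upos x))" "Uneg x = ennreal (enn2real (Uneg x))"
      using pos.mix_potential_less_top[of x] neg.mix_potential_less_top[of x] by simp_all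
    have eq: "enn2real (Upos x) + q (norm x) + max 0 (- (C * W)) = enn2real (Uneg x) + max 0 (C * W)"
      using potential_eq[OF x] by (simp add: max_def)
    have "Upos x + ennreal (q (norm x)) + ennreal (max 0 (- (C * W))) = ennreal (enn2real (Upos x) + q (norm x) + max 0 (- (C * W)))"
      using Q_nonneg[OF x] by (subst U) (simp add: ennreal_plus)
    also have "\<dots> = Uneg x + ennreal (max 0 (C * W))"
      unfolding eq by (subst (2) U) (simp add: ennreal_plus)
    finally show ?thesis .
  qed
  have "(\<integral>\<^sup>+x. Upos x + ennreal (q (norm x)) + ennreal (max 0 (- (C * W))) \<partial>\<tau>) = (\<integral>\<^sup>+x. Uneg x + ennreal (max 0 (C * W)) \<partial>\<tau>)"
    using \<tau>(3) by (intro nn_integral_cong_AE) (auto elim!: eventually_mono simp: pw)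
  then have "mutual_energy s \<tau> Mpos + (\<integral>\<^sup>+x. ennreal (q (norm x)) \<partial>\<tau>) + ennreal (max 0 (- (C * W))) * emeasure \<tau> UNIV =
     mutual_energy s \<tau> Mneg + ennreal (max 0 (C * W)) * emeasure \<tau> UNIV"
    unfolding pos.mutual_energy_mix neg.mutual_energy_mix by (simp add: nn_integral_add sp)
  moreover obtain a where a: "mutual_energy s \<tau> Mpos = ennreal a" "a \<ge> 0"
    using pos.mutual_energy_mix_finite[OF \<tau>(1)] by (cases "mutual_energy s \<tau> Mpos") auto
  moreover obtain a' where a': "mutual_energy s \<tau> Mneg = ennreal a'" "a' \<ge> 0"
    using neg.mutual_energy_mix_finite[OF \<tau>(1)] by (cases "mutual_energy s \<tau> Mneg") auto
  moreover obtain r where r: "(\<integral>\<^sup>+x. ennreal (q (norm x)) \<partial>\<tau>) = ennreal r" "r \<ge> 0"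
    using qfin by (cases "\<integral>\<^sup>+x. ennreal (q (norm x)) \<partial>\<tau>") auto
  moreover define t where "t = measure \<tau> UNIV"
  moreover have "emeasure \<tau> UNIV = ennreal t" "t \<ge> 0" by (simp_all add: t_def emeasure_eq_measure)
  ultimately have "ennreal (a + r + max 0 (- (C * W)) * t) = ennreal (a' + max 0 (C * W) * t)"
    by (simp add: ennreal_plus ennreal_mult)
  then have "a + r + max 0 (- (C * W)) * t = a' + max 0 (C * W) * t"
    using a a' r \<open>t \<ge> 0\<close> by (subst (asm) ennreal_inj) auto
  moreover have "max 0 (C * W) = C * W + max 0 (- (C * W))" by (simp add: max_def)
  ultimately have "a + r = a' + C * W * t" by (simp only: distrib_right)
  then show "enn2real (mutual_energy s \<tau> Mpos) + enn2real (\<integral>\<^sup>+x. ennreal (q (norm x)) \<partial>\<tau>) =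
     enn2real (mutual_energy s \<tau> Mneg) + C * W * measure \<tau> UNIV"
    unfolding a a' r t_def using a a' r by simp
qed

text \<open>The companion identity for \<open>U\<close>, for measures that do not charge the
  exceptional set of the equilibrium condition.\<close>

lemma equilibrium_integral_eq:
  assumes \<tau>: "finite_measure \<tau>" "sets \<tau> = sets (borel :: 'a measure)" "AE x in \<tau>. norm x \<le> R"
    and ac: "AE x in \<tau>. norm x \<le> R \<longrightarrow> U x + ennreal (q (norm x)) = ennreal c"
    and fin: "mutual_energy s \<tau> M < top"
  shows "enn2real (mutual_energy s \<tau> M) + enn2real (\<integral>\<^sup>+x. ennreal (q (norm x)) \<partial>\<tau>) = c * measure \<tau> UNIV"
proof -
  interpret finite_measure \<tau> by fact
  note [measurable_cong] = \<tau>(2)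
  have sp: "space \<tau> = UNIV" using sets_eq_imp_space_eq[OF \<tau>(2)] by simp
  have c0: "c \<ge> 0" using I_q0 by (simp add: c_def)
  have "mutual_energy s \<tau> M + (\<integral>\<^sup>+x. ennreal (q (norm x)) \<partial>\<tau>) = (\<integral>\<^sup>+x. U x + ennreal (q (norm x)) \<partial>\<tau>)"
    unfolding mutual_energy_def U_def[symmetric] by (rule nn_integral_add[symmetric]) measurable
  also have "\<dots> = (\<integral>\<^sup>+x. ennreal c \<partial>\<tau>)"
    using \<tau>(3) ac by (intro nn_integral_cong_AE) (auto elim: eventually_elim2)
  also have "\<dots> = ennreal (c * measure \<tau> UNIV)" using c0 by (simp add: sp emeasure_eq_measure ennreal_mult)
  finally have "enn2real (mutual_energy s \<tau> M + (\<integral>\<^sup>+x. ennreal (q (norm x)) \<partial>\<tau>)) = c * measure \<tau> UNIV"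
    using c0 by simp
  then show ?thesis using fin potential_integral_eq(2)[OF \<tau>] by (simp add: enn2real_plus)
qed

text \<open>Integrating the two potential identities gives linear relations between mutual energies:
  the one for the candidate is integrated against \<open>M\<close>, \<open>Mpos\<close> and
  \<open>Mneg\<close>, the one for \<open>U\<close> against \<open>Mpos\<close> and
  \<open>Mneg\<close>, and \<open>c = I + q0\<close> supplies the case of \<open>M\<close>. They
  combine to energy 0 for \<open>M - (Mpos - Mneg)\<close>, expressed without subtraction.\<close>

lemma M_add_Mneg: "add_measure M Mneg = Mpos"
proof (rule riesz_energy_eq_imp_eq[OF s_pos])
  have fin: "finite_measure M" "finite_measure (Mpos :: 'a measure)" "finite_measure (Mneg :: 'a measure)"
    by (rule finite_M pos.finite_measure_mix neg.finite_measure_mix)+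
  have sets: "sets M = sets borel" "sets (Mpos :: 'a measure) = sets borel" "sets (Mneg :: 'a measure) = sets borel" by (simp_all add: sets_M)
  note sf = fin[THEN finite_measure_imp_sigma_finite]
  show fadd: "finite_measure (add_measure M Mneg)" using fin sets by (intro finite_measure_add_measure) auto
  show sadd: "sets (add_measure M Mneg) = sets borel" by (simp add: sets_M)
  show "finite_measure (Mpos :: 'a measure)" "sets (Mpos :: 'a measure) = sets borel" by fact+
  have conc: "AE x in M. norm x \<le> R" "AE x in (Mpos :: 'a measure). norm x \<le> R" "AE x in (Mneg :: 'a measure). norm x \<le> R"
    using M_conc pos.AE_mix_norm_less neg.AE_mix_norm_less by (auto elim!: eventually_mono)
  define E where "E = (\<lambda>M N. enn2real (mutual_energy s M (N :: 'a measure)))"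
  define q' where "q' = (\<lambda>M. enn2real (\<integral>\<^sup>+x. ennreal (q (norm (x::'a))) \<partial>M))"
  have sym: "mutual_energy s (Mneg :: 'a measure) Mpos = mutual_energy s (Mpos :: 'a measure) Mneg" "mutual_energy s (Mpos :: 'a measure) M = mutual_energy s M Mpos"
     "mutual_energy s (Mneg :: 'a measure) M = mutual_energy s M Mneg"
    by (intro mutual_energy_commute sf sets)+
  have f: "mutual_energy s \<tau> Mpos < top" "mutual_energy s \<tau> Mneg < top" if "finite_measure \<tau>" for \<tau>
    by (rule pos.mutual_energy_mix_finite[OF that] neg.mutual_energy_mix_finite[OF that])+
  have AE_U: "AE x in (lborel :: 'a measure). norm x \<le> R \<longrightarrow> U x + ennreal (q (norm x)) = ennreal c"
    by (rule U_eq_AE[OF lam s_DIM R])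
  have AE_pos: "AE x in (Mpos :: 'a measure). norm x \<le> R \<longrightarrow> U x + ennreal (q (norm x)) = ennreal c"
    unfolding mix_def using AE_U by (subst AE_density) auto
  have AE_neg: "AE x in (Mneg :: 'a measure). norm x \<le> R \<longrightarrow> U x + ennreal (q (norm x)) = ennreal c"
    unfolding mix_def using AE_U by (subst AE_density) auto
  have M1': "measure M UNIV = 1" using M1 by (simp add: measure_def)
  have q0: "q' M = q0" by (simp add: q'_def q0_def)
  have 1: "E M Mpos + q0 = E M Mneg + C * W"
    using potential_integral_eq(1)[OF fin(1) sets(1) conc(1)] M1' q0 by (simp add: E_def q'_def)
  have 2: "E Mpos Mpos + q' Mpos = E Mpos Mneg + C * W * measure (Mpos :: 'a measure) UNIV"
    using potential_integral_eq(1)[OF fin(2) sets(2) conc(2)] by (simp add: E_def q'_def)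
  have 3: "E Mpos Mneg + q' Mneg = E Mneg Mneg + C * W * measure (Mneg :: 'a measure) UNIV"
    using potential_integral_eq(1)[OF fin(3) sets(3) conc(3)] by (simp add: E_def q'_def sym)
  have 4: "E M Mpos + q' Mpos = c * measure (Mpos :: 'a measure) UNIV"
    using equilibrium_integral_eq[OF fin(2) sets(2) conc(2) AE_pos] f(1)[OF fin(1)] by (simp add: E_def q'_def sym)
  have 5: "E M Mneg + q' Mneg = c * measure (Mneg :: 'a measure) UNIV"
    using equilibrium_integral_eq[OF fin(3) sets(3) conc(3) AE_neg] f(2)[OF fin(1)] by (simp add: E_def q'_def sym)
  \<comment> \<open>Total mass 1 of the candidate turns differences of multiples of
    \<open>C * W\<close> and of \<open>c\<close> into the constants themselves.\<close>
  have mC: "C * W * measure (Mpos :: 'a measure) UNIV = C * W * measure (Mneg :: 'a measure) UNIV + C * W" "c * measure (Mpos :: 'a measure) UNIV = c * measure (Mneg :: 'a measure) UNIV + c"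
    using mass by (simp_all add: algebra_simps)
  \<comment> \<open>The difference \<open>E M Mneg - E M Mpos\<close> occurs twice; it is expressed
    once by 1 and once by 4 and 5. With 2 and 3, the constants \<open>C * W\<close> and
    \<open>c\<close> and all field integrals cancel.\<close>
  have key: "I + 2 * E M Mneg + E Mneg Mneg + E Mpos Mpos = 2 * (E M Mpos + E Mpos Mneg)"
    using 1 2 3 4 5 mC by (simp add: c_def)
  have real: "mutual_energy s M M = ennreal I" "mutual_energy s M Mneg = ennreal (E M Mneg)" "mutual_energy s M Mpos = ennreal (E M Mpos)"
    "mutual_energy s (Mpos :: 'a measure) Mpos = ennreal (E Mpos Mpos)" "mutual_energy s (Mneg :: 'a measure) Mneg = ennreal (E Mneg Mneg)"
    "mutual_energy s (Mpos :: 'a measure) Mneg = ennreal (E Mpos Mneg)"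
    using f fin by (simp_all add: E_def I_q0)
  have nonneg: "E M N \<ge> 0" for M N by (simp add: E_def)
  have add1: "mutual_energy s (add_measure M Mneg) K = mutual_energy s M K + mutual_energy s (Mneg :: 'a measure) K" if "finite_measure K" "sets K = sets borel" for K
    using that by (intro mutual_energy_add_left sets finite_measure_imp_sigma_finite)
  have add2: "mutual_energy s K (add_measure M Mneg) = mutual_energy s K M + mutual_energy s K Mneg" if "finite_measure K" "sets K = sets borel" for K
    using that by (intro mutual_energy_add_right sets fin)
  have EA: "mutual_energy s (add_measure M Mneg) (add_measure M Mneg) = ennreal (I + 2 * E M Mneg + E Mneg Mneg)"
    unfolding add1[OF fadd sadd] add2[OF fin(1) sets(1)] add2[OF fin(3) sets(3)] sym real
    using I_q0 nonneg by (simp add: ennreal_plus[symmetric] del: ennreal_plus)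
  have EB: "mutual_energy s (add_measure M Mneg) Mpos = ennreal (E M Mpos + E Mpos Mneg)"
    unfolding add1[OF fin(2) sets(2)] sym real using nonneg by (simp add: ennreal_plus)
  show "mutual_energy s (add_measure M Mneg) (add_measure M Mneg) < top" unfolding EA by simp
  show "mutual_energy s (Mpos :: 'a measure) Mpos < top" by (rule f(1)[OF fin(2)])
  have "mutual_energy s (add_measure M Mneg) (add_measure M Mneg) + mutual_energy s (Mpos :: 'a measure) Mpos = ennreal (I + 2 * E M Mneg + E Mneg Mneg + E Mpos Mpos)"
    unfolding EA real using I_q0 nonneg by (simp add: ennreal_plus[symmetric] del: ennreal_plus)
  also have "\<dots> = 2 * mutual_energy s (add_measure M Mneg) Mpos"
    unfolding EB key using nonneg by (subst ennreal_mult) auto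
  finally show "mutual_energy s (add_measure M Mneg) (add_measure M Mneg) + mutual_energy s (Mpos :: 'a measure) Mpos = 2 * mutual_energy s (add_measure M Mneg) Mpos" .
qed

lemma measure_M:
  assumes A: "A \<in> sets (borel :: 'a measure)"
  shows "measure M A = (\<integral>x. indicator A x * profile (norm x) \<partial>lborel)"
proof -
  interpret P: finite_measure "Mpos :: 'a measure" by (rule pos.finite_measure_mix)
  interpret N: finite_measure "Mneg :: 'a measure" by (rule neg.finite_measure_mix)
  interpret M: finite_measure M by (rule finite_M)
  have "emeasure (Mpos :: 'a measure) A = emeasure M A + emeasure (Mneg :: 'a measure) A"
    unfolding M_add_Mneg[symmetric] using A by (intro emeasure_add_measure) (simp_all add: sets_M)
  then have "ennreal (measure (Mpos :: 'a measure) A) = ennreal (measure M A + measure (Mneg :: 'a measure) A)"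
    by (simp add: P.emeasure_eq_measure N.emeasure_eq_measure M.emeasure_eq_measure ennreal_plus)
  then have "measure (Mpos :: 'a measure) A = measure M A + measure (Mneg :: 'a measure) A"
    by (subst (asm) ennreal_inj) auto
  then show ?thesis using measure_diff(2)[OF A] by simp
qed

end

section \<open>Radial profiles, and passage between the flat disk and \<open>'a\<close>\<close>

lemma clamp_extension:
  fixes \<phi> :: "real \<Rightarrow> real"
  assumes "R > 0" "continuous_on {0..R} \<phi>"
  shows "continuous_on UNIV (\<lambda>r. \<phi> (max 0 (min R r)))"
  by (rule continuous_on_compose2[OF assms(2)]) (use assms(1) in \<open>auto intro!: continuous_intros\<close>)

text \<open>The chain rule along the ray \<open>r *\<^sub>R e\<close>, with derivatives within the
  ball, gives derivatives within \<open>{0..R}\<close>. Clamping the argument extends all three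
  functions continuously to the line without changing them on \<open>{0..R}\<close>.\<close>

lemma C2_on_radial_profile:
  fixes h :: "'a::euclidean_space \<Rightarrow> real"
  assumes C2: "C2_on (cball 0 R) h" and R: "R > 0" and e: "norm e = 1"
    and q: "\<And>r. r \<in> {0..R} \<Longrightarrow> q r = h (r *\<^sub>R e)"
  obtains q0 q1 q2 where "continuous_on UNIV q0" "continuous_on UNIV q1" "continuous_on UNIV q2"
    "\<And>r. r \<in> {0..R} \<Longrightarrow> q0 r = q r"
    "\<And>r. r \<in> {0..R} \<Longrightarrow> (q0 has_real_derivative q1 r) (at r within {0..R})"
    "\<And>r. r \<in> {0..R} \<Longrightarrow> (q1 has_real_derivative q2 r) (at r within {0..R})"
proof -
  from C2 obtain f' :: "'a \<Rightarrow> 'a \<Rightarrow>\<^sub>L real" and f'' :: "'a \<Rightarrow> 'a \<Rightarrow>\<^sub>L ('a \<Rightarrow>\<^sub>L real)"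
    where f': "\<And>x. x \<in> cball 0 R \<Longrightarrow> (h has_derivative blinfun_apply (f' x)) (at x within cball 0 R)"
      and f'': "\<And>x. x \<in> cball 0 R \<Longrightarrow> (f' has_derivative blinfun_apply (f'' x)) (at x within cball 0 R)"
      and cont: "continuous_on (cball 0 R) f''"
    unfolding C2_on_def by blast
  define cl where "cl = (\<lambda>r. max 0 (min R r))"
  define p1 where "p1 = (\<lambda>r. blinfun_apply (f' (r *\<^sub>R e)) e)"
  define p2 where "p2 = (\<lambda>r. blinfun_apply (blinfun_apply (f'' (r *\<^sub>R e)) e) e)"
  have cl: "cl r = r" if "r \<in> {0..R}" for r using that by (auto simp: cl_def)
  have img: "(\<lambda>r. r *\<^sub>R e) ` {0..R} \<subseteq> cball 0 R" using e by auto
  have lin: "((\<lambda>r. r *\<^sub>R e) has_derivative (\<lambda>t. t *\<^sub>R e)) (at r within {0..R})" for r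
    by (auto intro!: derivative_eq_intros)
  have d0: "(q has_real_derivative p1 r) (at r within {0..R})" if r: "r \<in> {0..R}" for r
  proof -
    have "((\<lambda>r. h (r *\<^sub>R e)) has_derivative (\<lambda>t. f' (r *\<^sub>R e) (t *\<^sub>R e))) (at r within {0..R})"
      by (rule has_derivative_in_compose2[OF _ img r lin]) (rule f')
    then have "((\<lambda>r. h (r *\<^sub>R e)) has_real_derivative p1 r) (at r within {0..R})"
      by (simp add: has_field_derivative_def p1_def blinfun.scaleR_right mult_commute_abs)
    then show ?thesis
      by (rule has_field_derivative_transform_within[where d=1]) (use q r in auto)
  qed
  have d1: "(p1 has_real_derivative p2 r) (at r within {0..R})" if r: "r \<in> {0..R}" for r
  proof -
    have "((\<lambda>r. f' (r *\<^sub>R e)) has_derivative (\<lambda>t. f'' (r *\<^sub>R e) (t *\<^sub>R e))) (at r within {0..R})"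
      by (rule has_derivative_in_compose2[OF _ img r lin]) (rule f'')
    then have "((\<lambda>r. blinfun_apply (f' (r *\<^sub>R e)) e) has_derivative (\<lambda>t. blinfun_apply (f'' (r *\<^sub>R e) (t *\<^sub>R e)) e)) (at r within {0..R})"
      by (rule bounded_linear.has_derivative[OF blinfun.bounded_linear_left])
    then show ?thesis
      by (simp add: has_field_derivative_def p1_def p2_def blinfun.scaleR_right blinfun.scaleR_left mult_commute_abs)
  qed
  have c0: "continuous_on {0..R} q" by (rule DERIV_continuous_on[OF d0])
  have c1: "continuous_on {0..R} p1" by (rule DERIV_continuous_on[OF d1])
  have c2: "continuous_on {0..R} p2"
    unfolding p2_def using img
    by (intro blinfun.continuous_on continuous_on_compose2[OF cont] continuous_intros) auto
  show ?thesis
  proof (rule that[of "\<lambda>r. q (cl r)" "\<lambda>r. p1 (cl r)" "\<lambda>r. p2 (cl r)"])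
    show "continuous_on UNIV (\<lambda>r. q (cl r))" "continuous_on UNIV (\<lambda>r. p1 (cl r))" "continuous_on UNIV (\<lambda>r. p2 (cl r))"
      unfolding cl_def by (intro clamp_extension R c0 c1 c2)+
    fix r assume r: "r \<in> {0..R}"
    show "q (cl r) = q r" by (simp add: cl[OF r])
    show "((\<lambda>r. q (cl r)) has_real_derivative p1 (cl r)) (at r within {0..R})"
      unfolding cl[OF r] by (rule has_field_derivative_transform_within[OF d0[OF r], where d=1]) (use r cl in auto)
    show "((\<lambda>r. p1 (cl r)) has_real_derivative p2 (cl r)) (at r within {0..R})"
      unfolding cl[OF r] by (rule has_field_derivative_transform_within[OF d1[OF r], where d=1]) (use r cl in auto)
  qed
qed

text \<open>The complement is a union of open null sets, and by Lindelof countably many of them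
  already cover it.\<close>

lemma emeasure_Compl_msupport:
  fixes \<mu> :: "'b::second_countable_topology measure"
  assumes sets: "sets \<mu> = sets borel"
  shows "emeasure \<mu> (- msupport \<mu>) = 0"
proof -
  define F where "F = {U. open U \<and> emeasure \<mu> U = 0}"
  have "\<And>U. U \<in> F \<Longrightarrow> open U" by (simp add: F_def)
  then obtain F' where F': "F' \<subseteq> F" "countable F'" "\<Union>F' = \<Union>F" by (rule Lindelof)
  have "- msupport \<mu> = \<Union>F'"
    unfolding F' by (auto simp: msupport_def F_def)
  moreover have "(\<Union>U\<in>F'. U) \<in> null_sets \<mu>"
    using F' by (intro null_sets_UN') (auto simp: F_def null_sets_def sets)
  ultimately show ?thesis by auto
qed

lemma closed_disk: "closed (disk R)"
  unfolding disk_def by (intro closed_Times) auto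

text \<open>Carries a measure on \<open>'a\<close> to the hyperplane of the disk. The embedding is
  isometric, so Riesz energies are preserved.\<close>

definition lift_measure :: "'a::euclidean_space measure \<Rightarrow> (real \<times> 'a) measure" where
  "lift_measure N = distr N borel (\<lambda>y. (0, y))"

lemma lift_measurable [measurable]: "(\<lambda>y. (0::real, y)) \<in> (borel :: 'a::euclidean_space measure) \<rightarrow>\<^sub>M borel"
  by (intro borel_measurable_continuous_onI continuous_intros)

context
  fixes N :: "'a::euclidean_space measure" and R :: real
  assumes setsN: "sets N = sets borel" and N1: "emeasure N UNIV = 1" and conc: "AE y in N. norm y \<le> R"
begin

lemma finite_lift_domain: "finite_measure N"
  using N1 sets_eq_imp_space_eq[OF setsN] by (intro finite_measureI) simp

lemma lift_measurable_N: "(\<lambda>y. (0::real, y)) \<in> N \<rightarrow>\<^sub>M borel"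
  using lift_measurable by (simp add: measurable_cong_sets[OF setsN refl])

lemma AE_lift_measure_disk: "AE p in lift_measure N. p \<in> disk R"
  unfolding lift_measure_def
  by (subst AE_distr_iff[OF lift_measurable_N])
    (use conc borel_closed[OF closed_disk[of R]] in \<open>auto simp: disk_def elim!: eventually_mono\<close>)

text \<open>Makes every unit measure on the ball of radius \<open>R\<close> a competitor in the
  problem on the unit disk.\<close>

lemma lift_measure_unit:
  assumes "R \<le> 1"
  shows "lift_measure N \<in> unit_measures_on (disk 1)"
proof -
  have "emeasure (lift_measure N) UNIV = 1"
    unfolding lift_measure_def using N1 sets_eq_imp_space_eq[OF setsN] by (subst emeasure_distr[OF lift_measurable_N]) auto
  moreover have "msupport (lift_measure N) \<subseteq> disk R"
  proof (rule ccontr)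
    assume "\<not> msupport (lift_measure N) \<subseteq> disk R"
    then obtain p where p: "p \<in> msupport (lift_measure N)" "p \<in> - disk R" by auto
    have "open (- disk R :: (real \<times> 'a) set)" using closed_disk by (rule open_Compl)
    then have "emeasure (lift_measure N) (- disk R) > 0" using p by (auto simp: msupport_def)
    moreover have "emeasure (lift_measure N) (- disk R) = 0"
      using AE_lift_measure_disk by (subst (asm) AE_iff_measurable[where N="- disk R"])
        (auto simp: lift_measure_def intro!: borel_open open_Compl closed_disk)
    ultimately show False by simp
  qed
  moreover have "disk R \<subseteq> (disk 1 :: (real \<times> 'a) set)" using assms by (auto simp: disk_def)
  ultimately show ?thesis by (auto simp: unit_measures_on_def lift_measure_def)
qed

lemma riesz_energy_lift: "riesz_energy s (lift_measure N) = mutual_energy s N N"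
proof -
  interpret finite_measure N by (rule finite_lift_domain)
  have sf: "sigma_finite_measure (lift_measure N)"
    unfolding lift_measure_def by (intro finite_measure_imp_sigma_finite finite_measure_distr lift_measurable_N)
  have "riesz_energy s (lift_measure N) = (\<integral>\<^sup>+p. \<integral>\<^sup>+p'. riesz_kernel s p p' \<partial>lift_measure N \<partial>lift_measure N)"
    by (simp add: riesz_energy_def riesz_kernel_def)
  also have "\<dots> = (\<integral>\<^sup>+x. \<integral>\<^sup>+p'. riesz_kernel s (0, x) p' \<partial>lift_measure N \<partial>N)"
  proof -
    have "(\<lambda>p. \<integral>\<^sup>+p'. riesz_kernel s p p' \<partial>lift_measure N) \<in> borel_measurable borel"
      by (rule riesz_potential_measurable[OF sf]) (simp add: lift_measure_def)
    then have "(\<lambda>p. \<integral>\<^sup>+p'. riesz_kernel s p p' \<partial>lift_measure N) \<in> borel_measurable (distr N borel (\<lambda>y. (0, y)))"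
      by simp
    from nn_integral_distr[OF lift_measurable_N this] show ?thesis by (simp add: lift_measure_def)
  qed
  also have "\<dots> = (\<integral>\<^sup>+x. \<integral>\<^sup>+y. riesz_kernel s (0::real, x) (0, y) \<partial>N \<partial>N)"
    unfolding lift_measure_def by (intro nn_integral_cong nn_integral_distr lift_measurable_N) measurable
  also have "\<dots> = mutual_energy s N N"
    by (simp add: mutual_energy_def riesz_kernel_def norm_Pair)
  finally show ?thesis .
qed

lemma weighted_energy_lift:
  assumes "R \<le> 1" and Q: "\<And>y. norm y \<le> R \<Longrightarrow> Q (0, y) = ennreal (u y)" and [measurable]: "u \<in> borel_measurable borel"
  shows "weighted_energy s Q (lift_measure N) = mutual_energy s N N + 2 * (\<integral>\<^sup>+y. ennreal (u y) \<partial>N)"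
proof -
  have "(\<integral>\<^sup>+p \<in> disk 1. Q p \<partial>lift_measure N) = (\<integral>\<^sup>+p. ennreal (u (snd p)) \<partial>lift_measure N)"
  proof (rule nn_integral_cong_AE, rule AE_mp[OF AE_lift_measure_disk], intro AE_I2 impI)
    fix p :: "real \<times> 'a" assume "p \<in> disk R"
    then obtain y where "p = (0, y)" "norm y \<le> R" by (auto simp: disk_def)
    then show "Q p * indicator (disk 1) p = ennreal (u (snd p))" using Q[of y] assms(1) by (simp add: disk_def)
  qed
  also have "\<dots> = (\<integral>\<^sup>+y. ennreal (u y) \<partial>N)"
  proof -
    have "snd \<in> (borel :: (real \<times> 'a) measure) \<rightarrow>\<^sub>M borel"
      by (intro borel_measurable_continuous_onI continuous_intros)
    then have "(\<lambda>p::real \<times> 'a. ennreal (u (snd p))) \<in> borel_measurable borel" by measurable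
    then show ?thesis unfolding lift_measure_def by (subst nn_integral_distr[OF lift_measurable_N]) auto
  qed
  finally show ?thesis by (simp add: weighted_energy_def riesz_energy_lift)
qed

end

text \<open>A measure concentrated on the disk is recovered from its projection, so the extremal
  measure can be studied on \<open>'a\<close>.\<close>

lemma lift_snd_eq:
  fixes \<mu> :: "(real \<times> 'a::euclidean_space) measure"
  assumes sets: "sets \<mu> = sets borel" and AE: "AE p in \<mu>. p \<in> disk R"
  shows "lift_measure (distr \<mu> borel snd) = \<mu>"
proof -
  have snd: "snd \<in> \<mu> \<rightarrow>\<^sub>M borel"
    unfolding measurable_cong_sets[OF sets refl] by (intro borel_measurable_continuous_onI continuous_intros)
  have "lift_measure (distr \<mu> borel snd) = distr \<mu> borel (\<lambda>p. (0, snd p))"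
    unfolding lift_measure_def by (subst distr_distr[OF lift_measurable snd]) (simp add: o_def)
  also have "\<dots> = distr \<mu> borel (\<lambda>p. p)"
    by (rule distr_cong_AE) (use AE measurable_compose[OF snd lift_measurable] in
      \<open>auto simp: disk_def measurable_cong_sets[OF sets refl] elim!: eventually_mono\<close>)
  also have "\<dots> = \<mu>" by (rule distr_id2) (simp add: sets)
  finally show ?thesis .
qed

theorem theorem1p2:
  fixes d :: nat and lam s R :: real
    and Q :: "real \<times> 'a::euclidean_space \<Rightarrow> ennreal"
    and q :: "real \<Rightarrow> real"
    and \<mu> :: "(real \<times> 'a) measure"
  assumes "d \<ge> 3" and "DIM('a) = d - 1"
    and "0 < lam" and "lam < 1" and "s = (real d - 3) + 2 * lam"
    and "external_field Q"
    and "extremal_measure s Q \<mu>"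
    and "0 < R" and "msupport \<mu> = disk R"
    and "\<forall>r\<in>{0..R}. 0 \<le> q r \<and> (\<forall>w\<in>sphere 0 1. Q (0, r *\<^sub>R w) = ennreal (q r))"
    and "C2_on (cball 0 R) (\<lambda>y::'a. enn2real (Q (0, y)))"
  shows "has_polar_density d R \<mu> (dens_f d lam R q)"
proof -
  note R = \<open>0 < R\<close>
  define n where "n = d - 1"
  have n: "n \<ge> 2" "d = Suc n" "n = DIM('a)" using assms(1,2) by (auto simp: n_def)
  have s: "s = real n - 2 + 2 * lam" using assms(5) n by simp
  have s_pos: "s > 0" using s n assms(3) by simp
  obtain e :: 'a where e: "norm e = 1" using vector_choose_size[of 1] by auto
  have Qq: "Q (0, y) = ennreal (q (norm y))" if "norm y \<le> R" for y :: 'a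
  proof (cases "y = 0")
    case True
    \<comment> \<open>At the origin \<open>sgn y\<close> is not a unit vector, so a fixed direction
      \<open>e\<close> takes its place.\<close>
    have "Q (0, 0 *\<^sub>R e) = ennreal (q 0)"
      by (rule bspec[OF conjunct2[OF bspec[OF assms(10)]]]) (use R e in auto)
    then show ?thesis using True by simp
  next
    case False
    have "Q (0, norm y *\<^sub>R sgn y) = ennreal (q (norm y))"
      using assms(10) that False by (auto simp: norm_sgn)
    then show ?thesis using False by (simp add: sgn_div_norm)
  qed
  have q0: "q r \<ge> 0" if "r \<in> {0..R}" for r using assms(10) that by blast
  obtain qq q1 q2 where qq: "continuous_on UNIV qq" "continuous_on UNIV q1" "continuous_on UNIV q2"
    "\<And>r. r \<in> {0..R} \<Longrightarrow> qq r = q r"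
    "\<And>r. r \<in> {0..R} \<Longrightarrow> (qq has_real_derivative q1 r) (at r within {0..R})"
    "\<And>r. r \<in> {0..R} \<Longrightarrow> (q1 has_real_derivative q2 r) (at r within {0..R})"
  proof (rule C2_on_radial_profile[OF assms(11) R e, of q])
    fix r assume r: "r \<in> {0..R}"
    then show "q r = enn2real (Q (0, r *\<^sub>R e))" using Qq[of "r *\<^sub>R e"] e q0[OF r] by simp
  qed blast
  define C where "C = dens_C d lam R q"
  interpret radial_field_space n lam R s qq q1 q2 C "TYPE('a)"
    using n assms(3,4) R s qq q0 by unfold_locales auto
  have \<mu>: "sets \<mu> = sets borel" "emeasure \<mu> UNIV = 1" "msupport \<mu> \<subseteq> disk 1" "weighted_energy s Q \<mu> = min_energy s Q"
    using assms(7) by (auto simp: extremal_measure_def unit_measures_on_def)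
  \<comment> \<open>Ensures that lifts of measures on the ball of radius \<open>R\<close> are
    admissible for the extremal problem on the unit disk.\<close>
  have R1: "R \<le> 1"
  proof -
    have "(0, R *\<^sub>R e) \<in> msupport \<mu>" using assms(9) R e by (simp add: disk_def)
    then have "(0, R *\<^sub>R e) \<in> disk 1" using \<mu>(3) by blast
    then show ?thesis using R e by (simp add: disk_def)
  qed
  have \<mu>_AE: "AE p in \<mu>. p \<in> disk R"
  proof (rule AE_I'[of "- disk R"])
    show "- disk R \<in> null_sets \<mu>"
      using emeasure_Compl_msupport[OF \<mu>(1)] closed_disk[of R] unfolding assms(9) by (auto simp: null_sets_def \<mu>(1) intro!: borel_open open_Compl)
  qed auto
  define M where "M = distr \<mu> borel snd"
  have snd: "snd \<in> \<mu> \<rightarrow>\<^sub>M borel"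
    unfolding measurable_cong_sets[OF \<mu>(1) refl] by (intro borel_measurable_continuous_onI continuous_intros)
  have lift: "lift_measure M = \<mu>" unfolding M_def by (rule lift_snd_eq[OF \<mu>(1) \<mu>_AE])
  have setsM: "sets M = sets borel" by (simp add: M_def)
  have space_\<mu>: "space \<mu> = UNIV" using sets_eq_imp_space_eq[OF \<mu>(1)] by simp
  have M1: "emeasure M UNIV = 1" unfolding M_def using \<mu>(2) by (subst emeasure_distr[OF snd]) (auto simp: space_\<mu>)
  have M_conc: "AE y in M. norm y \<le> R"
    unfolding M_def by (subst AE_distr_iff[OF snd]) (use \<mu>_AE in \<open>auto simp: disk_def elim!: eventually_mono\<close>)
  define u where "u = (\<lambda>y::'a. qq (norm y))"
  have u_meas: "u \<in> borel_measurable borel" unfolding u_def by measurable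
  have Qu: "Q (0, y) = ennreal (u y)" if "norm y \<le> R" for y :: 'a
    using Qq[OF that] qq(4)[of "norm y"] that by (simp add: u_def)
  have energy: "weighted_energy s Q (lift_measure N) = mutual_energy s N N + 2 * (\<integral>\<^sup>+y. ennreal (u y) \<partial>N)"
    if "sets N = sets borel" "emeasure N UNIV = 1" "AE y in N. norm y \<le> R" for N :: "'a measure"
    by (rule weighted_energy_lift[OF that R1 Qu u_meas])
  have minimal: "mutual_energy s M M + 2 * (\<integral>\<^sup>+y. ennreal (u y) \<partial>M) \<le> mutual_energy s N N + 2 * (\<integral>\<^sup>+y. ennreal (u y) \<partial>N)"
    if N: "sets N = sets borel" "emeasure N UNIV = 1" "AE y in N. norm y \<le> R" for N :: "'a measure"
  proof -
    have "weighted_energy s Q \<mu> \<le> weighted_energy s Q (lift_measure N)"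
      unfolding \<mu>(4) min_energy_def by (rule INF_lower) (rule lift_measure_unit[OF N R1])
    then show ?thesis using energy[OF N] energy[OF setsM M1 M_conc] lift by simp
  qed
  \<comment> \<open>The uniform distribution on the ball has finite weighted energy, which bounds
    that of the minimizer.\<close>
  have M_fin: "mutual_energy s M M < top"
  proof -
    define N where "N = uniform_measure lborel (cball (0::'a) R)"
    have vol: "emeasure lborel (cball (0::'a) R) \<noteq> 0" "emeasure lborel (cball (0::'a) R) < top"
      using R unit_ball_vol_pos[of "real DIM('a)"] by (auto simp: emeasure_cball simp del: unit_ball_vol_pos)
    have AE_N: "AE y in N. norm y \<le> R"
      unfolding N_def by (rule AE_uniform_measureI) auto
    have N: "sets N = sets borel" "emeasure N UNIV = 1" "AE y in N. norm y \<le> R"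
      using vol AE_N by (auto simp: N_def)
    have "mutual_energy s N N < top"
      unfolding N_def using vol ball_lebesgue_energy_finite[OF lam s_DIM s_pos R]
      by (intro mutual_energy_uniform_measure_finite sigma_finite_lborel) auto
    moreover have "(\<integral>\<^sup>+y. ennreal (u y) \<partial>N) < top"
    proof -
      obtain B where B: "B \<ge> 0" "\<And>x. x \<in> {0..R} \<Longrightarrow> \<bar>qq x\<bar> \<le> B"
        using continuous_on_Icc_bounded[of 0 R qq] continuous_on_subset[OF qq(1)] by blast
      have "(\<integral>\<^sup>+y. ennreal (u y) \<partial>N) \<le> (\<integral>\<^sup>+y. ennreal B \<partial>N)"
      proof (intro nn_integral_mono_AE, rule AE_mp[OF N(3)], intro AE_I2 impI)
        fix y :: 'a assume "norm y \<le> R"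
        then have "\<bar>u y\<bar> \<le> B" unfolding u_def by (intro B) auto
        then show "ennreal (u y) \<le> ennreal B" by (intro ennreal_leI) linarith
      qed
      also have "\<dots> < top" using N(2) sets_eq_imp_space_eq[OF N(1)] by simp
      finally show ?thesis .
    qed
    ultimately have "mutual_energy s N N + 2 * (\<integral>\<^sup>+y. ennreal (u y) \<partial>N) < top"
      by (simp add: ennreal_mult_less_top)
    from order.strict_trans1[OF minimal[OF N] this] show ?thesis by simp
  qed
  have M_supp: "emeasure M V > 0" if V: "norm x \<le> R" "open V" "x \<in> V" for x :: 'a and V
  proof -
    have "emeasure M V = emeasure \<mu> (UNIV \<times> V)"
      unfolding M_def using V by (subst emeasure_distr[OF snd]) (auto simp: space_\<mu> intro!: arg_cong[where f="emeasure \<mu>"])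
    moreover have "(0, x) \<in> msupport \<mu>" using V by (simp add: assms(9) disk_def)
    moreover have "open ((UNIV :: real set) \<times> V)" using V by (intro open_Times) auto
    ultimately show ?thesis using V by (auto simp: msupport_def)
  qed
  have q_eq: "\<And>r. r \<in> {0..R} \<Longrightarrow> q r = qq r" using qq(4) by simp
  have C: "C = dens_C (Suc n) lam R q" by (simp add: C_def n(2))
  interpret disk_problem n lam R s qq q1 q2 C M
  proof unfold_locales
    show "continuous_on UNIV (\<lambda>x::'a. qq (norm x))"
      by (rule continuous_on_compose2[OF qq(1)]) (auto intro!: continuous_intros)
    show "measure (Mpos :: 'a measure) UNIV - measure (Mneg :: 'a measure) UNIV = 1"
      by (rule mass_eq_1[OF q_eq C])
    fix x :: 'a and V assume "norm x \<le> R"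
    then show "0 \<le> qq (norm x)" using q0[of "norm x"] qq(4)[of "norm x"] by simp
  qed (use s_pos setsM M1 M_conc M_fin minimal[unfolded u_def] M_supp in auto)
  define f where "f = dens_f d lam R q"
  \<comment> \<open>A Borel function that agrees with \<open>f\<close> on all of
    \<open>{0..R}\<close>, endpoints included; \<open>f\<close> itself is built from
    \<open>deriv\<close> and \<open>integral\<close>, so its measurability is not at hand.\<close>
  define fh where "fh = (\<lambda>r. profile r + f 0 * indicator {0} r + f R * indicator {R} r)"
  have [measurable]: "fh \<in> borel_measurable borel" unfolding fh_def by measurable
  have f_eq: "f r = fh r" if r: "r \<in> {0..R}" for r
  proof -
    consider "r = 0" | "r = R" | "r \<in> {0<..<R}" using r by force
    then show ?thesis
    proof cases
      case 3
      then show ?thesis using dens_f_eq_profile[OF q_eq C 3] by (simp add: f_def fh_def n(2))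
    qed (use R in \<open>auto simp: fh_def profile_def\<close>)
  qed
  let ?P = "restrict_space lborel {0..R} \<Otimes>\<^sub>M (sphere_measure :: 'a measure)"
  have main: "integrable ?P (\<lambda>(r, w). indicat_real A (0, r *\<^sub>R w) * (f r * r ^ (d - 2))) \<and>
      measure \<mu> A = (\<integral>(r, w). indicat_real A (0, r *\<^sub>R w) * (f r * r ^ (d - 2)) \<partial>?P)"
    if A: "A \<in> sets borel" for A :: "(real \<times> 'a) set"
  proof -
    \<comment> \<open>The slice of \<open>A\<close> in the hyperplane of the disk, the only part
      that \<open>\<mu>\<close> sees.\<close>
    define A' where "A' = (\<lambda>y::'a. (0::real, y)) -` A"
    have A'[measurable]: "A' \<in> sets borel" unfolding A'_def using measurable_sets[OF lift_measurable A] by simp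
    define g where "g = (\<lambda>x::'a. indicator A' x * fh (norm x) :: real)"
    have [measurable]: "g \<in> borel_measurable borel" unfolding g_def by measurable
    have AE: "AE x in lborel. indicator A' x * profile (norm x) = g x * indicator (cball 0 R) x"
      using AE_norm_neq by eventually_elim (auto simp: g_def fh_def profile_def indicator_def)
    have [measurable]: "cball (0::'a) R \<in> sets borel" by simp
    have int: "integrable lborel (\<lambda>x. g x * indicator (cball 0 R) x)"
      by (rule integrable_cong_AE_imp[OF measure_diff(1)[OF A']]) (use AE in auto)
    have meas: "measure \<mu> A = (\<integral>x. g x * indicator (cball 0 R) x \<partial>lborel)"
    proof -
      have "measure \<mu> A = measure M A'"
        unfolding lift[symmetric] lift_measure_def A'_def using A setsM
        by (subst measure_distr) (auto simp: measurable_cong_sets[OF setsM refl] sets_eq_imp_space_eq[OF setsM])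
      also have "\<dots> = (\<integral>x. indicator A' x * profile (norm x) \<partial>lborel)" by (rule measure_M[OF A'])
      also have "\<dots> = (\<integral>x. g x * indicator (cball 0 R) x \<partial>lborel)" by (intro integral_cong_AE AE) measurable
      finally show ?thesis .
    qed
    have eq: "(case p of (r, w) \<Rightarrow> indicat_real A (0, r *\<^sub>R w) * (f r * r ^ (d - 2))) = (case p of (r, w) \<Rightarrow> g (r *\<^sub>R w) * r ^ (DIM('a) - 1))"
      if "p \<in> space ?P" for p
      using that assms(2) f_eq by (auto simp: space_pair_measure space_restrict_space g_def A'_def indicator_def numeral_2_eq_2)
    show ?thesis
      using integral_polar_disk[OF _ int] meas
      by (simp add: Bochner_Integration.integrable_cong[OF refl eq] Bochner_Integration.integral_cong[OF refl eq])
  qed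
  have "integrable ?P (\<lambda>(r, w). f r * r ^ (d - 2))" using main[of UNIV] by simp
  then show ?thesis
    unfolding has_polar_density_def Let_def f_def[symmetric] using main by blast
qed

end
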